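(* Let $n$ be a positive odd integer. For generic $x,y\in\mathbb{C}^*$, \[ f_{n,n+4,n}(x,y,q)=g_{n,n+4,n}(x,y,q,y^n/x^n,x^n/y^n)-\Theta_{n,4}(x,y,q), \] where, writing $Q=q^{4(2n+4)}$, \[ \Theta_{n,4}(x,y,q):=\frac{q^{-(n^2+n-3)}x^{-(n-3)/2}y^{(n+1)/2}\,j(y/x;Q)}{j(y^n/x^n;q^{4n(2n+4)})\,j(-q^{2n+8}x^4;Q)\,j(-q^{2n+8}y^4;Q)}\Big\{J_{4n,16n}S_1-qJ_{8n,16n}S_2\Big\}, \] with \begin{align*} S_1:=&\frac{j(q^{6n+16}x^2y^2;Q)\,j(-q^{2(2n+4)}y/x;Q)\,j(q^{n+4}xy;q^{2(2n+4)})}{J_{2(2n+4)}^3J_{8(2n+4)}}\\ &\cdot\Big\{j(-q^{2n+8}x^2y^2;Q)\,j(q^{2(2n+4)}y^2/x^2;Q)\,J_{4(2n+4)}^2+\frac{q^{n+4}x^2\,j(-q^{6n+16}x^2y^2;Q)\,j(q^{2(2n+4)}y/x;Q)^2\,j(-y/x;Q)^2}{J_{4(2n+4)}}\Big\},\\ S_2:=&\frac{j(q^{2n+8}x^2y^2;Q)\,j(-y/x;Q)\,j(q^{3n+8}xy;q^{2(2n+4)})}{J_{2(2n+4)}^2}\\ &\cdot\Big\{\frac{q^{n+1}j(-q^{2n+8}x^2y^2;Q)\,j(q^{2(2n+4)}y^2/x^2;Q)\,J_{8(2n+4)}}{y\,J_{4(2n+4)}}+\frac{qx\,j(-q^{6n+16}x^2y^2;Q)\,j(q^{4(2n+4)}y^2/x^2;q^{8(2n+4)})^2}{J_{8(2n+4)}}\Big\}.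 \end{align*}
   Context: Let $q\in\mathbb{C}$ with $0<|q|<1$. $j(x;q):=(x;q)_\infty(q/x;q)_\infty(q;q)_\infty=\sum_{n\in\mathbb{Z}}(-1)^nq^{\binom n2}x^n$; $J_{a,m}:=j(q^a;q^m)$; $J_m:=J_{m,3m}=\prod_{i\ge1}(1-q^{mi})$. $m(x,q,z):=\frac{1}{j(z;q)}\sum_{r\in\mathbb{Z}}\frac{(-1)^rq^{\binom r2}z^r}{1-q^{r-1}xz}$. With $\mathrm{sg}(r)=1$ for $r\ge0$, $-1$ for $r<0$: $f_{a,b,c}(x,y,q):=\sum_{\mathrm{sg}(r)=\mathrm{sg}(s)}\mathrm{sg}(r)(-1)^{r+s}x^ry^sq^{a\binom r2+brs+c\binom s2}$ and \begin{align*} g_{a,b,c}(x,y,q,z_1,z_0):=&\sum_{t=0}^{a-1}(-y)^tq^{c\binom t2}j(q^{bt}x;q^a)\,m\Big(-q^{a\binom{b+1}{2}-c\binom{a+1}{2}-t(b^2-ac)}\frac{(-y)^a}{(-x)^b},q^{a(b^2-ac)},z_0\Big)\\ &+\sum_{t=0}^{c-1}(-x)^tq^{a\binom t2}j(q^{bt}y;q^c)\,m\Big(-q^{c\binom{b+1}{2}-a\binom{c+1}{2}-t(b^2-ac)}\frac{(-x)^c}{(-y)^b},q^{c(b^2-ac)},z_1\Big). \end{align*} "Generic" means no poles occur in the Appell–Lerch sums or theta quotients. *)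

theory Defs
  imports "HOL-Analysis.Analysis"
begin

text \<open>Binomial coefficient \<open>r choose 2\<close> at an arbitrary integer.\<close>
definition tri :: "int \<Rightarrow> int" where
  "tri r = (r * (r - 1)) div 2"

definition qpoch_inf :: "complex \<Rightarrow> complex \<Rightarrow> complex" where
  "qpoch_inf x q = (\<Prod>i. 1 - x * q ^ i)"

definition jtheta :: "complex \<Rightarrow> complex \<Rightarrow> complex" where
  "jtheta x q = qpoch_inf x q * qpoch_inf (q / x) q * qpoch_inf q q"

definition J2 :: "int \<Rightarrow> int \<Rightarrow> complex \<Rightarrow> complex" where
  "J2 a m q = jtheta (q powi a) (q powi m)"

definition J1 :: "int \<Rightarrow> complex \<Rightarrow> complex" where
  "J1 m q = J2 m (3 * m) q"

definition appell_m :: "complex \<Rightarrow> complex \<Rightarrow> complex \<Rightarrow> complex" where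
  "appell_m x q z =
     (1 / jtheta z q) *
     (\<Sum>\<^sub>\<infinity>r\<in>(UNIV :: int set).
        ((-1) powi r * q powi (tri r) * z powi r) / (1 - q powi (r - 1) * x * z))"

text \<open>No summand of \<open>appell_m x q z\<close>, and not its prefactor, has a pole.\<close>
definition appell_no_pole :: "complex \<Rightarrow> complex \<Rightarrow> complex \<Rightarrow> bool" where
  "appell_no_pole x q z \<longleftrightarrow>
     jtheta z q \<noteq> 0 \<and> (\<forall>r::int. 1 - q powi (r - 1) * x * z \<noteq> 0)"

text \<open>Unlike \<open>sgn\<close>, this takes the value 1 at 0.\<close>
definition sg :: "int \<Rightarrow> int" where
  "sg r = (if r \<ge> 0 then 1 else -1)"

definition hecke_f ::
  "int \<Rightarrow> int \<Rightarrow> int \<Rightarrow> complex \<Rightarrow> complex \<Rightarrow> complex \<Rightarrow> complex" where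
  "hecke_f a b c x y q =
     (\<Sum>\<^sub>\<infinity>(r, s)\<in>{(r, s). sg r = sg s}.
        of_int (sg r) * (-1) powi (r + s) * x powi r * y powi s *
        q powi (a * tri r + b * r * s + c * tri s))"

text \<open>First argument of the Appell--Lerch sums in the first sum defining \<open>hecke_g\<close>; the
  second sum arises from it by exchanging \<open>a\<close> with \<open>c\<close> and \<open>x\<close> with \<open>y\<close>.\<close>
definition hecke_g_arg ::
  "int \<Rightarrow> int \<Rightarrow> int \<Rightarrow> complex \<Rightarrow> complex \<Rightarrow> complex \<Rightarrow> int \<Rightarrow> complex" where
  "hecke_g_arg a b c x y q t =
     - (q powi (a * tri (b + 1) - c * tri (a + 1) - t * (b\<^sup>2 - a * c)) *
        ((- y) powi a / (- x) powi b))"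

definition hecke_g ::
  "int \<Rightarrow> int \<Rightarrow> int \<Rightarrow> complex \<Rightarrow> complex \<Rightarrow> complex \<Rightarrow> complex \<Rightarrow> complex \<Rightarrow> complex" where
  "hecke_g a b c x y q z1 z0 =
     (\<Sum>t\<in>{0..a - 1}. (- y) powi t * q powi (c * tri t) *
        jtheta (q powi (b * t) * x) (q powi a) *
        appell_m (hecke_g_arg a b c x y q t) (q powi (a * (b\<^sup>2 - a * c))) z0) +
     (\<Sum>t\<in>{0..c - 1}. (- x) powi t * q powi (a * tri t) *
        jtheta (q powi (b * t) * y) (q powi c) *
        appell_m (hecke_g_arg c b a y x q t) (q powi (c * (b\<^sup>2 - a * c))) z1)"

definition hecke_g_no_pole ::
  "int \<Rightarrow> int \<Rightarrow> int \<Rightarrow> complex \<Rightarrow> complex \<Rightarrow> complex \<Rightarrow> complex \<Rightarrow> complex \<Rightarrow> bool" where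
  "hecke_g_no_pole a b c x y q z1 z0 \<longleftrightarrow>
     (\<forall>t\<in>{0..a - 1}.
        appell_no_pole (hecke_g_arg a b c x y q t) (q powi (a * (b\<^sup>2 - a * c))) z0) \<and>
     (\<forall>t\<in>{0..c - 1}.
        appell_no_pole (hecke_g_arg c b a y x q t) (q powi (c * (b\<^sup>2 - a * c))) z1)"

definition S1 :: "int \<Rightarrow> complex \<Rightarrow> complex \<Rightarrow> complex \<Rightarrow> complex" where
  "S1 n x y q =
     (let N = 2 * n + 4; Q = q powi (4 * N) in
      (jtheta (q powi (6 * n + 16) * x\<^sup>2 * y\<^sup>2) Q *
       jtheta (- (q powi (2 * N) * y / x)) Q *
       jtheta (q powi (n + 4) * x * y) (q powi (2 * N))) /
      ((J1 (2 * N) q) ^ 3 * J1 (8 * N) q) *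
      (jtheta (- (q powi (2 * n + 8) * x\<^sup>2 * y\<^sup>2)) Q *
         jtheta (q powi (2 * N) * y\<^sup>2 / x\<^sup>2) Q * (J1 (4 * N) q)\<^sup>2 +
       (q powi (n + 4) * x\<^sup>2 * jtheta (- (q powi (6 * n + 16) * x\<^sup>2 * y\<^sup>2)) Q *
         (jtheta (q powi (2 * N) * y / x) Q)\<^sup>2 * (jtheta (- (y / x)) Q)\<^sup>2) /
       J1 (4 * N) q))"

definition S2 :: "int \<Rightarrow> complex \<Rightarrow> complex \<Rightarrow> complex \<Rightarrow> complex" where
  "S2 n x y q =
     (let N = 2 * n + 4; Q = q powi (4 * N) in
      (jtheta (q powi (2 * n + 8) * x\<^sup>2 * y\<^sup>2) Q *
       jtheta (- (y / x)) Q *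
       jtheta (q powi (3 * n + 8) * x * y) (q powi (2 * N))) /
      (J1 (2 * N) q)\<^sup>2 *
      ((q powi (n + 1) * jtheta (- (q powi (2 * n + 8) * x\<^sup>2 * y\<^sup>2)) Q *
         jtheta (q powi (2 * N) * y\<^sup>2 / x\<^sup>2) Q * J1 (8 * N) q) /
       (y * J1 (4 * N) q) +
       (q * x * jtheta (- (q powi (6 * n + 16) * x\<^sup>2 * y\<^sup>2)) Q *
         (jtheta (q powi (4 * N) * y\<^sup>2 / x\<^sup>2) (q powi (8 * N)))\<^sup>2) /
       J1 (8 * N) q))"

text \<open>Meant for odd \<open>n\<close>, where the divisions by 2 in the exponents are exact.\<close>
definition Theta4 :: "int \<Rightarrow> complex \<Rightarrow> complex \<Rightarrow> complex \<Rightarrow> complex" where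
  "Theta4 n x y q =
     (let N = 2 * n + 4; Q = q powi (4 * N) in
      (q powi (- (n\<^sup>2 + n - 3)) * x powi (- ((n - 3) div 2)) * y powi ((n + 1) div 2) *
       jtheta (y / x) Q) /
      (jtheta (y powi n / x powi n) (q powi (4 * n * N)) *
       jtheta (- (q powi (2 * n + 8) * x ^ 4)) Q *
       jtheta (- (q powi (2 * n + 8) * y ^ 4)) Q) *
      (J2 (4 * n) (16 * n) q * S1 n x y q - q * J2 (8 * n) (16 * n) q * S2 n x y q))"

text \<open>The other denominators of \<open>Theta4\<close> are products of \<open>y\<close> and of factors
  \<open>J1 m q\<close> with \<open>m > 0\<close>, which never vanish for \<open>y \<noteq> 0\<close> and \<open>0 < |q| < 1\<close>.\<close>
definition Theta4_no_pole :: "int \<Rightarrow> complex \<Rightarrow> complex \<Rightarrow> complex \<Rightarrow> bool" where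
  "Theta4_no_pole n x y q \<longleftrightarrow>
     (let N = 2 * n + 4; Q = q powi (4 * N) in
      jtheta (y powi n / x powi n) (q powi (4 * n * N)) \<noteq> 0 \<and>
      jtheta (- (q powi (2 * n + 8) * x ^ 4)) Q \<noteq> 0 \<and>
      jtheta (- (q powi (2 * n + 8) * y ^ 4)) Q \<noteq> 0)"

end

theory Submission
  imports Defs "HOL-Complex_Analysis.Complex_Analysis"
begin

text \<open>
  Write \<open>n = 2h + 1\<close>, \<open>p = 4\<close>, \<open>Q = q^(p(2n+p))\<close>, \<open>P = Q^n\<close> and \<open>X(z) = -q^(2n+8) z^4\<close>, and consider
  \<open>E = j(y^n/x^n;P) (f - g + \<Theta>)\<close> as a function of \<open>y\<close>.  The theta factor cancels the prefactors of
  the Appell--Lerch sums, so the only possible singularities of \<open>E\<close> in \<open>y \<noteq> 0\<close> are the points where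
  \<open>X(y)\<close> is a power of \<open>Q\<close>.  Translating the summation lattice of \<open>f\<close> by \<open>(n + p, -n)\<close> changes \<open>f\<close> only
  by finitely many theta functions, which are exactly the defects of \<open>g\<close> under \<open>y \<mapsto> Qy\<close>; hence
  \<open>E(Qy) = (Q^(h+1)/X(x)) E(y)\<close>.  A function holomorphic in \<open>y \<noteq> 0\<close> with \<open>E(Qy) = C E(y)\<close> vanishes
  unless \<open>C\<close> is a power of \<open>Q\<close>, and \<open>X(x)\<close> is no such power because \<open>j(X(x);Q) \<noteq> 0\<close>.

  It remains to see that the singularities are removable.  At \<open>X(y) = Q^k\<close> exactly one summand of \<open>g\<close>
  is singular, and its numerator is, up to a monomial, a theta function.  Translating by \<open>(1, 1)\<close>, that
  is, multiplying \<open>x\<close> and \<open>y\<close> by \<open>q^(2n+p)\<close>, reduces to \<open>k = 0\<close>.  There \<open>S\<^sub>1\<close> and \<open>S\<^sub>2\<close> collapse to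
  multiples of \<open>j(X(x);Q)\<close>, and the numerator is a multiple of \<open>j(c;q^n)\<close> with \<open>c\<^sup>4 = -q^(2n)\<close>, whose
  even and odd parts are \<open>J\<^sub>8\<^sub>n\<^sub>,\<^sub>1\<^sub>6\<^sub>n\<close> and a multiple of \<open>J\<^sub>4\<^sub>n\<^sub>,\<^sub>1\<^sub>6\<^sub>n\<close>.  The value
  \<open>p = 4\<close> matters only for \<open>\<Theta>\<close> and this last step.
\<close>


section \<open>Infinite products\<close>

lemma norm_power_less_1:
  fixes q :: "'a :: real_normed_div_algebra"
  assumes "norm q < 1" "k > 0"
  shows "norm (q ^ k) < 1"
  using assms by (simp add: norm_power power_less_one_iff)

lemma norm_power_int_less_1: "norm (q :: complex) < 1 \<Longrightarrow> k > 0 \<Longrightarrow> norm (q powi k) < 1"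
  using norm_power_less_1[of q "nat k"] by (simp add: power_int_def)

lemma power_int_inj:
  assumes "norm (q :: complex) < 1" "q \<noteq> 0" "q powi a = q powi b"
  shows "a = b"
proof -
  have "norm q powi a = norm q powi b" using assms(3) by (metis norm_power_int)
  hence "\<not> a < b" "\<not> b < a"
    using power_int_strict_decreasing[of _ _ "norm q"] assms by force+
  thus ?thesis by simp
qed

lemma convergent_prod_qpoch:
  fixes q x :: complex
  assumes "norm q < 1"
  shows "convergent_prod (\<lambda>i. 1 - x * q ^ i)"
proof -
  have "summable (\<lambda>i. norm (- x * q ^ i))"
    using assms by (auto simp: norm_mult norm_power intro!: summable_mult summable_geometric)
  hence "abs_convergent_prod (\<lambda>i. 1 + (- x * q ^ i))"
    by (subst abs_convergent_prod_conv_summable) auto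
  thus ?thesis
    using abs_convergent_prod_imp_convergent_prod by fastforce
qed

lemma qpoch_inf_has_prod: "norm q < 1 \<Longrightarrow> (\<lambda>i. 1 - x * q ^ i) has_prod qpoch_inf x q"
  unfolding qpoch_inf_def by (intro convergent_prod_has_prod convergent_prod_qpoch)

lemma qpoch_inf_LIMSEQ:
  assumes "norm q < 1"
  shows "(\<lambda>N. \<Prod>i<N. 1 - x * q ^ i) \<longlonglongrightarrow> qpoch_inf x q"
  unfolding qpoch_inf_def LIMSEQ_lessThan_iff_atMost
  by (rule convergent_prod_LIMSEQ[OF convergent_prod_qpoch[OF assms]])

lemma qpoch_inf_unfold:
  assumes "norm q < 1"
  shows "qpoch_inf x q = (1 - x) * qpoch_inf (x * q) q"
  using has_prod_unique[OF has_prod_ignore_initial_segment'[OF convergent_prod_qpoch[OF assms, of x], of 1]]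
  by (simp add: qpoch_inf_def mult_ac)

lemma qpoch_inf_eq_0_iff:
  assumes "norm q < 1"
  shows "qpoch_inf x q = 0 \<longleftrightarrow> (\<exists>i. x * q ^ i = 1)"
  using has_prod_eq_0_iff[OF qpoch_inf_has_prod[OF assms, of x]] by force

lemma qpoch_inf_split:
  assumes "norm q < 1" "m > 0"
  shows "qpoch_inf x q = (\<Prod>j<m. qpoch_inf (x * q ^ j) (q ^ m))"
proof -
  have block: "(\<Prod>j<m. 1 - x * q ^ j * (q ^ m) ^ k) = (\<Prod>i\<in>{k * m..<k * m + m}. 1 - x * q ^ i)" for k
    by (rule prod.reindex_bij_witness[of _ "\<lambda>i. i - k * m" "\<lambda>j. j + k * m"])
       (auto simp: power_add power_mult[symmetric] mult_ac)
  have "(\<lambda>N. \<Prod>j<m. \<Prod>i<N. 1 - x * q ^ j * (q ^ m) ^ i) \<longlonglongrightarrow> (\<Prod>j<m. qpoch_inf (x * q ^ j) (q ^ m))"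
    using assms by (intro tendsto_prod qpoch_inf_LIMSEQ norm_power_less_1)
  also have "(\<lambda>N. \<Prod>j<m. \<Prod>i<N. 1 - x * q ^ j * (q ^ m) ^ i) = (\<lambda>N. \<Prod>i<N * m. 1 - x * q ^ i)"
    by (subst prod.swap) (simp only: block prod.nat_group)
  finally have "(\<lambda>N. \<Prod>i<N * m. 1 - x * q ^ i) \<longlonglongrightarrow> (\<Prod>j<m. qpoch_inf (x * q ^ j) (q ^ m))" .
  moreover have "(\<lambda>N. \<Prod>i<N * m. 1 - x * q ^ i) \<longlonglongrightarrow> qpoch_inf x q"
    using LIMSEQ_subseq_LIMSEQ[OF qpoch_inf_LIMSEQ[OF assms(1), of x], of "\<lambda>N. N * m"] assms(2)
    by (simp add: strict_mono_def o_def)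
  ultimately show ?thesis
    using LIMSEQ_unique by blast
qed

lemma qpoch_inf_split_2:
  assumes "norm q < 1"
  shows "qpoch_inf x q = qpoch_inf x (q\<^sup>2) * qpoch_inf (x * q) (q\<^sup>2)"
  using qpoch_inf_split[OF assms, of 2 x] by (simp add: lessThan_nat_numeral eval_nat_numeral mult.commute)

lemma qpoch_inf_split_3:
  assumes "norm q < 1"
  shows "qpoch_inf x q = qpoch_inf x (q ^ 3) * qpoch_inf (x * q) (q ^ 3) * qpoch_inf (x * q\<^sup>2) (q ^ 3)"
  using qpoch_inf_split[OF assms, of 3 x] by (simp add: lessThan_nat_numeral eval_nat_numeral mult_ac)

lemma qpoch_inf_square:
  assumes "norm q < 1"
  shows "qpoch_inf (x\<^sup>2) (q\<^sup>2) = qpoch_inf x q * qpoch_inf (- x) q"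
proof -
  have "1 - x\<^sup>2 * (q\<^sup>2) ^ i = (1 - x * q ^ i) * (1 - (- x) * q ^ i)" for i
    by (simp add: power2_eq_square power_mult_distrib algebra_simps)
  thus ?thesis
    unfolding qpoch_inf_def using prodinf_mult[OF convergent_prod_qpoch convergent_prod_qpoch] assms
    by presburger
qed

lemma qpoch_inf_self_nonzero:
  assumes "norm q < 1"
  shows "qpoch_inf q q \<noteq> 0"
proof
  assume "qpoch_inf q q = 0"
  then obtain i where "q * q ^ i = 1"
    using qpoch_inf_eq_0_iff[OF assms] by blast
  hence "norm (q ^ Suc i) = 1" by simp
  thus False using norm_power_less_1[OF assms, of "Suc i"] by simp
qed

lemma holomorphic_qpoch_inf:
  assumes "norm q < 1"
  shows "(\<lambda>x. qpoch_inf x q) holomorphic_on UNIV"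
proof (rule holomorphic_uniform_sequence[where f = "\<lambda>N x. \<Prod>i<N. 1 - x * q ^ i"])
  show "(\<lambda>x. \<Prod>i<N. 1 - x * q ^ i) holomorphic_on UNIV" for N
    by (intro holomorphic_intros)
  fix z :: complex
  have "uniformly_convergent_on (cball z 1) (\<lambda>N x. \<Sum>i<N. norm (1 - x * q ^ i - 1))"
  proof (rule Weierstrass_m_test')
    show "summable (\<lambda>i. (norm z + 1) * norm q ^ i)"
      using assms by (intro summable_mult summable_geometric) auto
    fix i and x assume "x \<in> cball z 1"
    hence "norm x \<le> norm z + 1"
      using norm_triangle_ineq2[of x z] by (simp add: dist_norm norm_minus_commute)
    thus "norm (norm (1 - x * q ^ i - 1)) \<le> (norm z + 1) * norm q ^ i"
      by (simp add: norm_mult norm_power mult_right_mono)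
  qed
  hence "uniformly_convergent_on (cball z 1) (\<lambda>N x. \<Prod>i<N. 1 - x * q ^ i)"
    by (intro uniformly_convergent_on_prod') (auto intro!: continuous_intros)
  hence "uniform_limit (cball z 1) (\<lambda>N x. \<Prod>i<N. 1 - x * q ^ i) (\<lambda>x. qpoch_inf x q) sequentially"
    unfolding uniformly_convergent_uniform_limit_iff limI[OF qpoch_inf_LIMSEQ[OF assms]] .
  thus "\<exists>d>0. cball z d \<subseteq> UNIV \<and>
      uniform_limit (cball z d) (\<lambda>N x. \<Prod>i<N. 1 - x * q ^ i) (\<lambda>x. qpoch_inf x q) sequentially"
    by (intro exI[of _ 1]) auto
qed auto

lemma analytic_on_qpoch_inf [analytic_intros]:
  assumes "norm q < 1" "g analytic_on A"
  shows "(\<lambda>z. qpoch_inf (g z) q) analytic_on A"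
proof -
  have "(\<lambda>x. qpoch_inf x q) analytic_on g ` A"
    using holomorphic_qpoch_inf[OF assms(1)] by (auto simp: analytic_on_holomorphic)
  thus ?thesis
    using analytic_on_compose[OF assms(2)] by (simp add: o_def)
qed

lemma J1_eq_qpoch_inf:
  assumes "norm q < 1" "q \<noteq> 0" "m > 0"
  shows "J1 m q = qpoch_inf (q powi m) (q powi m)"
proof -
  have base: "norm (q powi m) < 1"
    using assms by (intro norm_power_int_less_1)
  have cube: "q powi (3 * m) = (q powi m) ^ 3"
    by (simp add: power_int_mult mult.commute[of 3])
  show ?thesis
    unfolding J1_def J2_def jtheta_def cube using assms qpoch_inf_split_3[OF base, of "q powi m"]
    by (simp add: power3_eq_cube power2_eq_square mult_ac)
qed


section \<open>Theta functions\<close>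

lemma jtheta_reflect: "q \<noteq> 0 \<Longrightarrow> jtheta (q / x) q = jtheta x q"
  unfolding jtheta_def by (cases "x = 0") (auto simp: mult_ac)

lemma jtheta_inverse:
  assumes "norm q < 1" "x \<noteq> 0"
  shows "jtheta (1 / x) q = - jtheta x q / x"
proof -
  have "jtheta (1 / x) q = (1 - 1 / x) * qpoch_inf (q / x) q * qpoch_inf (q * x) q * qpoch_inf q q"
    unfolding jtheta_def using qpoch_inf_unfold[OF assms(1), of "1 / x"] by (simp add: mult.commute)
  moreover have "jtheta x q = (1 - x) * qpoch_inf (q * x) q * qpoch_inf (q / x) q * qpoch_inf q q"
    unfolding jtheta_def using qpoch_inf_unfold[OF assms(1), of x] by (simp add: mult.commute)
  ultimately show ?thesis
    using assms(2) by (simp add: divide_simps) (simp add: algebra_simps)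
qed

lemma jtheta_mult_base:
  assumes "norm q < 1" "q \<noteq> 0" "x \<noteq> 0"
  shows "jtheta (q * x) q = - jtheta x q / x"
  using jtheta_inverse[OF assms(1,3)] jtheta_reflect[of q "1 / x"] assms by simp

lemma jtheta_mult_base_eq:
  assumes "norm q < 1" "q \<noteq> 0" "x \<noteq> 0" "z = q * x"
  shows "jtheta z q = - jtheta x q / x"
  using jtheta_mult_base assms by simp

lemma jtheta_mult_base_squared_eq:
  assumes "norm q < 1" "q \<noteq> 0" "x \<noteq> 0" "z = q\<^sup>2 * x"
  shows "jtheta z q = jtheta x q / (q * x\<^sup>2)"
  using jtheta_mult_base[OF assms(1,2), of "q * x"] jtheta_mult_base[OF assms(1-3)] assms
  by (simp add: power2_eq_square mult_ac)

lemma tri_Suc: "tri (r + 1) = tri r + r"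
proof -
  have "(r + 1) * (r + 1 - 1) = r * (r - 1) + 2 * r" by (simp add: algebra_simps)
  thus ?thesis unfolding tri_def by simp
qed

lemma two_tri: "2 * tri r = r * (r - 1)"
  unfolding tri_def by (rule dvd_mult_div_cancel) simp

lemma tri_0 [simp]: "tri 0 = 0" and tri_1 [simp]: "tri 1 = 0"
  by (simp_all add: tri_def)

lemma tri_add: "tri (a + b) = tri a + tri b + a * b"
proof -
  have "2 * tri (a + b) = 2 * (tri a + tri b + a * b)"
    unfolding distrib_left two_tri by (simp add: algebra_simps)
  thus ?thesis by simp
qed

lemma tri_uminus: "tri (- r) = tri r + r"
proof -
  have "2 * tri (- r) = 2 * (tri r + r)"
    unfolding distrib_left two_tri by (simp add: algebra_simps)
  thus ?thesis by simp
qed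

lemma tri_diff: "tri (a - b) = tri a + tri b + b - a * b"
  using tri_add[of a "- b"] by (simp add: tri_uminus)

lemma tri_double: "tri (2 * a) = 4 * tri a + a"
proof -
  have "2 * tri (2 * a) = 2 * (4 * tri a + a)"
    unfolding distrib_left mult.assoc mult.left_commute[of 2 4] two_tri by (simp add: algebra_simps)
  thus ?thesis by simp
qed

lemma mult_self_eq_tri: "k * k = 2 * tri k + k" "k * (k * l) = (2 * tri k + k) * l"
proof -
  show square: "k * k = 2 * tri k + k"
    using two_tri[of k] by (simp add: right_diff_distrib)
  show "k * (k * l) = (2 * tri k + k) * l"
    unfolding square[symmetric] by (simp add: mult.assoc)
qed

lemma tri_odd: "tri (2 * h + 1) = h * (2 * h + 1)"
  unfolding tri_def by (simp add: mult.commute)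

lemma int_step_induct:
  fixes P :: "int \<Rightarrow> bool"
  assumes "P 0" "\<And>k. P k \<longleftrightarrow> P (k + 1)"
  shows "P k"
proof (induction k rule: int_induct[of _ 0])
  case (step2 i)
  thus ?case using assms(2)[of "i - 1"] by simp
qed (use assms in auto)

lemma jtheta_shift:
  assumes "norm q < 1" "q \<noteq> 0" "x \<noteq> 0"
  shows "jtheta (q powi m * x) q = (-1) powi m * q powi (- tri m) * x powi (- m) * jtheta x q"
proof (induction m rule: int_step_induct)
  case (2 m)
  have "jtheta (q powi (m + 1) * x) q = - jtheta (q powi m * x) q / (q powi m * x)"
    using jtheta_mult_base[OF assms(1,2), of "q powi m * x"] assms by (simp add: power_int_add mult_ac)
  moreover have "(-1) powi (m + 1) * q powi (- tri (m + 1)) * x powi (- (m + 1)) * jtheta x q =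
      - ((-1) powi m * q powi (- tri m) * x powi (- m) * jtheta x q) / (q powi m * x)"
    using assms by (simp add: power_int_add tri_Suc power_int_diff power_int_minus divide_inverse mult_ac)
  ultimately show ?case using assms by simp
qed simp

lemma jtheta_eq_0_iff:
  assumes "norm q < 1" "q \<noteq> 0" "x \<noteq> 0"
  shows "jtheta x q = 0 \<longleftrightarrow> (\<exists>m::int. x = q powi m)"
proof
  assume "jtheta x q = 0"
  then consider i where "x * q ^ i = 1" | i where "q / x * q ^ i = 1"
    using qpoch_inf_self_nonzero[OF assms(1)] by (auto simp: jtheta_def qpoch_inf_eq_0_iff[OF assms(1)])
  thus "\<exists>m::int. x = q powi m"
  proof cases
    case 1
    hence "x = q powi (- int i)" using assms by (simp add: power_int_minus field_simps)
    thus ?thesis by blast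
  next
    case 2
    hence "x = q powi (int (Suc i))" using assms by (simp add: field_simps del: of_nat_Suc)
    thus ?thesis by blast
  qed
next
  assume "\<exists>m::int. x = q powi m"
  then obtain m :: int where "x = q powi m" by blast
  moreover have "jtheta 1 q = 0" using jtheta_inverse[OF assms(1), of 1] by simp
  ultimately show "jtheta x q = 0" using jtheta_shift[OF assms(1,2), of 1 m] by simp
qed

lemma analytic_on_jtheta [analytic_intros]:
  assumes "norm q < 1" "g analytic_on A" "\<And>z. z \<in> A \<Longrightarrow> g z \<noteq> 0"
  shows "(\<lambda>z. jtheta (g z) q) analytic_on A"
  unfolding jtheta_def using assms by (intro analytic_intros)

text \<open>\<open>j(z;q)\<close> without the factor of the product that vanishes at \<open>z = q^k\<close>.\<close>
definition jtheta_cofactor :: "complex \<Rightarrow> int \<Rightarrow> complex \<Rightarrow> complex" where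
  "jtheta_cofactor q k z = (-1) powi (k + 1) * q powi (- tri k) * (z / q powi k) powi (1 - k) *
     (qpoch_inf (q * (z / q powi k)) q * qpoch_inf (q / (z / q powi k)) q * qpoch_inf q q)"

lemma jtheta_eq_cofactor:
  assumes "norm q < 1" "q \<noteq> 0" "z \<noteq> 0"
  shows "jtheta z q = (1 - q powi k / z) * jtheta_cofactor q k z"
proof -
  define u where "u = z / q powi k"
  have u: "u \<noteq> 0" "z = q powi k * u" "q powi k / z = 1 / u" using assms by (auto simp: u_def)
  have "jtheta u q = (1 - u) * (qpoch_inf (q * u) q * qpoch_inf (q / u) q * qpoch_inf q q)"
    unfolding jtheta_def using qpoch_inf_unfold[OF assms(1), of u] by (simp add: mult_ac)
  also have "1 - u = - u * (1 - 1 / u)"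
    using u(1) by (simp add: field_simps)
  finally have "jtheta z q = (-1) powi k * q powi (- tri k) * u powi (- k) *
     - (u * ((1 - 1 / u) * (qpoch_inf (q * u) q * qpoch_inf (q / u) q * qpoch_inf q q)))"
    using jtheta_shift[OF assms(1,2) u(1), of k] u(2) by simp
  moreover have "u powi (1 - k) = u * u powi (- k)" "(-1 :: complex) powi (k + 1) = - ((-1) powi k)"
    using u(1) power_int_add[of u 1 "- k"] by (simp_all add: power_int_add)
  ultimately show ?thesis
    unfolding jtheta_cofactor_def u_def[symmetric] u(3) by (simp add: mult_ac)
qed

lemma jtheta_cofactor_at_zero:
  assumes "q \<noteq> 0"
  shows "jtheta_cofactor q k (q powi k) = (-1) powi (k + 1) * q powi (- tri k) * qpoch_inf q q ^ 3"
  using assms by (simp add: jtheta_cofactor_def power3_eq_cube)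

lemma jtheta_cofactor_at_zero_Suc:
  assumes "q \<noteq> 0"
  shows "jtheta_cofactor q (k + 1) (q powi (k + 1)) = - jtheta_cofactor q k (q powi k) / q powi k"
  unfolding jtheta_cofactor_at_zero[OF assms] tri_Suc using assms by (simp add: power_int_add power_int_diff)

lemma jtheta_cofactor_at_zero_nonzero:
  assumes "norm q < 1" "q \<noteq> 0"
  shows "jtheta_cofactor q k (q powi k) \<noteq> 0"
  using assms qpoch_inf_self_nonzero[OF assms(1)] by (simp add: jtheta_cofactor_at_zero)

lemma analytic_on_jtheta_cofactor [analytic_intros]:
  assumes "norm q < 1" "q \<noteq> 0" "g analytic_on A" "\<And>z. z \<in> A \<Longrightarrow> g z \<noteq> 0"
  shows "(\<lambda>z. jtheta_cofactor q k (g z)) analytic_on A"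
  unfolding jtheta_cofactor_def using assms by (intro analytic_intros) auto


section \<open>Jacobi's triple product identity\<close>

definition theta_term :: "complex \<Rightarrow> complex \<Rightarrow> int \<Rightarrow> complex" where
  "theta_term q x r = (-1) powi r * q powi (tri r) * x powi r"

lemma theta_term_0 [simp]: "theta_term q x 0 = 1"
  by (simp add: theta_term_def)

lemma theta_term_Suc: "q \<noteq> 0 \<Longrightarrow> x \<noteq> 0 \<Longrightarrow> theta_term q x (r + 1) = - (x * q powi r * theta_term q x r)"
  unfolding theta_term_def by (simp add: power_int_add tri_Suc)

lemma theta_term_mult: "theta_term q (q powi j * x) r = q powi (j * r) * theta_term q x r"
  unfolding theta_term_def by (simp add: power_int_mult_distrib power_int_mult)

lemma norm_theta_term: "norm (theta_term q x r) = norm q powi (tri r) * norm x powi r"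
  by (simp add: theta_term_def norm_mult norm_power_int)

lemma summable_gauss_nat:
  fixes p z :: real
  assumes "0 < p" "p < 1" "0 < z"
  shows "summable (\<lambda>n. p powi (tri (int n)) * z ^ n)"
proof -
  have "(\<lambda>n. p ^ n * z) \<longlonglongrightarrow> 0 * z"
    using assms by (intro tendsto_intros LIMSEQ_power_zero) auto
  hence "eventually (\<lambda>n. p ^ n * z < 1 / 2) sequentially"
    by (intro order_tendstoD(2)[of _ "0 * z"]) auto
  then obtain N where N: "\<And>n. n \<ge> N \<Longrightarrow> p ^ n * z < 1 / 2"
    by (auto simp: eventually_sequentially)
  show ?thesis
  proof (rule summable_ratio_test[of "1 / 2" N])
    fix n assume "n \<ge> N"
    have "p powi (tri (int (Suc n))) * z ^ Suc n = (p ^ n * z) * (p powi (tri (int n)) * z ^ n)"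
      using tri_Suc[of "int n"] assms by (simp add: power_int_add add.commute)
    thus "norm (p powi (tri (int (Suc n))) * z ^ Suc n) \<le> 1 / 2 * norm (p powi (tri (int n)) * z ^ n)"
      using N[OF \<open>n \<ge> N\<close>] assms by (simp add: norm_mult mult_right_mono)
  qed simp
qed

lemma summable_on_gauss:
  fixes p z :: real
  assumes "0 < p" "p < 1" "0 < z"
  shows "(\<lambda>r::int. p powi (tri r) * z powi r) summable_on UNIV"
proof -
  let ?f = "\<lambda>r::int. p powi (tri r) * z powi r"
  have nonneg: "?f summable_on range int"
    using summable_gauss_nat[OF assms] assms
    by (subst summable_on_reindex) (auto simp: o_def intro!: summable_nonneg_imp_summable_on)
  have nonpos: "?f summable_on range (\<lambda>n. - int n)"
  proof (subst summable_on_reindex)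
    have "?f \<circ> (\<lambda>n. - int n) = (\<lambda>n. p powi (tri (int n)) * (p / z) ^ n)"
      using assms by (auto simp: o_def tri_uminus power_int_add power_int_minus power_divide field_simps)
    thus "(?f \<circ> (\<lambda>n. - int n)) summable_on UNIV"
      using summable_gauss_nat[of p "p / z"] assms by (simp add: summable_nonneg_imp_summable_on)
  qed (auto simp: inj_on_def)
  have "UNIV = range int \<union> range (\<lambda>n. - int n)"
  proof (rule UNIV_eq_I)
    show "r \<in> range int \<union> range (\<lambda>n. - int n)" for r
      by (cases r rule: int_cases2) auto
  qed
  thus ?thesis using summable_on_union[OF nonneg nonpos] by simp
qed

lemma summable_norm_theta_term:
  assumes "norm q < 1" "q \<noteq> 0" "x \<noteq> 0"
  shows "(\<lambda>r. norm (theta_term q x r)) summable_on UNIV"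
  unfolding norm_theta_term using assms by (intro summable_on_gauss) auto

lemma has_sum_translate:
  fixes f :: "'a :: group_add \<Rightarrow> 'b :: topological_comm_monoid_add"
  shows "((\<lambda>x. f (x + c)) has_sum a) UNIV \<longleftrightarrow> (f has_sum a) UNIV"
  by (rule has_sum_reindex_bij_witness[of _ "\<lambda>x. x - c" "\<lambda>x. x + c"]) auto

lemma tendsto_infsum_dominated:
  fixes f :: "'n \<Rightarrow> 'i \<Rightarrow> 'a :: banach"
  assumes lim: "\<And>i. i \<in> I \<Longrightarrow> ((\<lambda>n. f n i) \<longlongrightarrow> g i) F"
    and bound: "\<And>n i. i \<in> I \<Longrightarrow> norm (f n i) \<le> M i" and M: "M summable_on I" and F: "F \<noteq> bot"
  shows "((\<lambda>n. infsum (f n) I) \<longlongrightarrow> infsum g I) F"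
proof (rule swap_uniform_limit')
  show "uniform_limit UNIV (\<lambda>X n. sum (f n) X) (\<lambda>n. infsum (f n) I) (finite_subsets_at_top I)"
    by (rule Weierstrass_m_test_general[OF bound M])
  show "\<forall>\<^sub>F X in finite_subsets_at_top I. ((\<lambda>n. sum (f n) X) \<longlongrightarrow> sum g X) F"
    by (rule eventually_finite_subsets_at_top_weakI) (auto intro!: tendsto_sum lim)
  have "norm (g i) \<le> M i" if "i \<in> I" for i
    using tendsto_upperbound[OF tendsto_norm[OF lim[OF that]] always_eventually F] bound[OF that] by blast
  hence "g summable_on I"
    by (intro abs_summable_summable[OF Infinite_Sum.abs_summable_on_comparison_test'[OF M]])
  thus "(sum g \<longlongrightarrow> infsum g I) (finite_subsets_at_top I)"
    by (rule infsum_tendsto)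
qed auto

text \<open>The factor \<open>(q\<^sup>m\<^sup>+\<^sup>1; q)\<^sub>\<infinity>\<close> plays the role of \<open>1/(q; q)\<^sub>m\<close> in the Gaussian binomial coefficients, but
  is also meaningful for \<open>m < 0\<close>, where it vanishes.\<close>
definition qpoch_tail :: "complex \<Rightarrow> int \<Rightarrow> complex" where
  "qpoch_tail q m = qpoch_inf (q powi (m + 1)) q"

lemma qpoch_tail_0 [simp]: "qpoch_tail q 0 = qpoch_inf q q"
  by (simp add: qpoch_tail_def)

lemma qpoch_tail_rec:
  assumes "norm q < 1" "q \<noteq> 0"
  shows "qpoch_tail q (m - 1) = (1 - q powi m) * qpoch_tail q m"
  unfolding qpoch_tail_def using qpoch_inf_unfold[OF assms(1), of "q powi m"] assms(2) by (simp add: power_int_add)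

lemma qpoch_tail_neg:
  assumes "norm q < 1" "q \<noteq> 0" "m < 0"
  shows "qpoch_tail q m = 0"
proof -
  have "q powi (m + 1) * q ^ nat (- (m + 1)) = 1"
    using assms by (auto simp: power_int_def simp flip: power_mult_distrib)
  thus ?thesis
    unfolding qpoch_tail_def qpoch_inf_eq_0_iff[OF assms(1)] by blast
qed

lemma qpoch_tail_nonneg:
  assumes "norm q < 1" "q \<noteq> 0" "m \<ge> 0"
  shows "qpoch_tail q m \<noteq> 0"
proof
  assume "qpoch_tail q m = 0"
  then obtain i where "q powi (m + 1) * q ^ i = 1"
    unfolding qpoch_tail_def qpoch_inf_eq_0_iff[OF assms(1)] by blast
  hence "q ^ (nat (m + 1) + i) = 1" using assms(3) by (simp add: power_int_def power_add)
  thus False using norm_power_less_1[OF assms(1), of "nat (m + 1) + i"] assms(3) by simp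
qed

lemma tendsto_qpoch_tail:
  assumes "norm q < 1"
  shows "(qpoch_tail q \<longlongrightarrow> 1) at_top"
proof -
  have "isCont (\<lambda>x. qpoch_inf x q) 0"
    using holomorphic_on_imp_continuous_on[OF holomorphic_qpoch_inf[OF assms]]
    by (simp add: continuous_on_eq_continuous_at)
  moreover have "((\<lambda>m. q powi (m + 1)) \<longlongrightarrow> 0) at_top"
  proof -
    have "(\<lambda>k. q ^ (k + 1)) \<longlonglongrightarrow> 0"
      using assms by (intro LIMSEQ_ignore_initial_segment LIMSEQ_power_zero)
    hence "((\<lambda>m. q ^ (nat m + 1)) \<longlongrightarrow> 0) at_top"
      by (rule filterlim_compose) (rule filterlim_nat_sequentially)
    moreover have "\<forall>\<^sub>F m in at_top. q ^ (nat m + 1) = q powi (m + 1)"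
      using eventually_ge_at_top[of 0] by eventually_elim (simp add: power_int_def nat_add_distrib)
    ultimately show ?thesis by (rule Lim_transform_eventually)
  qed
  ultimately have "((\<lambda>m. qpoch_inf (q powi (m + 1)) q) \<longlongrightarrow> qpoch_inf 0 q) at_top"
    by (rule isCont_tendsto_compose)
  thus ?thesis by (simp add: qpoch_tail_def[abs_def] qpoch_inf_def)
qed

lemma bounded_qpoch_tail:
  assumes "norm q < 1" "q \<noteq> 0"
  obtains C where "\<And>m. norm (qpoch_tail q m) \<le> C"
proof -
  have lim: "(\<lambda>m. qpoch_tail q (int m)) \<longlonglongrightarrow> 1"
    by (rule filterlim_compose[OF tendsto_qpoch_tail[OF assms(1)] filterlim_int_sequentially])
  obtain C where C: "C > 0" "\<And>m. norm (qpoch_tail q (int m)) \<le> C"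
    using convergent_imp_Bseq[OF convergentI[OF lim]] unfolding Bseq_def by blast
  have "norm (qpoch_tail q m) \<le> C" for m
    using C(2)[of "nat m"] C(1) qpoch_tail_neg[OF assms, of m] by (cases "m \<ge> 0") auto
  thus ?thesis using that by blast
qed

definition gauss_coeff :: "complex \<Rightarrow> int \<Rightarrow> int \<Rightarrow> complex" where
  "gauss_coeff q n r = qpoch_tail q (n + r) * qpoch_tail q (n - r)"

lemma gauss_coeff_Suc:
  assumes "norm q < 1" "q \<noteq> 0"
  shows "(1 - q powi (2 * n + 1)) * (1 - q powi (2 * n + 2)) * gauss_coeff q (n + 1) r =
    (1 + q powi (2 * n + 1)) * gauss_coeff q n r + q powi (n + 1 - r) * gauss_coeff q n (r - 1)
      + q powi (n + 1 + r) * gauss_coeff q n (r + 1)"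
proof -
  define a b where "a = q powi (n + r)" and "b = q powi (n - r)"
  define A B where "A = qpoch_tail q (n + r + 1)" and "B = qpoch_tail q (n - r + 1)"
  note tail_rec = qpoch_tail_rec[OF assms]
  have tail: "qpoch_tail q (n + r) = (1 - q * a) * A" "qpoch_tail q (n - r) = (1 - q * b) * B"
    unfolding A_def B_def a_def b_def
    using tail_rec[of "n + r + 1"] tail_rec[of "n - r + 1"] assms(2) by (simp_all add: power_int_add mult.commute)
  have tail': "qpoch_tail q (n + r - 1) = (1 - a) * ((1 - q * a) * A)"
    "qpoch_tail q (n - r - 1) = (1 - b) * ((1 - q * b) * B)"
    unfolding a_def b_def tail[symmetric, unfolded a_def b_def] by (rule tail_rec)+
  have exponents: "n + 1 + r = 1 + (n + r)" "n + 1 - r = 1 + (n - r)"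
    "2 * n + 1 = 1 + (n + r) + (n - r)" "2 * n + 2 = 2 + (n + r) + (n - r)"
    by simp_all
  have powers: "q powi (n + 1 + r) = q * a" "q powi (n + 1 - r) = q * b"
    "q powi (2 * n + 1) = q * a * b" "q powi (2 * n + 2) = q\<^sup>2 * a * b"
    unfolding a_def b_def exponents power_int_add[OF disjI1[OF assms(2)]] by simp_all
  have ring: "(1 - q * a * b) * (1 - q\<^sup>2 * a * b) * (A * B) =
      (1 + q * a * b) * ((1 - q * a) * A * ((1 - q * b) * B)) +
      q * b * ((1 - a) * ((1 - q * a) * A) * B) + q * a * (A * ((1 - b) * ((1 - q * b) * B)))"
    by (simp add: algebra_simps power2_eq_square)
  have "n + (r - 1) = n + r - 1" "n - (r - 1) = n - r + 1" "n + (r + 1) = n + r + 1" "n - (r + 1) = n - r - 1"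
    "n + 1 + r = n + r + 1" "n + 1 - r = n - r + 1" by simp_all
  thus ?thesis
    unfolding gauss_coeff_def powers by (simp only: tail tail' A_def[symmetric] B_def[symmetric] ring)
qed

lemma gauss_coeff_0: "norm q < 1 \<Longrightarrow> q \<noteq> 0 \<Longrightarrow> gauss_coeff q 0 r = (if r = 0 then (qpoch_inf q q)\<^sup>2 else 0)"
  using qpoch_tail_neg[of q r] qpoch_tail_neg[of q "- r"]
  by (cases r "0 :: int" rule: linorder_cases) (auto simp: gauss_coeff_def power2_eq_square)

lemma theta_term_gauss_coeff_Suc:
  assumes "norm q < 1" "q \<noteq> 0" "x \<noteq> 0"
  defines "g \<equiv> \<lambda>n r. theta_term q x r * gauss_coeff q (int n) r"
  shows "(1 + q powi (2 * int n + 1)) * g n r + - (x * q ^ n) * g n (r + - 1) + - (q / x * q ^ n) * g n (r + 1) =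
    (1 - q powi (2 * int n + 1)) * (1 - q powi (2 * int n + 2)) * g (Suc n) r"
proof -
  have "x * q ^ n = q powi (int n + 1 - r) * (x * q powi (r - 1))"
    using assms(2) by (simp add: power_int_add power_int_diff)
  hence lower: "x * q ^ n * theta_term q x (r - 1) = - (q powi (int n + 1 - r) * theta_term q x r)"
    using theta_term_Suc[OF assms(2,3), of "r - 1"] assms(3) by simp
  have upper: "q / x * q ^ n * theta_term q x (r + 1) = - (q powi (int n + 1 + r) * theta_term q x r)"
    using theta_term_Suc[OF assms(2,3), of r] assms(2,3) by (simp add: power_int_add)
  have "(1 + q powi (2 * int n + 1)) * g n r + - (x * q ^ n) * g n (r + - 1) + - (q / x * q ^ n) * g n (r + 1) =
    (1 + q powi (2 * int n + 1)) * g n r - (x * q ^ n * theta_term q x (r - 1)) * gauss_coeff q (int n) (r - 1)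
      - (q / x * q ^ n * theta_term q x (r + 1)) * gauss_coeff q (int n) (r + 1)"
    unfolding g_def by (simp add: mult.assoc)
  also have "\<dots> = theta_term q x r * ((1 + q powi (2 * int n + 1)) * gauss_coeff q (int n) r
      + q powi (int n + 1 - r) * gauss_coeff q (int n) (r - 1)
      + q powi (int n + 1 + r) * gauss_coeff q (int n) (r + 1))"
    unfolding g_def lower upper by (simp add: algebra_simps)
  finally show ?thesis
    unfolding gauss_coeff_Suc[OF assms(1,2), symmetric] by (simp add: g_def add.commute mult_ac)
qed

lemma finite_triple_product:
  assumes "norm q < 1" "q \<noteq> 0" "x \<noteq> 0"
  shows "((\<lambda>r. theta_term q x r * gauss_coeff q (int n) r) has_sum
    qpoch_tail q (2 * int n) * qpoch_inf q q * (\<Prod>i<n. (1 - x * q ^ i) * (1 - q / x * q ^ i))) UNIV"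
proof (induction n)
  case 0
  show ?case
    by (rule has_sum_finite_neutralI[of "{0}"]) (use assms in \<open>auto simp: gauss_coeff_0 power2_eq_square\<close>)
next
  case (Suc n)
  define c where "c = (1 - q powi (2 * int n + 1)) * (1 - q powi (2 * int n + 2))"
  define F where "F n = qpoch_inf q q * (\<Prod>i<n. (1 - x * q ^ i) * (1 - q / x * q ^ i))" for n
  let ?S = "qpoch_tail q (2 * int n) * F n"
  have tail: "qpoch_tail q (2 * int n) = c * qpoch_tail q (2 * int (Suc n))"
    using qpoch_tail_rec[OF assms(1,2), of "2 * int n + 1"] qpoch_tail_rec[OF assms(1,2), of "2 * int n + 2"]
    by (simp add: c_def add.commute)
  hence "c \<noteq> 0"
    using qpoch_tail_nonneg[OF assms(1,2), of "2 * int n"] by auto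
  have "q powi (2 * int n) = q ^ n * q ^ n"
    using power_int_add[of q "int n" "int n"] assms(2) by simp
  hence factors: "1 + q powi (2 * int n + 1) + - (x * q ^ n) + - (q / x * q ^ n) =
      (1 - x * q ^ n) * (1 - q / x * q ^ n)"
    using assms(2,3) by (simp add: power_int_add field_simps)
  have "((\<lambda>r. c * (theta_term q x r * gauss_coeff q (int (Suc n)) r)) has_sum
    (1 + q powi (2 * int n + 1)) * ?S + - (x * q ^ n) * ?S + - (q / x * q ^ n) * ?S) UNIV"
    unfolding c_def theta_term_gauss_coeff_Suc[OF assms, symmetric]
    by (intro has_sum_add has_sum_cmult_right has_sum_translate[THEN iffD2])
       (use Suc.IH in \<open>simp_all add: F_def mult.assoc\<close>)
  also have "(1 + q powi (2 * int n + 1)) * ?S + - (x * q ^ n) * ?S + - (q / x * q ^ n) * ?S =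
      (1 - x * q ^ n) * (1 - q / x * q ^ n) * ?S"
    unfolding factors[symmetric] by (simp only: distrib_right)
  also have "\<dots> = c * (qpoch_tail q (2 * int (Suc n)) * F (Suc n))"
    unfolding tail F_def by simp
  finally show ?case
    unfolding has_sum_cmult_right_iff[OF \<open>c \<noteq> 0\<close>] using \<open>c \<noteq> 0\<close> by (simp add: F_def mult.assoc)
qed

theorem jacobi_triple_product:
  assumes "norm q < 1" "q \<noteq> 0" "x \<noteq> 0"
  shows "(theta_term q x has_sum jtheta x q) UNIV"
proof -
  let ?a = "\<lambda>n r. theta_term q x r * gauss_coeff q (int n) r"
  obtain C where C: "\<And>m. norm (qpoch_tail q m) \<le> C"
    using bounded_qpoch_tail[OF assms(1,2)] by blast
  have "(\<lambda>n. ?a n r) \<longlonglongrightarrow> theta_term q x r * (1 * 1)" for r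
  proof -
    have "filterlim (\<lambda>n. int n + r) at_top sequentially" "filterlim (\<lambda>n. int n - r) at_top sequentially"
      by real_asymp+
    thus ?thesis
      unfolding gauss_coeff_def
      by (intro tendsto_mult tendsto_const filterlim_compose[OF tendsto_qpoch_tail[OF assms(1)]])
  qed
  hence "(\<lambda>n. infsum (?a n) UNIV) \<longlonglongrightarrow> infsum (theta_term q x) UNIV"
  proof (intro tendsto_infsum_dominated[where M = "\<lambda>r. norm (theta_term q x r) * (C * C)"])
    show "norm (?a n r) \<le> norm (theta_term q x r) * (C * C)" for n r
      unfolding norm_mult gauss_coeff_def
      by (intro mult_left_mono mult_mono C order_trans[OF norm_ge_zero C[of 0]]) auto
  qed (use summable_on_cmult_left[OF summable_norm_theta_term[OF assms]] in auto)
  moreover have "infsum (?a n) UNIV = qpoch_tail q (2 * int n) * qpoch_inf q q *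
      ((\<Prod>i<n. 1 - x * q ^ i) * (\<Prod>i<n. 1 - q / x * q ^ i))" for n
    using infsumI[OF finite_triple_product[OF assms, of n]] by (simp add: prod.distrib)
  moreover have "(\<lambda>n. qpoch_tail q (2 * int n) * qpoch_inf q q *
      ((\<Prod>i<n. 1 - x * q ^ i) * (\<Prod>i<n. 1 - q / x * q ^ i))) \<longlonglongrightarrow>
      1 * qpoch_inf q q * (qpoch_inf x q * qpoch_inf (q / x) q)"
  proof (intro tendsto_mult tendsto_const qpoch_inf_LIMSEQ assms)
    have "filterlim (\<lambda>n. 2 * int n) at_top sequentially" by real_asymp
    thus "(\<lambda>n. qpoch_tail q (2 * int n)) \<longlonglongrightarrow> 1"
      by (rule filterlim_compose[OF tendsto_qpoch_tail[OF assms(1)]])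
  qed
  ultimately have "infsum (theta_term q x) UNIV = 1 * qpoch_inf q q * (qpoch_inf x q * qpoch_inf (q / x) q)"
    by (simp only: LIMSEQ_unique)
  moreover have "theta_term q x summable_on UNIV"
    by (rule abs_summable_summable[OF summable_norm_theta_term[OF assms]])
  ultimately show ?thesis by (simp add: has_sum_iff jtheta_def mult_ac)
qed


section \<open>Monomials\<close>

definition monomial :: "complex \<Rightarrow> complex \<Rightarrow> complex \<Rightarrow> int \<Rightarrow> int \<Rightarrow> int \<Rightarrow> int \<Rightarrow> complex" where
  "monomial x y q s a b e = (-1) powi s * x powi a * y powi b * q powi e"

text \<open>With \<open>m\<close> a variable, the following rules rewrite a product of integer powers to a single
  term \<open>m s a b e\<close>, so that identities between such products become identities between integers.\<close>
lemma monomial_rules: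
  assumes nz: "x \<noteq> 0" "y \<noteq> 0" "q \<noteq> 0" and m: "m = monomial x y q"
  shows "x = m 0 1 0 0" "y = m 0 0 1 0" "q = m 0 0 0 1" "1 = m 0 0 0 0"
    "m s a b e * m s' a' b' e' = m (s + s') (a + a') (b + b') (e + e')"
    "m s a b e / m s' a' b' e' = m (s - s') (a - a') (b - b') (e - e')"
    "m s a b e powi k = m (k * s) (k * a) (k * b) (k * e)"
    "m s a b e ^ j = m (int j * s) (int j * a) (int j * b) (int j * e)"
    "- m s a b e = m (s + 1) a b e"
proof -
  show "x = m 0 1 0 0" "y = m 0 0 1 0" "q = m 0 0 0 1" "1 = m 0 0 0 0" "- m s a b e = m (s + 1) a b e"
    by (simp_all add: m monomial_def power_int_add)
  show "m s a b e * m s' a' b' e' = m (s + s') (a + a') (b + b') (e + e')"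
    "m s a b e / m s' a' b' e' = m (s - s') (a - a') (b - b') (e - e')"
    using nz by (simp_all add: m monomial_def power_int_add power_int_diff)
  show powi: "m s a b e powi k = m (k * s) (k * a) (k * b) (k * e)" for k
    using nz by (simp add: m monomial_def power_int_mult_distrib mult.commute[of k] power_int_mult)
  show "m s a b e ^ j = m (int j * s) (int j * a) (int j * b) (int j * e)"
    using powi[of "int j"] by simp
qed

lemma monomial_eqI:
  assumes "m = monomial x y q" "even (s - s')" "a = a'" "b = b'" "e = e'"
  shows "m s a b e = m s' a' b' e'"
proof -
  have "(-1 :: complex) powi s = (-1) powi s'"
    using assms(2) by (auto simp: power_int_minus_left)
  thus ?thesis using assms by (simp add: monomial_def)
qed

section \<open>Theta identities\<close>

lemma has_sum_range_Un:
  fixes f :: "'b \<Rightarrow> 'c :: topological_comm_monoid_add"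
  assumes "((\<lambda>i. f (g i)) has_sum a) UNIV" "((\<lambda>i. f (h i)) has_sum b) UNIV"
    and "inj g" "inj h" "range g \<inter> range h = {}" "range g \<union> range h = UNIV"
  shows "(f has_sum (a + b)) UNIV"
proof -
  have "(f has_sum a) (range g)" "(f has_sum b) (range h)"
    using assms(1-4) by (simp_all add: has_sum_reindex o_def)
  from has_sum_Un_disjoint[OF this assms(5)] show ?thesis by (simp only: assms(6))
qed

lemma has_sum_even_odd:
  fixes f :: "int \<Rightarrow> 'a :: topological_comm_monoid_add"
  assumes "((\<lambda>i. f (2 * i)) has_sum a) UNIV" "((\<lambda>i. f (2 * i + 1)) has_sum b) UNIV"
  shows "(f has_sum (a + b)) UNIV"
proof (rule has_sum_range_Un[where g = "\<lambda>i. 2 * i" and h = "\<lambda>i. 2 * i + 1"])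
  show "range (\<lambda>i::int. 2 * i) \<union> range (\<lambda>i. 2 * i + 1) = UNIV"
  proof (rule UNIV_eq_I[symmetric])
    fix r :: int
    show "r \<in> range (\<lambda>i. 2 * i) \<union> range (\<lambda>i. 2 * i + 1)"
      by (cases "even r") (auto elim: evenE oddE)
  qed
  show "range (\<lambda>i::int. 2 * i) \<inter> range (\<lambda>i. 2 * i + 1) = {}"
    by (auto, presburger)
qed (use assms in \<open>auto simp: inj_on_def\<close>)

lemma jtheta_even_odd:
  assumes "norm q < 1" "q \<noteq> 0" "z \<noteq> 0"
  shows "jtheta z q = jtheta (- (q * z\<^sup>2)) (q ^ 4) - z * jtheta (- (q ^ 3 * z\<^sup>2)) (q ^ 4)"
proof -
  define m where "m = monomial z 1 q"
  note m = monomial_rules(1,3-)[OF assms(3) one_neq_zero assms(2) m_def] and eq = monomial_eqI[OF m_def]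
  have even: "theta_term q z (2 * i) = theta_term (q ^ 4) (- (q * z\<^sup>2)) i"
    and odd: "theta_term q z (2 * i + 1) = - z * theta_term (q ^ 4) (- (q ^ 3 * z\<^sup>2)) i" for i
    unfolding theta_term_def by (simp only: m, rule eq; simp add: tri_double tri_Suc)+
  have q4: "norm (q ^ 4) < 1" using assms(1) by (rule norm_power_less_1) simp
  have "(theta_term q z has_sum (jtheta (- (q * z\<^sup>2)) (q ^ 4) + - z * jtheta (- (q ^ 3 * z\<^sup>2)) (q ^ 4))) UNIV"
    by (rule has_sum_even_odd; unfold even odd;
        (rule has_sum_cmult_right)?; rule jacobi_triple_product) (use assms q4 in auto)
  from has_sum_unique[OF jacobi_triple_product[OF assms] this] show ?thesis by simp
qed

lemma summable_on_product:
  fixes f :: "'i \<Rightarrow> real" and g :: "'j \<Rightarrow> real"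
  assumes "f summable_on A" "g summable_on B" "\<And>i. f i \<ge> 0" "\<And>j. g j \<ge> 0"
  shows "(\<lambda>(i, j). f i * g j) summable_on A \<times> B"
proof (rule summable_on_SigmaI)
  show "((\<lambda>j. case (i, j) of (i, j) \<Rightarrow> f i * g j) has_sum f i * infsum g B) B" for i
    using assms(2) by (simp add: has_sum_cmult_right)
  show "(\<lambda>i. f i * infsum g B) summable_on A"
    using assms(1) by (rule summable_on_cmult_left)
qed (use assms in auto)

lemma has_sum_product:
  fixes f :: "'i \<Rightarrow> complex" and g :: "'j \<Rightarrow> complex"
  assumes "(f has_sum a) A" "(g has_sum b) B"
    and "(\<lambda>i. norm (f i)) summable_on A" "(\<lambda>j. norm (g j)) summable_on B"
  shows "((\<lambda>(i, j). f i * g j) has_sum (a * b)) (A \<times> B)"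
proof (rule has_sum_SigmaI)
  show "((\<lambda>j. case (i, j) of (i, j) \<Rightarrow> f i * g j) has_sum f i * b) B" for i
    using assms(2) by (simp add: has_sum_cmult_right)
  show "((\<lambda>i. f i * b) has_sum a * b) A"
    using assms(1) by (rule has_sum_cmult_left)
  have "(\<lambda>p. norm ((\<lambda>(i, j). f i * g j) p)) summable_on A \<times> B"
    using summable_on_product[OF assms(3,4)] by (simp add: case_prod_unfold norm_mult)
  thus "(\<lambda>(i, j). f i * g j) summable_on A \<times> B"
    by (rule abs_summable_summable)
qed

lemma has_sum_theta_product:
  assumes "norm q < 1" "q \<noteq> 0" "x \<noteq> 0" "y \<noteq> 0"
  shows "((\<lambda>(i, j). theta_term q x i * theta_term q y j) has_sum (jtheta x q * jtheta y q)) UNIV"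
  using has_sum_product[OF jacobi_triple_product[OF assms(1-3)] jacobi_triple_product[OF assms(1,2,4)]
    summable_norm_theta_term[OF assms(1-3)] summable_norm_theta_term[OF assms(1,2,4)]] by simp

lemma has_sum_int_pair_parity:
  fixes f :: "int \<times> int \<Rightarrow> 'a :: topological_comm_monoid_add"
  assumes "((\<lambda>(i, j). f (i - j, i + j)) has_sum a) UNIV" "((\<lambda>(i, j). f (i - j + 1, i + j)) has_sum b) UNIV"
  shows "(f has_sum (a + b)) UNIV"
proof (rule has_sum_range_Un[where g = "\<lambda>(i, j). (i - j, i + j)" and h = "\<lambda>(i, j). (i - j + 1, i + j)"])
  let ?g = "\<lambda>(i::int, j). (i - j, i + j)" and ?h = "\<lambda>(i::int, j). (i - j + 1, i + j)"
  show "range ?g \<inter> range ?h = {}"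
    by (auto, presburger)
  show "range ?g \<union> range ?h = UNIV"
  proof (rule UNIV_eq_I[symmetric])
    fix p :: "int \<times> int"
    obtain r s where p: "p = (r, s)" by (cases p)
    show "p \<in> range ?g \<union> range ?h"
    proof (cases "even (r + s)")
      case True
      then obtain k where "r + s = 2 * k" by (elim evenE)
      hence "p = ?g (k, s - k)" by (simp add: p)
      thus ?thesis by blast
    next
      case False
      then obtain k where "r + s = 2 * k + 1" by (elim oddE)
      hence "p = ?h (k, s - k)" by (simp add: p)
      thus ?thesis by blast
    qed
  qed
qed (use assms in \<open>auto simp: inj_on_def case_prod_unfold\<close>)

lemma jtheta_product:
  assumes "norm q < 1" "q \<noteq> 0" "x \<noteq> 0" "y \<noteq> 0"
  shows "jtheta x q * jtheta y q = jtheta (- (x * y)) (q\<^sup>2) * jtheta (- (q * y / x)) (q\<^sup>2)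
     - x * (jtheta (- (q * x * y)) (q\<^sup>2) * jtheta (- (y / x)) (q\<^sup>2))"
proof -
  define m where "m = monomial x y q"
  note m = monomial_rules[OF assms(3,4,2) m_def] and eq = monomial_eqI[OF m_def]
  have even: "theta_term q x (i - j) * theta_term q y (i + j) =
      theta_term (q\<^sup>2) (- (x * y)) i * theta_term (q\<^sup>2) (- (q * y / x)) j"
    and odd: "theta_term q x (i - j + 1) * theta_term q y (i + j) =
      - x * (theta_term (q\<^sup>2) (- (q * x * y)) i * theta_term (q\<^sup>2) (- (y / x)) j)" for i j
    unfolding theta_term_def by (simp only: m, rule eq; simp add: tri_Suc tri_diff tri_add algebra_simps)+
  have q2: "norm (q\<^sup>2) < 1" using assms(1) by (rule norm_power_less_1) simp
  have nz: "q\<^sup>2 \<noteq> 0" "- (x * y) \<noteq> 0" "- (q * y / x) \<noteq> 0" "- (q * x * y) \<noteq> 0" "- (y / x) \<noteq> 0"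
    using assms by simp_all
  let ?t = "\<lambda>(i, j). theta_term q x i * theta_term q y j"
  have "(?t has_sum (jtheta (- (x * y)) (q\<^sup>2) * jtheta (- (q * y / x)) (q\<^sup>2) +
      - x * (jtheta (- (q * x * y)) (q\<^sup>2) * jtheta (- (y / x)) (q\<^sup>2)))) UNIV"
  proof (rule has_sum_int_pair_parity)
    show "((\<lambda>(i, j). ?t (i - j, i + j)) has_sum jtheta (- (x * y)) (q\<^sup>2) * jtheta (- (q * y / x)) (q\<^sup>2)) UNIV"
      unfolding case_prod_conv even by (rule has_sum_theta_product[OF q2 nz(1-3)])
    show "((\<lambda>(i, j). ?t (i - j + 1, i + j)) has_sum
        - x * (jtheta (- (q * x * y)) (q\<^sup>2) * jtheta (- (y / x)) (q\<^sup>2))) UNIV"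
      unfolding case_prod_conv odd
      using has_sum_cmult_right[OF has_sum_theta_product[OF q2 nz(1,4,5)], of "- x"] by (simp add: case_prod_unfold)
  qed
  from has_sum_unique[OF has_sum_theta_product[OF assms] this] show ?thesis by simp
qed

lemma jtheta_split_base:
  assumes "norm p < 1" "p \<noteq> 0"
  shows "jtheta u p * (qpoch_inf (p\<^sup>2) (p\<^sup>2))\<^sup>2 = jtheta u (p\<^sup>2) * jtheta (p * u) (p\<^sup>2) * qpoch_inf p p"
proof -
  have "qpoch_inf (p / u) p = qpoch_inf (p / u) (p\<^sup>2) * qpoch_inf (p\<^sup>2 / u) (p\<^sup>2)"
    using qpoch_inf_split_2[OF assms(1), of "p / u"] by (simp add: power2_eq_square)
  moreover have "p\<^sup>2 / (p * u) = p / u" using assms(2) by (simp add: power2_eq_square)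
  ultimately show ?thesis
    unfolding jtheta_def using qpoch_inf_split_2[OF assms(1), of u]
    by (simp add: mult_ac) (simp add: power2_eq_square)
qed

lemma jtheta_square:
  assumes "norm p < 1"
  shows "jtheta (u\<^sup>2) (p\<^sup>2) * (qpoch_inf p p)\<^sup>2 = jtheta u p * jtheta (- u) p * qpoch_inf (p\<^sup>2) (p\<^sup>2)"
  using qpoch_inf_square[OF assms, of u] qpoch_inf_square[OF assms, of "p / u"]
  unfolding jtheta_def by (simp add: power_divide power2_eq_square mult_ac)

lemma jtheta_square_split:
  assumes "norm p < 1" "p \<noteq> 0"
  shows "jtheta (u\<^sup>2) (p\<^sup>2) * qpoch_inf (p\<^sup>2) (p\<^sup>2) ^ 3 =
    jtheta u (p\<^sup>2) * jtheta (p * u) (p\<^sup>2) * jtheta (- u) (p\<^sup>2) * jtheta (- (p * u)) (p\<^sup>2)"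
proof -
  let ?P = "qpoch_inf p p" and ?R = "qpoch_inf (p\<^sup>2) (p\<^sup>2)"
  have nz: "?P \<noteq> 0" "?R \<noteq> 0"
    using assms by (auto intro!: qpoch_inf_self_nonzero norm_power_less_1)
  have "(jtheta (u\<^sup>2) (p\<^sup>2) * ?R ^ 3) * (?P\<^sup>2 * ?R) = (jtheta u p * ?R\<^sup>2) * (jtheta (- u) p * ?R\<^sup>2) * ?R"
    using jtheta_square[OF assms(1), of u] by (simp add: eval_nat_numeral mult_ac)
  also have "\<dots> = (jtheta u (p\<^sup>2) * jtheta (p * u) (p\<^sup>2) * jtheta (- u) (p\<^sup>2) * jtheta (- (p * u)) (p\<^sup>2)) *
      (?P\<^sup>2 * ?R)"
    using jtheta_split_base[OF assms, of u] jtheta_split_base[OF assms, of "- u"]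
    by (simp add: power2_eq_square mult_ac)
  finally show ?thesis using nz by simp
qed

lemma jtheta_self_base_4:
  assumes "norm p < 1" "p \<noteq> 0"
  shows "jtheta p (p ^ 4) * qpoch_inf (p\<^sup>2) (p\<^sup>2) = qpoch_inf p p * qpoch_inf (p ^ 4) (p ^ 4)"
proof -
  have pow: "(p\<^sup>2)\<^sup>2 = p ^ 4" "p * p\<^sup>2 = p ^ 3" "p * p = p\<^sup>2" "p ^ 4 / p = p ^ 3"
    using assms(2) by (simp_all add: eval_nat_numeral)
  have "qpoch_inf p p = qpoch_inf p (p ^ 4) * qpoch_inf (p ^ 3) (p ^ 4) * qpoch_inf (p\<^sup>2) (p\<^sup>2)"
    using qpoch_inf_split_2[OF assms(1), of p] qpoch_inf_split_2[OF norm_power_less_1[OF assms(1)], of 2 p]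
    by (simp add: pow)
  thus ?thesis by (simp add: jtheta_def pow mult_ac)
qed

lemma jtheta_reflect_base_4: "p \<noteq> 0 \<Longrightarrow> jtheta (p ^ 3) (p ^ 4) = jtheta p (p ^ 4)"
  using jtheta_reflect[of "p ^ 4" p] by (simp add: eval_nat_numeral)

lemma jtheta_addition:
  assumes "norm p < 1" "p \<noteq> 0" "u \<noteq> 0" "v\<^sup>2 = -1"
  shows "jtheta u (p\<^sup>2) * jtheta (- (p * u)) (p\<^sup>2) - v * (jtheta (p * u) (p\<^sup>2) * jtheta (- u) (p\<^sup>2))
     = (1 - v) * jtheta p (p ^ 4) * jtheta (v * u) p"
proof -
  have p2: "norm (p\<^sup>2) < 1" using assms(1) by (rule norm_power_less_1) simp
  have v: "v * v = -1" "v \<noteq> 0" using assms(4) by (auto simp: power2_eq_square)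
  let ?A = "jtheta (p * u\<^sup>2) (p ^ 4)" and ?B = "jtheta (p ^ 3 * u\<^sup>2) (p ^ 4)" and ?J = "jtheta p (p ^ 4)"
  have p4: "(p\<^sup>2)\<^sup>2 = p ^ 4" by simp
  have minus: "jtheta u (p\<^sup>2) * jtheta (- (p * u)) (p\<^sup>2) = ?A * ?J - u * (?B * ?J)"
    using jtheta_product[OF p2, of u "- (p * u)"] assms jtheta_reflect_base_4[of p] unfolding p4
    by (simp add: eval_nat_numeral mult_ac)
  have plus: "jtheta (p * u) (p\<^sup>2) * jtheta (- u) (p\<^sup>2) = ?A * ?J + u * (?B * ?J)"
    using jtheta_product[OF p2, of "- u" "p * u"] assms jtheta_reflect_base_4[of p] unfolding p4
    by (simp add: eval_nat_numeral mult_ac)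
  have split: "jtheta (v * u) p = ?A - v * u * ?B"
    using jtheta_even_odd[OF assms(1,2), of "v * u"] assms v by (simp add: power_mult_distrib)
  have "jtheta u (p\<^sup>2) * jtheta (- (p * u)) (p\<^sup>2) - v * (jtheta (p * u) (p\<^sup>2) * jtheta (- u) (p\<^sup>2))
    = (1 - v) * ?A * ?J - (1 + v) * u * ?B * ?J"
    unfolding minus plus by (simp add: algebra_simps)
  also have "1 + v = (1 - v) * v" using v by (simp add: algebra_simps)
  finally show ?thesis unfolding split by (simp add: algebra_simps)
qed

lemma jtheta_sqrt_minus_base:
  assumes "norm q < 1" "q \<noteq> 0" "z\<^sup>2 = - q"
  shows "jtheta z q = jtheta (q\<^sup>2) (q ^ 4)"
proof -
  have "jtheta (q ^ 4) (q ^ 4) = 0"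
    by (subst jtheta_eq_0_iff) (use assms norm_power_less_1[of q 4] in \<open>auto intro: exI[of _ 1]\<close>)
  moreover have "q * z\<^sup>2 = - (q\<^sup>2)" "q ^ 3 * z\<^sup>2 = - (q ^ 4)" "z \<noteq> 0"
    using assms by (auto simp: eval_nat_numeral)
  ultimately show ?thesis
    using jtheta_even_odd[OF assms(1,2), of z] by simp
qed

lemma jtheta_imaginary_unit:
  assumes "norm q < 1" "q \<noteq> 0" "z\<^sup>2 = -1"
  shows "jtheta z q = (1 - z) * jtheta q (q ^ 4)"
proof -
  have "z \<noteq> 0" using assms by auto
  thus ?thesis
    using jtheta_even_odd[OF assms(1,2), of z] assms jtheta_reflect_base_4 by (simp add: algebra_simps)
qed

lemma jtheta_eighth_root:
  assumes "norm p < 1" "p \<noteq> 0" "v\<^sup>2 = -1" "c\<^sup>2 = v * p"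
  shows "jtheta c p = jtheta (p ^ 8) (p ^ 16) - c * (1 - v) * jtheta (p ^ 4) (p ^ 16)"
proof -
  have v: "v \<noteq> 0" "1 / v = - v" using assms(3) by (auto simp: power2_eq_square divide_simps)
  have "c \<noteq> 0" using assms v by auto
  have p4: "norm (p ^ 4) < 1" "p ^ 4 \<noteq> 0" "(p ^ 4)\<^sup>2 = p ^ 8" "(p ^ 4) ^ 4 = p ^ 16"
    using assms norm_power_less_1[of p 4] by simp_all
  have "p * c\<^sup>2 = v * p\<^sup>2" "p ^ 3 * c\<^sup>2 = p ^ 4 * v"
    unfolding assms(4) by (simp_all add: eval_nat_numeral)
  hence "jtheta c p = jtheta (- (v * p\<^sup>2)) (p ^ 4) - c * jtheta (p ^ 4 * - v) (p ^ 4)"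
    using jtheta_even_odd[OF assms(1,2) \<open>c \<noteq> 0\<close>] by simp
  also have "jtheta (- (v * p\<^sup>2)) (p ^ 4) = jtheta (p ^ 8) (p ^ 16)"
    using jtheta_sqrt_minus_base[OF p4(1,2), of "- (v * p\<^sup>2)"] assms(3) by (simp add: power_mult_distrib p4)
  also have "jtheta (p ^ 4 * - v) (p ^ 4) = 1 / v * (1 + v) * jtheta (p ^ 4) (p ^ 16)"
    using jtheta_mult_base[OF p4(1,2), of "- v"] jtheta_imaginary_unit[OF p4(1,2), of "- v"] assms(3) v(1)
    by (simp add: p4)
  also have "1 / v * (1 + v) = 1 - v"
    using v(1) assms(3) by (simp add: field_simps power2_eq_square)
  finally show ?thesis by simp
qed


section \<open>The theta quotients \<open>S\<^sub>1\<close> and \<open>S\<^sub>2\<close>\<close>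

text \<open>With \<open>\<rho> = q^(2n+4)\<close>, \<open>u = y/x\<close> and \<open>z = q^(n+4) x y\<close>, these are \<open>j(y/x;\<rho>^4) S\<^sub>1\<close> and
  \<open>j(y/x;\<rho>^4) S\<^sub>2 / (q y)\<close>.\<close>
definition theta_S1 :: "complex \<Rightarrow> complex \<Rightarrow> complex \<Rightarrow> complex" where
  "theta_S1 \<rho> u z = jtheta u (\<rho> ^ 4) *
     (jtheta (\<rho>\<^sup>2 * z\<^sup>2) (\<rho> ^ 4) * jtheta (- (\<rho>\<^sup>2 * u)) (\<rho> ^ 4) * jtheta z (\<rho>\<^sup>2)) /
     (qpoch_inf (\<rho>\<^sup>2) (\<rho>\<^sup>2) ^ 3 * qpoch_inf (\<rho> ^ 8) (\<rho> ^ 8)) *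
     (jtheta (- (z\<^sup>2)) (\<rho> ^ 4) * jtheta (\<rho>\<^sup>2 * u\<^sup>2) (\<rho> ^ 4) * (qpoch_inf (\<rho> ^ 4) (\<rho> ^ 4))\<^sup>2 +
      z / u * jtheta (- (\<rho>\<^sup>2 * z\<^sup>2)) (\<rho> ^ 4) * (jtheta (\<rho>\<^sup>2 * u) (\<rho> ^ 4))\<^sup>2 * (jtheta (- u) (\<rho> ^ 4))\<^sup>2 /
        qpoch_inf (\<rho> ^ 4) (\<rho> ^ 4))"

definition theta_S2 :: "complex \<Rightarrow> complex \<Rightarrow> complex \<Rightarrow> complex" where
  "theta_S2 \<rho> u z = jtheta u (\<rho> ^ 4) *
     (jtheta (z\<^sup>2) (\<rho> ^ 4) * jtheta (- u) (\<rho> ^ 4) * jtheta (\<rho> * z) (\<rho>\<^sup>2)) /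
     (qpoch_inf (\<rho>\<^sup>2) (\<rho>\<^sup>2))\<^sup>2 *
     (\<rho> / (z * u) * jtheta (- (z\<^sup>2)) (\<rho> ^ 4) * jtheta (\<rho>\<^sup>2 * u\<^sup>2) (\<rho> ^ 4) * qpoch_inf (\<rho> ^ 8) (\<rho> ^ 8) /
        qpoch_inf (\<rho> ^ 4) (\<rho> ^ 4) +
      1 / u * jtheta (- (\<rho>\<^sup>2 * z\<^sup>2)) (\<rho> ^ 4) * (jtheta (\<rho> ^ 4 * u\<^sup>2) (\<rho> ^ 8))\<^sup>2 / qpoch_inf (\<rho> ^ 8) (\<rho> ^ 8))"

context
  fixes \<rho> u z :: complex
  assumes \<rho>: "norm \<rho> < 1" "\<rho> \<noteq> 0" and nz: "u \<noteq> 0" "z \<noteq> 0"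
begin

lemma theta_S_shift_z:
  shows "theta_S1 \<rho> u (\<rho>\<^sup>2 * z) = theta_S1 \<rho> u z / (\<rho>\<^sup>2 * z ^ 5)"
    and "theta_S2 \<rho> u (\<rho>\<^sup>2 * z) = theta_S2 \<rho> u z / (\<rho> ^ 3 * z ^ 5)"
proof -
  have shifts:
    "jtheta (\<rho>\<^sup>2 * (\<rho>\<^sup>2 * z)\<^sup>2) (\<rho> ^ 4) = - jtheta (\<rho>\<^sup>2 * z\<^sup>2) (\<rho> ^ 4) / (\<rho>\<^sup>2 * z\<^sup>2)"
    "jtheta (- (\<rho>\<^sup>2 * (\<rho>\<^sup>2 * z)\<^sup>2)) (\<rho> ^ 4) = - jtheta (- (\<rho>\<^sup>2 * z\<^sup>2)) (\<rho> ^ 4) / (- (\<rho>\<^sup>2 * z\<^sup>2))"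
    "jtheta ((\<rho>\<^sup>2 * z)\<^sup>2) (\<rho> ^ 4) = - jtheta (z\<^sup>2) (\<rho> ^ 4) / z\<^sup>2"
    "jtheta (- ((\<rho>\<^sup>2 * z)\<^sup>2)) (\<rho> ^ 4) = - jtheta (- (z\<^sup>2)) (\<rho> ^ 4) / (- (z\<^sup>2))"
    "jtheta (\<rho>\<^sup>2 * z) (\<rho>\<^sup>2) = - jtheta z (\<rho>\<^sup>2) / z"
    "jtheta (\<rho> * (\<rho>\<^sup>2 * z)) (\<rho>\<^sup>2) = - jtheta (\<rho> * z) (\<rho>\<^sup>2) / (\<rho> * z)"
    by (rule jtheta_mult_base_eq, use norm_power_less_1[OF \<rho>(1)] in simp, use \<rho> in simp, use \<rho> nz in simp,
        use \<rho> nz in \<open>simp add: eval_nat_numeral mult_ac\<close>)+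
  show "theta_S1 \<rho> u (\<rho>\<^sup>2 * z) = theta_S1 \<rho> u z / (\<rho>\<^sup>2 * z ^ 5)"
    unfolding theta_S1_def shifts using \<rho> nz
    by (simp add: add_divide_distrib distrib_left eval_nat_numeral mult_ac)
  show "theta_S2 \<rho> u (\<rho>\<^sup>2 * z) = theta_S2 \<rho> u z / (\<rho> ^ 3 * z ^ 5)"
    unfolding theta_S2_def shifts using \<rho> nz
    by (simp add: add_divide_distrib distrib_left eval_nat_numeral mult_ac)
qed

lemma theta_S_shift_u:
  shows "theta_S1 \<rho> (\<rho> ^ 4 * u) z = - theta_S1 \<rho> u z / (\<rho> ^ 10 * u ^ 6)"
    and "theta_S2 \<rho> (\<rho> ^ 4 * u) z = - theta_S2 \<rho> u z / (\<rho> ^ 12 * u ^ 6)"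
proof -
  have shifts:
    "jtheta (\<rho> ^ 4 * u) (\<rho> ^ 4) = - jtheta u (\<rho> ^ 4) / u"
    "jtheta (- (\<rho> ^ 4 * u)) (\<rho> ^ 4) = - jtheta (- u) (\<rho> ^ 4) / (- u)"
    "jtheta (\<rho>\<^sup>2 * (\<rho> ^ 4 * u)) (\<rho> ^ 4) = - jtheta (\<rho>\<^sup>2 * u) (\<rho> ^ 4) / (\<rho>\<^sup>2 * u)"
    "jtheta (- (\<rho>\<^sup>2 * (\<rho> ^ 4 * u))) (\<rho> ^ 4) = - jtheta (- (\<rho>\<^sup>2 * u)) (\<rho> ^ 4) / (- (\<rho>\<^sup>2 * u))"
    "jtheta (\<rho> ^ 4 * (\<rho> ^ 4 * u)\<^sup>2) (\<rho> ^ 8) = - jtheta (\<rho> ^ 4 * u\<^sup>2) (\<rho> ^ 8) / (\<rho> ^ 4 * u\<^sup>2)"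
    by (rule jtheta_mult_base_eq, use norm_power_less_1[OF \<rho>(1)] in simp, use \<rho> in simp, use \<rho> nz in simp,
        use \<rho> nz in \<open>simp add: eval_nat_numeral mult_ac\<close>)+
  have shift_2: "jtheta (\<rho>\<^sup>2 * (\<rho> ^ 4 * u)\<^sup>2) (\<rho> ^ 4) = jtheta (\<rho>\<^sup>2 * u\<^sup>2) (\<rho> ^ 4) / (\<rho> ^ 4 * (\<rho>\<^sup>2 * u\<^sup>2)\<^sup>2)"
    by (rule jtheta_mult_base_squared_eq[OF norm_power_less_1[OF \<rho>(1)]])
       (use \<rho> nz in \<open>simp_all add: eval_nat_numeral mult_ac\<close>)
  show "theta_S1 \<rho> (\<rho> ^ 4 * u) z = - theta_S1 \<rho> u z / (\<rho> ^ 10 * u ^ 6)"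
    unfolding theta_S1_def shifts shift_2 using \<rho> nz
    by (simp add: add_divide_distrib diff_divide_distrib distrib_left eval_nat_numeral mult_ac)
  show "theta_S2 \<rho> (\<rho> ^ 4 * u) z = - theta_S2 \<rho> u z / (\<rho> ^ 12 * u ^ 6)"
    unfolding theta_S2_def shifts shift_2 using \<rho> nz
    by (simp add: add_divide_distrib diff_divide_distrib distrib_left eval_nat_numeral mult_ac)
qed

end

lemma theta_S_shift_both:
  assumes \<rho>: "norm \<rho> < 1" "\<rho> \<noteq> 0" and nz: "u \<noteq> 0" "z \<noteq> 0"
  shows "theta_S1 \<rho> (\<rho> ^ 4 * u) (\<rho> ^ 4 * z) = - theta_S1 \<rho> u z / (\<rho> ^ 24 * u ^ 6 * z ^ 10)"
    and "theta_S2 \<rho> (\<rho> ^ 4 * u) (\<rho> ^ 4 * z) = - theta_S2 \<rho> u z / (\<rho> ^ 28 * u ^ 6 * z ^ 10)"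
proof -
  have rho4: "\<rho> ^ 4 * z = \<rho>\<^sup>2 * (\<rho>\<^sup>2 * z)" by (simp add: eval_nat_numeral)
  have z: "\<rho>\<^sup>2 * z \<noteq> 0" "\<rho>\<^sup>2 * (\<rho>\<^sup>2 * z) \<noteq> 0" using \<rho> nz by simp_all
  show "theta_S1 \<rho> (\<rho> ^ 4 * u) (\<rho> ^ 4 * z) = - theta_S1 \<rho> u z / (\<rho> ^ 24 * u ^ 6 * z ^ 10)"
    unfolding rho4 theta_S_shift_u(1)[OF \<rho> nz(1) z(2)] theta_S_shift_z(1)[OF \<rho> nz(1) z(1)]
      theta_S_shift_z(1)[OF \<rho> nz]
    by (simp add: eval_nat_numeral)
  show "theta_S2 \<rho> (\<rho> ^ 4 * u) (\<rho> ^ 4 * z) = - theta_S2 \<rho> u z / (\<rho> ^ 28 * u ^ 6 * z ^ 10)"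
    unfolding rho4 theta_S_shift_u(2)[OF \<rho> nz(1) z(2)] theta_S_shift_z(2)[OF \<rho> nz(1) z(1)]
      theta_S_shift_z(2)[OF \<rho> nz]
    by (simp add: eval_nat_numeral)
qed

lemma theta_S_analytic:
  assumes \<rho>: "norm \<rho> < 1" "\<rho> \<noteq> 0" and "g analytic_on A" "k analytic_on A"
    and "\<And>w. w \<in> A \<Longrightarrow> g w \<noteq> 0" "\<And>w. w \<in> A \<Longrightarrow> k w \<noteq> 0"
  shows "(\<lambda>w. theta_S1 \<rho> (g w) (k w)) analytic_on A" "(\<lambda>w. theta_S2 \<rho> (g w) (k w)) analytic_on A"
  unfolding theta_S1_def theta_S2_def
  by (intro analytic_intros assms(3,4); auto simp: assms qpoch_inf_self_nonzero norm_power_less_1)+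

lemma jtheta_bracket_S1:
  assumes "norm p < 1" "p \<noteq> 0" "u \<noteq> 0" "v\<^sup>2 = -1"
  defines "E1 \<equiv> qpoch_inf p p" and "E2 \<equiv> qpoch_inf (p\<^sup>2) (p\<^sup>2)" and "E4 \<equiv> qpoch_inf (p ^ 4) (p ^ 4)"
    and "j \<equiv> \<lambda>w. jtheta w (p\<^sup>2)"
  shows "j (1 / u\<^sup>2) * j (p * u\<^sup>2) * E2\<^sup>2 + v / u / u * j (p * u\<^sup>2) * (j (p * u))\<^sup>2 * (j (- u))\<^sup>2 / E2 =
    - j (p * u\<^sup>2) / (u\<^sup>2 * E2) * (j (p * u) * j (- u) * ((1 - v) * (E1 * E4 / E2) * jtheta (v * u) p))"
proof -
  have p2: "norm (p\<^sup>2) < 1" using assms(1) by (rule norm_power_less_1) simp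
  have E2: "E2 \<noteq> 0" unfolding E2_def by (rule qpoch_inf_self_nonzero[OF p2])
  have inv: "j (1 / u\<^sup>2) = - j (u\<^sup>2) / u\<^sup>2"
    unfolding j_def by (rule jtheta_inverse[OF p2]) (use assms(3) in simp)
  have split: "j (u\<^sup>2) * E2 ^ 3 = j u * j (p * u) * j (- u) * j (- (p * u))"
    unfolding j_def E2_def by (rule jtheta_square_split[OF assms(1,2)])
  have "jtheta p (p ^ 4) = E1 * E4 / E2"
    using jtheta_self_base_4[OF assms(1,2)] E2 by (simp add: E1_def E2_def E4_def field_simps)
  hence addition: "j u * j (- (p * u)) - v * (j (p * u) * j (- u)) = (1 - v) * (E1 * E4 / E2) * jtheta (v * u) p"
    using jtheta_addition[OF assms(1-4)] by (simp add: j_def)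
  have "j (1 / u\<^sup>2) * j (p * u\<^sup>2) * E2\<^sup>2 + v / u / u * j (p * u\<^sup>2) * (j (p * u))\<^sup>2 * (j (- u))\<^sup>2 / E2 =
      - j (p * u\<^sup>2) / (u\<^sup>2 * E2) * (j (u\<^sup>2) * E2 ^ 3 - v * (j (p * u) * j (- u))\<^sup>2)"
    unfolding inv using E2 assms(3) by (simp add: field_simps eval_nat_numeral)
  also have "j (u\<^sup>2) * E2 ^ 3 - v * (j (p * u) * j (- u))\<^sup>2 =
      j (p * u) * j (- u) * (j u * j (- (p * u)) - v * (j (p * u) * j (- u)))"
    unfolding split by (simp add: algebra_simps power2_eq_square)
  finally show ?thesis unfolding addition .
qed

text \<open>With \<open>u\<close> and \<open>z\<close> as above, the points with \<open>z = v/u\<close> and \<open>v\<^sup>2 = -1\<close> are those with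
  \<open>-q^(2n+8) y^4 = 1\<close>, where a denominator of an Appell--Lerch sum vanishes.\<close>
lemma theta_S1_special_value:
  assumes \<rho>: "norm \<rho> < 1" "\<rho> \<noteq> 0" and "u \<noteq> 0" "v\<^sup>2 = -1"
  shows "theta_S1 \<rho> u (v / u) = (1 + v) * qpoch_inf (\<rho> ^ 4) (\<rho> ^ 4) ^ 3 * jtheta (u ^ 4) (\<rho> ^ 4) / u ^ 3"
proof -
  define p where "p = \<rho>\<^sup>2"
  have rho_pow: "\<rho>\<^sup>2 = p" "\<rho> ^ 4 = p\<^sup>2" "\<rho> ^ 8 = p ^ 4" by (simp_all add: p_def flip: power_mult)
  have v: "v \<noteq> 0" "1 / v = - v" "v * v = -1" using assms(4) by (auto simp: power2_eq_square divide_simps)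
  have p: "norm p < 1" "p \<noteq> 0" "norm (p\<^sup>2) < 1" "p\<^sup>2 \<noteq> 0"
    using \<rho> by (auto simp: p_def intro!: norm_power_less_1)
  define E1 E2 E4 where "E1 = qpoch_inf p p" and "E2 = qpoch_inf (p\<^sup>2) (p\<^sup>2)" and "E4 = qpoch_inf (p ^ 4) (p ^ 4)"
  have E: "E1 \<noteq> 0" "E2 \<noteq> 0" "E4 \<noteq> 0"
    using p norm_power_less_1[of p 4] by (auto simp: E1_def E2_def E4_def intro!: qpoch_inf_self_nonzero)
  let ?j = "\<lambda>w. jtheta w (p\<^sup>2)" and ?g = "jtheta (v * u) p" and ?g' = "jtheta (- (v * u)) p"
  have z_squared: "(v / u)\<^sup>2 = - (1 / u\<^sup>2)" using assms(4) by (simp add: power_divide)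
  have "v / u = 1 / (- (v * u))" using v assms(3) by (simp add: field_simps)
  hence "jtheta (v / u) p = (1 / v) * ?g' / u"
    using jtheta_inverse[OF p(1), of "- (v * u)"] v(1) assms(3) by simp
  hence inv: "jtheta (v / u) p = - v * ?g' / u" by (simp only: v(2))
  have refl: "?j (- (p * (1 / u\<^sup>2))) = ?j (- (p * u\<^sup>2))" "?j (p * (1 / u\<^sup>2)) = ?j (p * u\<^sup>2)"
    using jtheta_reflect[OF p(4), of "- (p * u\<^sup>2)"] jtheta_reflect[OF p(4), of "p * u\<^sup>2"] p
    by (simp_all add: power2_eq_square)
  have split: "?j (u\<^sup>2) * E2 ^ 3 = ?j u * ?j (p * u) * ?j (- u) * ?j (- (p * u))"
    "?j (u ^ 4) * E2 ^ 3 = ?j (u\<^sup>2) * ?j (p * u\<^sup>2) * ?j (- (u\<^sup>2)) * ?j (- (p * u\<^sup>2))"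
    and square: "?j (- (u\<^sup>2)) * E1\<^sup>2 = ?g * ?g' * E2"
    using jtheta_square_split[OF p(1,2), of u] jtheta_square_split[OF p(1,2), of "u\<^sup>2"]
      jtheta_square[OF p(1), of "v * u"] assms(4) by (simp_all add: E1_def E2_def power_mult_distrib)
  have "theta_S1 \<rho> u (v / u) = ?j u * (?j (- (p * u\<^sup>2)) * ?j (- (p * u)) * (- v * ?g' / u)) / (E1 ^ 3 * E4) *
      (- ?j (p * u\<^sup>2) / (u\<^sup>2 * E2) * (?j (p * u) * ?j (- u) * ((1 - v) * (E1 * E4 / E2) * ?g)))"
    unfolding theta_S1_def rho_pow z_squared mult_minus_right refl minus_minus inv
      jtheta_bracket_S1[OF p(1,2) assms(3,4)]
    by (simp only: E1_def E2_def E4_def)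
  also have "\<dots> = v * (1 - v) / (u ^ 3 * E1\<^sup>2 * E2 ^ 3) * (?j u * ?j (p * u) * ?j (- u) * ?j (- (p * u))) *
      (?j (p * u\<^sup>2) * ?j (- (p * u\<^sup>2))) * (?g * ?g' * E2)"
    using E assms(3) by (simp add: field_simps eval_nat_numeral)
  also have "\<dots> = v * (1 - v) / u ^ 3 * (?j (u\<^sup>2) * ?j (p * u\<^sup>2) * ?j (- (u\<^sup>2)) * ?j (- (p * u\<^sup>2)))"
    unfolding split(1)[symmetric] square[symmetric] using E assms(3) by (simp add: field_simps)
  also have "v * (1 - v) = 1 + v"
    using v(3) by (simp add: algebra_simps)
  finally show ?thesis
    unfolding split(2)[symmetric] rho_pow E2_def by (simp add: mult_ac)
qed

lemma jtheta_even_odd_imaginary: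
  assumes "norm \<rho> < 1" "\<rho> \<noteq> 0" "u \<noteq> 0" "v\<^sup>2 = -1"
  shows "jtheta (\<rho> * (v * u)) (\<rho>\<^sup>2) = jtheta (\<rho> ^ 4 * u\<^sup>2) (\<rho> ^ 8) + \<rho> * v / u * jtheta (u\<^sup>2) (\<rho> ^ 8)"
proof -
  have base: "norm (\<rho>\<^sup>2) < 1" "\<rho>\<^sup>2 \<noteq> 0" "norm (\<rho> ^ 8) < 1" "\<rho> ^ 8 \<noteq> 0" "(\<rho>\<^sup>2) ^ 4 = \<rho> ^ 8"
    using assms(2) norm_power_less_1[OF assms(1)] by (simp_all flip: power_mult)
  have "v \<noteq> 0" using assms(4) by auto
  have "\<rho>\<^sup>2 * (\<rho> * (v * u))\<^sup>2 = - (\<rho> ^ 4 * u\<^sup>2)" "(\<rho>\<^sup>2) ^ 3 * (\<rho> * (v * u))\<^sup>2 = - (\<rho> ^ 8 * u\<^sup>2)"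
    using assms(4) by (simp_all add: power_mult_distrib flip: mult.assoc power_add power_mult)
  hence "jtheta (\<rho> * (v * u)) (\<rho>\<^sup>2) = jtheta (\<rho> ^ 4 * u\<^sup>2) (\<rho> ^ 8) - \<rho> * (v * u) * jtheta (\<rho> ^ 8 * u\<^sup>2) (\<rho> ^ 8)"
    using jtheta_even_odd[OF base(1,2), of "\<rho> * (v * u)"] assms \<open>v \<noteq> 0\<close> by (simp add: base(5))
  also have "jtheta (\<rho> ^ 8 * u\<^sup>2) (\<rho> ^ 8) = - jtheta (u\<^sup>2) (\<rho> ^ 8) / u\<^sup>2"
    by (rule jtheta_mult_base[OF base(3,4)]) (use assms(3) in simp)
  finally show ?thesis using assms(3) by (simp add: power2_eq_square)
qed

lemma jtheta_bracket_S2: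
  assumes \<rho>: "norm \<rho> < 1" "\<rho> \<noteq> 0" and uv: "u \<noteq> 0" "v\<^sup>2 = -1"
  defines "E4 \<equiv> qpoch_inf (\<rho> ^ 4) (\<rho> ^ 4)" and "E8 \<equiv> qpoch_inf (\<rho> ^ 8) (\<rho> ^ 8)"
    and "j \<equiv> \<lambda>w. jtheta w (\<rho> ^ 4)" and "b \<equiv> jtheta (\<rho> ^ 4 * u\<^sup>2) (\<rho> ^ 8)"
  shows "\<rho> / (v / u * u) * j (1 / u\<^sup>2) * j (\<rho>\<^sup>2 * u\<^sup>2) * E8 / E4 + 1 / u * j (\<rho>\<^sup>2 * u\<^sup>2) * b\<^sup>2 / E8 =
    j (\<rho>\<^sup>2 * u\<^sup>2) * b / (u * E8) * jtheta (\<rho> * (v * u)) (\<rho>\<^sup>2)"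
proof -
  have v: "v \<noteq> 0" "1 / v = - v" using uv(2) by (auto simp: power2_eq_square divide_simps)
  have base: "norm (\<rho> ^ 4) < 1" "\<rho> ^ 4 \<noteq> 0" "(\<rho> ^ 4)\<^sup>2 = \<rho> ^ 8"
    using \<rho> by (auto intro: norm_power_less_1)
  have E: "E4 \<noteq> 0" "E8 \<noteq> 0"
    using \<rho>(1) by (simp_all add: E4_def E8_def qpoch_inf_self_nonzero norm_power_less_1)
  have inverse: "j (1 / u\<^sup>2) = - j (u\<^sup>2) / u\<^sup>2"
    unfolding j_def by (rule jtheta_inverse[OF base(1)]) (use uv(1) in simp)
  have j_square: "j (u\<^sup>2) = jtheta (u\<^sup>2) (\<rho> ^ 8) * b * E4 / E8\<^sup>2"
    using jtheta_split_base[OF base(1,2), of "u\<^sup>2"] E(2) unfolding j_def b_def E4_def E8_def base(3)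
    by (simp add: field_simps)
  have "\<rho> / (v / u * u) * j (1 / u\<^sup>2) * j (\<rho>\<^sup>2 * u\<^sup>2) * E8 / E4 + 1 / u * j (\<rho>\<^sup>2 * u\<^sup>2) * b\<^sup>2 / E8 =
      j (\<rho>\<^sup>2 * u\<^sup>2) * b / (u * E8) * (b - \<rho> * (1 / v) / u * jtheta (u\<^sup>2) (\<rho> ^ 8))"
    unfolding inverse j_square using uv(1) v(1) E by (simp add: field_simps power2_eq_square)
  also have "b - \<rho> * (1 / v) / u * jtheta (u\<^sup>2) (\<rho> ^ 8) = jtheta (\<rho> * (v * u)) (\<rho>\<^sup>2)"
    unfolding v(2) jtheta_even_odd_imaginary[OF \<rho> uv] b_def by simp
  finally show ?thesis .
qed

lemma theta_S2_special_value:
  assumes \<rho>: "norm \<rho> < 1" "\<rho> \<noteq> 0" and "u \<noteq> 0" "v\<^sup>2 = -1"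
  shows "theta_S2 \<rho> u (v / u) = qpoch_inf (\<rho> ^ 4) (\<rho> ^ 4) ^ 3 * jtheta (u ^ 4) (\<rho> ^ 4) / u ^ 3"
proof -
  define p where "p = \<rho>\<^sup>2"
  have rho_pow: "\<rho>\<^sup>2 = p" "\<rho> ^ 4 = p\<^sup>2" "\<rho> ^ 8 = p ^ 4" by (simp_all add: p_def flip: power_mult)
  have v: "v \<noteq> 0" "1 / v = - v" using assms(4) by (auto simp: power2_eq_square divide_simps)
  have p: "norm p < 1" "p \<noteq> 0" "norm (p\<^sup>2) < 1" "p\<^sup>2 \<noteq> 0" "norm (p ^ 4) < 1"
    using \<rho> by (auto simp: p_def intro!: norm_power_less_1)
  define E1 E2 E4 where "E1 = qpoch_inf p p" and "E2 = qpoch_inf (p\<^sup>2) (p\<^sup>2)" and "E4 = qpoch_inf (p ^ 4) (p ^ 4)"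
  have E: "E1 \<noteq> 0" "E2 \<noteq> 0" "E4 \<noteq> 0"
    using p by (auto simp: E1_def E2_def E4_def intro!: qpoch_inf_self_nonzero)
  let ?j = "\<lambda>w. jtheta w (p\<^sup>2)" and ?g = "jtheta (\<rho> * (v * u)) p" and ?g' = "jtheta (- (\<rho> * (v * u))) p"
  let ?a = "jtheta (u\<^sup>2) (p ^ 4)" and ?b = "jtheta (p\<^sup>2 * u\<^sup>2) (p ^ 4)"
  have z_squared: "(v / u)\<^sup>2 = - (1 / u\<^sup>2)" using assms(4) by (simp add: power_divide)
  have "p / (- (\<rho> * (v * u))) = - \<rho> * (1 / v) / u" using \<rho> assms(3) by (simp add: p_def power2_eq_square)
  also have "\<dots> = \<rho> * (v / u)" unfolding v(2) by simp
  finally have refl: "jtheta (\<rho> * (v / u)) p = ?g'" "?j (p * (1 / u\<^sup>2)) = ?j (p * u\<^sup>2)"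
    using jtheta_reflect[OF p(2), of "- (\<rho> * (v * u))"] jtheta_reflect[OF p(4), of "p * u\<^sup>2"] p
    by (simp_all add: power2_eq_square)
  have inv: "?j (- (1 / u\<^sup>2)) = ?j (- (u\<^sup>2)) / u\<^sup>2"
    using jtheta_inverse[OF p(3), of "- (u\<^sup>2)"] assms(3) by simp
  have split: "?j (u ^ 4) * E2 ^ 3 = ?j (u\<^sup>2) * ?j (p * u\<^sup>2) * ?j (- (u\<^sup>2)) * ?j (- (p * u\<^sup>2))"
    and square: "?j (- (p * u\<^sup>2)) * E1\<^sup>2 = ?g * ?g' * E2" "?a * E2\<^sup>2 = ?j u * ?j (- u) * E4"
    using jtheta_square_split[OF p(1,2), of "u\<^sup>2"] jtheta_square[OF p(1), of "\<rho> * (v * u)"]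
      jtheta_square[OF p(3), of u] assms(4)
    by (simp_all add: E1_def E2_def E4_def power_mult_distrib rho_pow)
  have j_u2: "?j (u\<^sup>2) = ?a * ?b * E2 / E4\<^sup>2"
    using jtheta_split_base[OF p(3,4), of "u\<^sup>2"] E(3) by (simp add: E2_def E4_def field_simps)
  have "theta_S2 \<rho> u (v / u) =
      ?j u * (?j (- (u\<^sup>2)) / u\<^sup>2 * ?j (- u) * ?g') / E1\<^sup>2 * (?j (p * u\<^sup>2) * ?b / (u * E4) * ?g)"
    unfolding theta_S2_def rho_pow z_squared mult_minus_right minus_minus refl inv
      jtheta_bracket_S2[OF assms, unfolded rho_pow]
    by (simp only: E1_def E2_def E4_def)
  also have "\<dots> = (?j u * ?j (- u) * E4) * ?b * ?j (p * u\<^sup>2) * ?j (- (u\<^sup>2)) * (?g * ?g' * E2) /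
      (u ^ 3 * E1\<^sup>2 * E4\<^sup>2 * E2)"
    using E assms(3) by (simp add: field_simps eval_nat_numeral)
  also have "\<dots> = (?j (u\<^sup>2) * ?j (p * u\<^sup>2) * ?j (- (u\<^sup>2)) * ?j (- (p * u\<^sup>2))) / u ^ 3"
    unfolding square[symmetric] j_u2 using E by (simp add: field_simps eval_nat_numeral)
  finally show ?thesis
    unfolding split[symmetric] rho_pow E2_def by (simp add: mult_ac)
qed


section \<open>Multiplicatively quasi-periodic functions\<close>

lemma entire_quasi_periodic_eq_0:
  fixes G :: "complex \<Rightarrow> complex"
  assumes hol: "G holomorphic_on UNIV" and eq: "\<And>y. G (Q * y) = \<mu> * G y"
    and ne: "\<And>k::nat. \<mu> \<noteq> Q ^ k"
  shows "G y = 0"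
proof (rule holomorphic_fun_eq_0_on_connected[OF hol])
  fix k
  have "(deriv ^^ k) (\<lambda>w. G (Q * w)) 0 = Q ^ k * (deriv ^^ k) G (Q * 0)"
    by (rule higher_deriv_compose_linear[OF hol, where S = UNIV]) auto
  moreover have "(deriv ^^ k) (\<lambda>w. \<mu> * G w) 0 = \<mu> * (deriv ^^ k) G 0"
    by (rule higher_deriv_cmult[OF hol]) auto
  ultimately have "Q ^ k * (deriv ^^ k) G 0 = \<mu> * (deriv ^^ k) G 0"
    by (auto simp: eq)
  thus "(deriv ^^ k) G 0 = 0" using ne[of k] by simp
qed auto

lemma exists_power_annulus:
  fixes Q y :: complex
  assumes "norm Q < 1" "Q \<noteq> 0" "y \<noteq> 0" "norm y \<le> 1"
  obtains k :: nat and z where "y = Q ^ k * z" "norm Q \<le> norm z" "norm z \<le> 1"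
proof -
  have "(\<lambda>k. norm Q ^ k) \<longlonglongrightarrow> 0" using assms by (intro LIMSEQ_power_zero) auto
  hence "eventually (\<lambda>k. norm Q ^ k < norm y) sequentially"
    by (rule order_tendstoD(2)) (use assms in auto)
  then obtain N where "norm Q ^ N < norm y"
    by (auto simp: eventually_sequentially)
  from ex_least_nat_less[of "\<lambda>k. norm Q ^ k < norm y", OF this]
  obtain k where k: "norm Q ^ Suc k < norm y" "norm y \<le> norm Q ^ k"
    using assms(4) by (auto simp: not_less)
  show ?thesis
  proof (rule that[of k "y / Q ^ k"])
    show "y = Q ^ k * (y / Q ^ k)" using assms by simp
    show "norm Q \<le> norm (y / Q ^ k)" "norm (y / Q ^ k) \<le> 1"
      using k assms by (auto simp: norm_divide norm_power field_simps)
  qed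
qed

lemma quasi_periodic_bounded_near_0:
  fixes H :: "complex \<Rightarrow> complex"
  assumes Q: "norm Q < 1" "Q \<noteq> 0" and cont: "continuous_on (- {0}) H"
    and eq: "\<And>y. y \<noteq> 0 \<Longrightarrow> H (Q * y) = \<mu> * H y" and \<mu>: "norm \<mu> \<le> 1"
  obtains B where "\<And>y. y \<noteq> 0 \<Longrightarrow> norm y \<le> 1 \<Longrightarrow> norm (H y) \<le> B"
proof -
  have "cball 0 1 - ball 0 (norm Q) \<subseteq> - {0::complex}" using Q by auto
  hence "compact (H ` (cball 0 1 - ball 0 (norm Q)))"
    by (intro compact_continuous_image compact_diff continuous_on_subset[OF cont]) auto
  from compact_imp_bounded[OF this]
  obtain B where "\<And>z. z \<in> cball 0 1 - ball 0 (norm Q) \<Longrightarrow> norm (H z) \<le> B"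
    unfolding bounded_iff by blast
  hence B: "norm (H z) \<le> B" if "norm Q \<le> norm z" "norm z \<le> 1" for z
    using that by simp
  have iterate: "H (Q ^ k * z) = \<mu> ^ k * H z" if "z \<noteq> 0" for z k
  proof (induction k)
    case (Suc k)
    thus ?case using eq[of "Q ^ k * z"] that Q by (simp add: mult.assoc)
  qed simp
  have "norm (H y) \<le> B" if y: "y \<noteq> 0" "norm y \<le> 1" for y
  proof -
    obtain k z where kz: "y = Q ^ k * z" "norm Q \<le> norm z" "norm z \<le> 1"
      using exists_power_annulus[OF Q y] by blast
    hence "norm (H y) = norm \<mu> ^ k * norm (H z)"
      using iterate[of z k] y by (simp add: norm_mult norm_power)
    also have "\<dots> \<le> 1 * B"
      using B[OF kz(2,3)] \<mu> by (intro mult_mono power_le_one) auto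
    finally show ?thesis by simp
  qed
  thus ?thesis using that by blast
qed

lemma bounded_imp_entire_extension:
  fixes H :: "complex \<Rightarrow> complex"
  assumes hol: "H holomorphic_on - {0}" and bound: "\<And>y. y \<noteq> 0 \<Longrightarrow> norm y \<le> 1 \<Longrightarrow> norm (H y) \<le> B"
  obtains g where "g holomorphic_on UNIV" "\<And>y. y \<noteq> 0 \<Longrightarrow> g y = H y"
proof -
  have "\<exists>g. g holomorphic_on UNIV \<and> (\<forall>y\<in>UNIV - {0}. g y = H y)"
  proof (subst holomorphic_on_extend_bounded)
    have "eventually (\<lambda>y::complex. y \<in> ball 0 1 - {0}) (at 0)"
      by (rule eventually_at_in_open) auto
    hence "eventually (\<lambda>y. norm (H y) \<le> B) (at 0)"
      by eventually_elim (use bound in auto)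
    thus "\<exists>B. eventually (\<lambda>y. norm (H y) \<le> B) (at 0)" by blast
  qed (use hol in \<open>auto simp: Compl_eq_Diff_UNIV\<close>)
  thus ?thesis using that by auto
qed

lemma punctured_quasi_periodic_eq_0:
  fixes G :: "complex \<Rightarrow> complex"
  assumes Q: "norm Q < 1" "Q \<noteq> 0" and hol: "G holomorphic_on - {0}"
    and eq: "\<And>y. y \<noteq> 0 \<Longrightarrow> G (Q * y) = C * G y"
    and ne: "\<And>k::int. C \<noteq> Q powi k" and y: "y \<noteq> 0"
  shows "G y = 0"
proof -
  have "(\<lambda>m. norm Q ^ m * norm C) \<longlonglongrightarrow> 0 * norm C"
    using Q by (intro tendsto_intros LIMSEQ_power_zero) auto
  hence "eventually (\<lambda>m. norm Q ^ m * norm C < 1) sequentially"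
    by (intro order_tendstoD(2)[of _ "0 * norm C"]) auto
  then obtain m where m: "norm Q ^ m * norm C < 1" by (auto simp: eventually_sequentially)
  define \<mu> where "\<mu> = Q ^ m * C"
  define H where "H y = y ^ m * G y" for y
  have H_eq: "H (Q * y) = \<mu> * H y" if "y \<noteq> 0" for y
    using eq[OF that] by (simp add: H_def \<mu>_def power_mult_distrib)
  have H_hol: "H holomorphic_on - {0}" unfolding H_def by (intro holomorphic_intros hol)
  obtain B where B: "\<And>y. y \<noteq> 0 \<Longrightarrow> norm y \<le> 1 \<Longrightarrow> norm (H y) \<le> B"
    using quasi_periodic_bounded_near_0[OF Q holomorphic_on_imp_continuous_on[OF H_hol] H_eq] m
    by (auto simp: \<mu>_def norm_mult norm_power)
  then obtain g where g: "g holomorphic_on UNIV" "\<And>z. z \<noteq> 0 \<Longrightarrow> g z = H z"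
    using bounded_imp_entire_extension[OF H_hol] by blast
  have cont: "continuous_on UNIV g" by (rule holomorphic_on_imp_continuous_on[OF g(1)])
  have "g (Q * y) - \<mu> * g y = 0" for y
  proof (rule continuous_constant_on_closure[where S = "- {0}" and f = "\<lambda>y. g (Q * y) - \<mu> * g y" and x = y])
    show "continuous_on (closure (- {0})) (\<lambda>y. g (Q * y) - \<mu> * g y)"
      by (intro continuous_intros continuous_on_compose2[OF cont]) auto
  qed (use Q g(2) H_eq in \<open>auto simp: closure_complement\<close>)
  hence "g (Q * y) = \<mu> * g y" for y by simp
  hence "g y = 0"
  proof (rule entire_quasi_periodic_eq_0[OF g(1)])
    show "\<mu> \<noteq> Q ^ k" for k
      using ne[of "int k - int m"] Q by (auto simp: \<mu>_def power_int_diff field_simps)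
  qed
  thus ?thesis using g(2)[OF y] y by (simp add: H_def)
qed

definition removable_at :: "(complex \<Rightarrow> complex) \<Rightarrow> complex \<Rightarrow> bool" where
  "removable_at f z \<longleftrightarrow> isolated_singularity_at f z \<and> (\<exists>c. f \<midarrow>z\<rightarrow> c)"

lemma analytic_imp_removable_at: "f analytic_on {z} \<Longrightarrow> removable_at f z"
  unfolding removable_at_def using isolated_singularity_at_analytic analytic_at_imp_isCont isContD by blast

lemma removable_at_add: "removable_at f z \<Longrightarrow> removable_at g z \<Longrightarrow> removable_at (\<lambda>w. f w + g w) z"
  unfolding removable_at_def using isolated_singularity_at_add tendsto_add by blast

lemma removable_at_cong:
  assumes "eventually (\<lambda>w. f w = g w) (at z)"
  shows "removable_at f z \<longleftrightarrow> removable_at g z"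
  unfolding removable_at_def
  using isolated_singularity_at_cong[OF assms refl] filterlim_cong[OF refl refl assms] by blast

lemma removable_at_quotient_simple_zero:
  assumes N: "N analytic_on {z}" "N z = 0" and D: "D analytic_on {z}" "D z = 0" "deriv D z \<noteq> 0"
  shows "removable_at (\<lambda>w. N w / D w) z"
proof -
  have "(N has_field_derivative deriv N z) (at z)" "(D has_field_derivative deriv D z) (at z)"
    using N(1) D(1) analytic_derivI by blast+
  hence "((\<lambda>w. (N w - N z) / (w - z)) \<longlongrightarrow> deriv N z) (at z)" "((\<lambda>w. (D w - D z) / (w - z)) \<longlongrightarrow> deriv D z) (at z)"
    by (simp_all add: has_field_derivative_iff)
  hence "((\<lambda>w. ((N w - N z) / (w - z)) / ((D w - D z) / (w - z))) \<longlongrightarrow> deriv N z / deriv D z) (at z)"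
    using D(3) by (rule tendsto_divide)
  moreover have "eventually (\<lambda>w. ((N w - N z) / (w - z)) / ((D w - D z) / (w - z)) = N w / D w) (at z)"
    using eventually_neq_at_within[of z] by eventually_elim (auto simp: N D)
  ultimately have "(\<lambda>w. N w / D w) \<midarrow>z\<rightarrow> deriv N z / deriv D z"
    by (rule Lim_transform_eventually)
  moreover have "isolated_singularity_at (\<lambda>w. N w / D w) z"
    by (intro isolated_singularity_at_divide isolated_singularity_at_analytic not_essential_analytic N D)
  ultimately show ?thesis unfolding removable_at_def by blast
qed

theorem removable_quasi_periodic_eq_0:
  fixes E :: "complex \<Rightarrow> complex"
  assumes Q: "norm Q < 1" "Q \<noteq> 0" and removable: "\<And>y. y \<noteq> 0 \<Longrightarrow> removable_at E y"
    and eq: "\<And>y. y \<noteq> 0 \<Longrightarrow> eventually (\<lambda>w. E (Q * w) = C * E w) (at y)"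
    and ne: "\<And>k::int. C \<noteq> Q powi k" and y: "y \<noteq> 0" "isCont E y"
  shows "E y = 0"
proof -
  let ?G = "remove_sings E"
  have lim: "E \<midarrow>z\<rightarrow> ?G z" if "z \<noteq> 0" for z
    using removable[OF that] remove_sings_eqI unfolding removable_at_def by metis
  have "?G analytic_on - {0}"
    using removable remove_sings_analytic_at
    unfolding analytic_on_analytic_at[of _ "- {0}"] removable_at_def by blast
  hence hol: "?G holomorphic_on - {0}" by (rule analytic_imp_holomorphic)
  have G_eq: "?G (Q * z) = C * ?G z" if z: "z \<noteq> 0" for z
  proof (rule tendsto_unique)
    have "filterlim (\<lambda>w. Q * w) (at (Q * z)) (at z)"
      using eventually_neq_at_within[of z]
      by (intro filterlim_atI tendsto_intros) (use Q in \<open>auto elim!: eventually_mono\<close>)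
    moreover have "Q * z \<noteq> 0" using Q z by simp
    ultimately show "((\<lambda>w. E (Q * w)) \<longlongrightarrow> ?G (Q * z)) (at z)"
      using filterlim_compose[OF lim] by blast
    show "((\<lambda>w. E (Q * w)) \<longlongrightarrow> C * ?G z) (at z)"
      using tendsto_mult_left[OF lim[OF z]] filterlim_cong[OF refl refl eq[OF z]] by blast
  qed auto
  have "?G y = 0" by (rule punctured_quasi_periodic_eq_0[OF Q hol G_eq ne y(1)])
  thus ?thesis using y(2) remove_sings_eqI isContD by metis
qed


section \<open>Holomorphy of infinite sums\<close>

lemma analytic_at_infsum:
  fixes f :: "'i \<Rightarrow> complex \<Rightarrow> complex"
  assumes M: "M summable_on I"
    and bound: "eventually (\<lambda>w. \<forall>i\<in>I. norm (f i w) \<le> M i) (nhds z)"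
    and diff: "eventually (\<lambda>w. \<forall>i\<in>I. f i field_differentiable (at w)) (nhds z)"
  shows "(\<lambda>w. infsum (\<lambda>i. f i w) I) analytic_on {z}"
proof -
  obtain d where d: "d > 0" "\<And>w i. dist w z < d \<Longrightarrow> i \<in> I \<Longrightarrow> norm (f i w) \<le> M i \<and> f i field_differentiable (at w)"
    using eventually_conj[OF bound diff] unfolding eventually_nhds_metric by blast
  define r where "r = d / 2"
  have r: "r > 0" "\<And>w. w \<in> cball z r \<Longrightarrow> dist w z < d" using d by (auto simp: r_def dist_commute)
  have uniform: "uniform_limit (cball z r) (\<lambda>X y. \<Sum>x\<in>X. f x y) (\<lambda>y. \<Sum>\<^sub>\<infinity>x\<in>I. f x y) (finite_subsets_at_top I)"
    by (rule Weierstrass_m_test_general[OF _ M]) (use d r in blast)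
  have partial: "eventually (\<lambda>X. continuous_on (cball z r) (\<lambda>y. \<Sum>x\<in>X. f x y) \<and>
     (\<lambda>y. \<Sum>x\<in>X. f x y) holomorphic_on ball z r) (finite_subsets_at_top I)"
  proof (rule eventually_finite_subsets_at_top_weakI)
    fix X assume "finite X" "X \<subseteq> I"
    hence "f i holomorphic_on cball z r" if "i \<in> X" for i
      unfolding holomorphic_on_def using d(2)[of _ i] r that field_differentiable_at_within by blast
    hence "(\<lambda>y. \<Sum>x\<in>X. f x y) holomorphic_on cball z r"
      by (rule holomorphic_on_sum)
    thus "continuous_on (cball z r) (\<lambda>y. \<Sum>x\<in>X. f x y) \<and> (\<lambda>y. \<Sum>x\<in>X. f x y) holomorphic_on ball z r"
      by (meson ball_subset_cball holomorphic_on_imp_continuous_on holomorphic_on_subset)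
  qed
  have "(\<lambda>y. \<Sum>\<^sub>\<infinity>x\<in>I. f x y) holomorphic_on ball z r"
    by (rule holomorphic_uniform_limit[OF partial uniform]) auto
  thus ?thesis
    unfolding analytic_at using r by (intro exI[of _ "ball z r"]) auto
qed

lemma field_differentiable_power_int:
  fixes g :: "complex \<Rightarrow> complex"
  assumes "g field_differentiable at w" "g w \<noteq> 0"
  shows "(\<lambda>w. g w powi k) field_differentiable at w"
  using assms unfolding field_differentiable_def by (auto intro!: derivative_eq_intros)

lemma power_int_le_add_bounds:
  fixes a b t :: real
  assumes "0 < a" "a \<le> t" "t \<le> b"
  shows "t powi k \<le> a powi k + b powi k"
proof (cases "k \<ge> 0")
  case True
  hence "t powi k \<le> b powi k" using assms by (intro power_int_mono) auto
  thus ?thesis using assms by (simp add: add_increasing)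
next
  case False
  hence "t powi k \<le> a powi k" using assms by (intro power_int_antimono) auto
  thus ?thesis using assms by (simp add: add_increasing2)
qed

lemma isCont_imp_tendsto_nhds: "isCont g z \<Longrightarrow> (g \<longlongrightarrow> g z) (nhds z)"
  by (simp add: isCont_def tendsto_at_iff_tendsto_nhds)

lemma eventually_norm_theta_term_le:
  assumes p: "norm p < 1" "p \<noteq> 0" and g: "isCont g z" "g z \<noteq> 0"
  obtains M where "M summable_on UNIV" "eventually (\<lambda>w. \<forall>k. norm (theta_term p (g w) k) \<le> M k) (nhds z)"
proof -
  let ?a = "norm (g z) / 2" and ?b = "norm (g z) * 2"
  have "((\<lambda>w. norm (g w)) \<longlongrightarrow> norm (g z)) (nhds z)"
    by (intro tendsto_norm isCont_imp_tendsto_nhds g)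
  hence "eventually (\<lambda>w. ?a < norm (g w)) (nhds z)" "eventually (\<lambda>w. norm (g w) < ?b) (nhds z)"
    by (rule order_tendstoD, use g(2) in simp)+
  hence "eventually (\<lambda>w. \<forall>k. norm (theta_term p (g w) k) \<le>
      norm p powi tri k * ?a powi k + norm p powi tri k * ?b powi k) (nhds z)"
  proof eventually_elim
    case (elim w)
    thus ?case
      using g(2) unfolding norm_theta_term distrib_left[symmetric]
      by (intro allI mult_left_mono power_int_le_add_bounds) auto
  qed
  moreover have "(\<lambda>k. norm p powi tri k * ?a powi k + norm p powi tri k * ?b powi k) summable_on UNIV"
    using p g(2) by (intro summable_on_add summable_on_gauss) auto
  ultimately show ?thesis using that by blast
qed

lemma finite_power_int_between:
  fixes r a b :: real
  assumes "0 < r" "r < 1" "0 < a"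
  shows "finite {m::int. a \<le> r powi m \<and> r powi m \<le> b}"
proof -
  have lim: "(\<lambda>m. r ^ m) \<longlonglongrightarrow> 0" using assms by (intro LIMSEQ_power_zero) auto
  have "eventually (\<lambda>N. r ^ N < a \<and> r ^ N < 1 / max b 1) sequentially"
    by (intro eventually_conj order_tendstoD(2)[OF lim]) (use assms in auto)
  then obtain N where N: "r ^ N < a" "r ^ N < 1 / max b 1"
    by (auto simp: eventually_sequentially)
  have "{m::int. a \<le> r powi m \<and> r powi m \<le> b} \<subseteq> {- int N..int N}"
  proof clarify
    fix m :: int assume m: "a \<le> r powi m" "r powi m \<le> b"
    have "m \<le> int N"
      using power_int_decreasing[of "int N" m r] m(1) N(1) assms by force
    moreover have "- m \<le> int N"
    proof (rule ccontr)
      assume "\<not> - m \<le> int N"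
      hence "1 / r ^ N \<le> r powi m"
        using power_int_decreasing[of m "- int N" r] assms by (simp add: power_int_minus divide_inverse)
      moreover have "b < 1 / r ^ N"
      proof -
        have "b * r ^ N \<le> max b 1 * r ^ N" using assms by (intro mult_right_mono) auto
        also have "\<dots> < 1" using N(2) by (simp add: less_divide_eq max.strict_coboundedI2 mult.commute)
        finally show ?thesis using assms by (simp add: less_divide_eq)
      qed
      ultimately show False using m(2) by linarith
    qed
    ultimately show "m \<in> {- int N..int N}" by simp
  qed
  thus ?thesis by (rule finite_subset) simp
qed

lemma norm_one_minus_ge_half:
  fixes w :: "'a :: real_normed_div_algebra"
  assumes "norm w \<le> 1 / 2 \<or> norm w \<ge> 2"
  shows "norm (1 - w) \<ge> 1 / 2"
  using assms norm_triangle_ineq2[of 1 w] norm_triangle_ineq2[of w 1] by (auto simp: norm_minus_commute)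

lemma eventually_power_int_away_from:
  fixes Q c :: complex
  assumes Q: "norm Q < 1" "Q \<noteq> 0" and c: "c \<noteq> 0" "\<And>m. m \<in> I \<Longrightarrow> Q powi m \<noteq> c"
  obtains \<delta> where "\<delta> > 0" "eventually (\<lambda>d. \<forall>m\<in>I. norm (1 - Q powi m / d) \<ge> \<delta>) (nhds c)"
proof -
  define F where "F = I \<inter> {m. norm c / 4 \<le> norm Q powi m \<and> norm Q powi m \<le> 4 * norm c}"
  have F: "finite F" unfolding F_def using Q c by (intro finite_Int disjI2 finite_power_int_between) auto
  obtain e where e: "e > 0" "\<And>m. m \<in> F \<Longrightarrow> e \<le> norm (1 - Q powi m / c)"
    using finite_set_avoid[of "(\<lambda>m. Q powi m / c) ` F" 1] F c by (auto simp: F_def dist_norm)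
  have ident: "((\<lambda>d. d) \<longlongrightarrow> c) (nhds c)" by (rule filterlim_ident)
  have "eventually (\<lambda>d. \<forall>m\<in>F. e / 2 < norm (1 - Q powi m / d)) (nhds c)"
  proof (rule eventually_ball_finite[OF F], safe)
    fix m assume "m \<in> F"
    have "((\<lambda>d. norm (1 - Q powi m / d)) \<longlongrightarrow> norm (1 - Q powi m / c)) (nhds c)"
      by (intro tendsto_intros ident c)
    thus "eventually (\<lambda>d. e / 2 < norm (1 - Q powi m / d)) (nhds c)"
      by (rule order_tendstoD(1)) (use e \<open>m \<in> F\<close> in force)
  qed
  moreover have "eventually (\<lambda>d. norm d < 2 * norm c) (nhds c)" "eventually (\<lambda>d. norm d > norm c / 2) (nhds c)"
    by (rule order_tendstoD[OF tendsto_norm[OF ident]], use c in simp)+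
  ultimately have "eventually (\<lambda>d. \<forall>m\<in>I. norm (1 - Q powi m / d) \<ge> min (e / 2) (1 / 2)) (nhds c)"
  proof eventually_elim
    case (elim d)
    have d: "norm d > 0" using elim(3) c(1) by force
    show ?case
    proof
      fix m assume "m \<in> I"
      hence "m \<in> F \<or> norm (Q powi m / d) \<le> 1 / 2 \<or> norm (Q powi m / d) \<ge> 2"
        using elim(2,3) d by (force simp: F_def norm_divide norm_power_int divide_le_eq le_divide_eq)
      thus "norm (1 - Q powi m / d) \<ge> min (e / 2) (1 / 2)"
        using elim(1) norm_one_minus_ge_half[of "Q powi m / d"] by force
    qed
  qed
  thus ?thesis using that[of "min (e / 2) (1 / 2)"] e(1) by simp
qed

lemma eventually_field_differentiable:
  assumes "f analytic_on {z}"
  shows "eventually (\<lambda>w. f field_differentiable at w) (nhds z)"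
proof -
  obtain A where A: "open A" "z \<in> A" "f holomorphic_on A"
    using assms by (auto simp: analytic_at)
  from eventually_nhds_in_open[OF A(1,2)] show ?thesis
    by eventually_elim (use A holomorphic_on_imp_differentiable_at in blast)
qed

text \<open>The summands are those of the numerator of an Appell--Lerch sum.  Restricting the index set
  allows the one summand that has a pole at a given point to be split off.\<close>
lemma
  fixes g c :: "complex \<Rightarrow> complex" and e :: "int \<Rightarrow> int"
  assumes P: "norm P < 1" "P \<noteq> 0" and Q: "norm Q < 1" "Q \<noteq> 0"
    and g: "g analytic_on {z}" "g z \<noteq> 0" and c: "c analytic_on {z}" "c z \<noteq> 0"
    and I: "\<And>r. r \<in> I \<Longrightarrow> Q powi (e r) \<noteq> c z"
  shows analytic_at_appell: "(\<lambda>w. \<Sum>\<^sub>\<infinity>r\<in>I. theta_term P (g w) r / (1 - Q powi (e r) / c w)) analytic_on {z}"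
    and summable_on_appell: "(\<lambda>r. theta_term P (g z) r / (1 - Q powi (e r) / c z)) summable_on I"
proof -
  let ?f = "\<lambda>r w. theta_term P (g w) r / (1 - Q powi (e r) / c w)"
  have cont: "isCont g z" "isCont c z" using g c by (auto simp: analytic_at_imp_isCont)
  obtain M where M: "M summable_on UNIV" "eventually (\<lambda>w. \<forall>k. norm (theta_term P (g w) k) \<le> M k) (nhds z)"
    using eventually_norm_theta_term_le[OF P cont(1) g(2)] by blast
  obtain \<delta> where \<delta>: "\<delta> > 0" "eventually (\<lambda>d. \<forall>m\<in>e ` I. norm (1 - Q powi m / d) \<ge> \<delta>) (nhds (c z))"
    by (rule eventually_power_int_away_from[OF Q c(2), of "e ` I"]) (use I in auto)
  have denom: "eventually (\<lambda>w. \<forall>m\<in>e ` I. norm (1 - Q powi m / c w) \<ge> \<delta>) (nhds z)"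
    by (rule eventually_compose_filterlim[OF \<delta>(2) isCont_imp_tendsto_nhds[OF cont(2)]])
  have bound: "eventually (\<lambda>w. \<forall>r\<in>I. norm (?f r w) \<le> M r / \<delta>) (nhds z)"
    using M(2) denom
  proof eventually_elim
    case (elim w)
    thus ?case
      using \<delta>(1) order_trans[OF norm_ge_zero] unfolding norm_divide by (intro ballI frac_le) blast+
  qed
  have summable: "(\<lambda>r. M r / \<delta>) summable_on I"
    unfolding divide_inverse by (intro summable_on_cmult_left summable_on_subset_banach[OF M(1)]) simp
  show "(\<lambda>r. ?f r z) summable_on I"
    by (rule abs_summable_summable, rule Infinite_Sum.abs_summable_on_comparison_test'[OF summable])
       (use eventually_nhds_x_imp_x[OF bound] in blast)
  have "eventually (\<lambda>w. g w \<noteq> 0) (nhds z)" "eventually (\<lambda>w. c w \<noteq> 0) (nhds z)"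
    using tendsto_imp_eventually_ne[OF isCont_imp_tendsto_nhds] cont g(2) c(2) by blast+
  hence "eventually (\<lambda>w. \<forall>r\<in>I. ?f r field_differentiable (at w)) (nhds z)"
    using denom eventually_field_differentiable[OF g(1)] eventually_field_differentiable[OF c(1)]
  proof eventually_elim
    case (elim w)
    have "1 - Q powi (e r) / c w \<noteq> 0" if "r \<in> I" for r
      using elim(3) that \<delta>(1) by force
    thus ?case unfolding theta_term_def using elim
      by (auto intro!: field_differentiable_divide field_differentiable_mult field_differentiable_const
          field_differentiable_power_int field_differentiable_diff)
  qed
  from analytic_at_infsum[OF summable bound this] show "(\<lambda>w. \<Sum>\<^sub>\<infinity>r\<in>I. ?f r w) analytic_on {z}" .
qed


section \<open>Hecke-type double sums\<close>

definition hecke_term :: "int \<Rightarrow> int \<Rightarrow> int \<Rightarrow> complex \<Rightarrow> complex \<Rightarrow> complex \<Rightarrow> int \<Rightarrow> int \<Rightarrow> complex" where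
  "hecke_term a b c x y q r s =
    (-1) powi (r + s) * x powi r * y powi s * q powi (a * tri r + b * r * s + c * tri s)"

definition hecke_row :: "int \<Rightarrow> int \<Rightarrow> int \<Rightarrow> complex \<Rightarrow> complex \<Rightarrow> complex \<Rightarrow> int \<Rightarrow> complex" where
  "hecke_row a b c x y q t = (- x) powi t * q powi (a * tri t) * jtheta (q powi (b * t) * y) (q powi c)"

definition sg_weight :: "int \<Rightarrow> int \<Rightarrow> complex" where
  "sg_weight r s = (if sg r = sg s then of_int (sg r) else 0)"

lemma hecke_term_swap: "hecke_term a b c x y q r s = hecke_term c b a y x q s r"
  by (simp add: hecke_term_def mult_ac add_ac)

lemma hecke_term_eq_theta_term:
  assumes "x \<noteq> 0" "y \<noteq> 0" "q \<noteq> 0"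
  shows "hecke_term a b c x y q t s =
    (- x) powi t * q powi (a * tri t) * theta_term (q powi c) (q powi (b * t) * y) s"
proof -
  define m where "m = monomial x y q"
  note m = monomial_rules[OF assms m_def] and eq = monomial_eqI[OF m_def]
  show ?thesis
    unfolding hecke_term_def theta_term_def by (simp only: m, rule eq) (simp_all add: algebra_simps)
qed

lemma hecke_term_add:
  assumes "x \<noteq> 0" "y \<noteq> 0" "q \<noteq> 0"
  shows "hecke_term a b c x y q (r + k) (s + l) =
    hecke_term a b c x y q k l * hecke_term a b c (q powi (a * k + b * l) * x) (q powi (b * k + c * l) * y) q r s"
proof -
  define m where "m = monomial x y q"
  note m = monomial_rules[OF assms m_def] and eq = monomial_eqI[OF m_def]
  show ?thesis
    unfolding hecke_term_def tri_add by (simp only: m, rule eq) (simp_all add: algebra_simps)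
qed

lemma analytic_on_hecke_row [analytic_intros]:
  assumes "norm q < 1" "q \<noteq> 0" "c > 0" "g analytic_on A" "k analytic_on A"
    and "\<And>z. z \<in> A \<Longrightarrow> g z \<noteq> 0" "\<And>z. z \<in> A \<Longrightarrow> k z \<noteq> 0"
  shows "(\<lambda>z. hecke_row a b c (g z) (k z) q t) analytic_on A"
  unfolding hecke_row_def using assms by (intro analytic_intros norm_power_int_less_1) auto

context
  fixes a b c :: int and q :: complex
  assumes q: "norm q < 1" "q \<noteq> 0" and ac: "a > 0" "c > 0" and b: "b \<ge> 0"
begin

lemma has_sum_hecke_row:
  assumes "x \<noteq> 0" "y \<noteq> 0"
  shows "((\<lambda>s. hecke_term a b c x y q t s) has_sum hecke_row a b c x y q t) UNIV"
  unfolding hecke_term_eq_theta_term[OF assms q(2)] hecke_row_def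
  using assms q by (intro has_sum_cmult_right jacobi_triple_product norm_power_int_less_1 ac) auto

lemma norm_hecke_term_le:
  "norm (sg_weight r s * hecke_term a b c x y q r s) \<le>
    norm (theta_term (q powi a) x r) * norm (theta_term (q powi c) y s)"
proof (cases "sg r = sg s")
  case True
  hence "r * s \<ge> 0" by (auto simp: sg_def split: if_splits intro: mult_nonpos_nonpos)
  hence rs: "b * r * s \<ge> 0" using b by (simp add: mult.assoc)
  have "norm (sg_weight r s * hecke_term a b c x y q r s) = norm q powi (b * r * s) *
      (norm (theta_term (q powi a) x r) * norm (theta_term (q powi c) y s))"
    unfolding hecke_term_def norm_theta_term using q True
    by (auto simp: sg_weight_def sg_def norm_mult norm_power norm_power_int power_int_add power_int_mult)
  also have "\<dots> \<le> 1 * (norm (theta_term (q powi a) x r) * norm (theta_term (q powi c) y s))"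
    using rs q by (intro mult_right_mono) (auto intro!: power_int_le_one)
  finally show ?thesis by simp
qed (simp add: sg_weight_def)

lemma has_sum_hecke_f:
  assumes "x \<noteq> 0" "y \<noteq> 0"
  shows "((\<lambda>(r, s). sg_weight r s * hecke_term a b c x y q r s) has_sum hecke_f a b c x y q) UNIV"
proof -
  let ?g = "\<lambda>(r, s). sg_weight r s * hecke_term a b c x y q r s"
  have "(\<lambda>(r, s). norm (theta_term (q powi a) x r) * norm (theta_term (q powi c) y s)) summable_on UNIV \<times> UNIV"
    using assms q ac by (intro summable_on_product summable_norm_theta_term norm_power_int_less_1) auto
  hence "(\<lambda>p. norm (?g p)) summable_on UNIV"
    unfolding UNIV_Times_UNIV
    by (rule Infinite_Sum.abs_summable_on_comparison_test') (auto intro: norm_hecke_term_le)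
  hence "?g summable_on UNIV" by (rule abs_summable_summable)
  moreover have "infsum ?g UNIV = hecke_f a b c x y q"
    unfolding hecke_f_def by (rule infsum_cong_neutral) (auto simp: sg_weight_def hecke_term_def mult_ac)
  ultimately show ?thesis by (simp add: has_sum_iff)
qed

lemma analytic_at_hecke_f:
  assumes "x \<noteq> 0" "y \<noteq> 0"
  shows "(\<lambda>y. hecke_f a b c x y q) analytic_on {y}"
proof -
  let ?g = "\<lambda>w (r, s). sg_weight r s * hecke_term a b c x w q r s"
  have nz: "eventually (\<lambda>w. w \<noteq> 0) (nhds y)"
    using assms by (intro t1_space_nhds) auto
  obtain M where M: "M summable_on UNIV" "eventually (\<lambda>w. \<forall>k. norm (theta_term (q powi c) w k) \<le> M k) (nhds y)"
    by (rule eventually_norm_theta_term_le[where p = "q powi c" and g = "\<lambda>w. w" and z = y])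
       (use assms q ac in \<open>auto intro: norm_power_int_less_1\<close>)
  have "(\<lambda>(r, s). norm (theta_term (q powi a) x r) * M s) summable_on UNIV \<times> UNIV"
  proof (intro summable_on_product M summable_norm_theta_term norm_power_int_less_1 q ac assms)
    show "M k \<ge> 0" for k
      using eventually_nhds_x_imp_x[OF M(2)] order_trans[OF norm_ge_zero] by blast
  qed (use q in auto)
  moreover have "eventually (\<lambda>w. \<forall>p\<in>UNIV. norm (?g w p) \<le>
      (case p of (r, s) \<Rightarrow> norm (theta_term (q powi a) x r) * M s)) (nhds y)"
    using M(2) by eventually_elim (auto intro!: order_trans[OF norm_hecke_term_le] mult_left_mono)
  moreover have "eventually (\<lambda>w. \<forall>p\<in>UNIV. (\<lambda>w. ?g w p) field_differentiable at w) (nhds y)"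
    using nz unfolding hecke_term_def
    by eventually_elim
       (auto intro!: field_differentiable_mult field_differentiable_const field_differentiable_power_int)
  ultimately have "(\<lambda>w. infsum (?g w) UNIV) analytic_on {y}"
    by (intro analytic_at_infsum) auto
  moreover have eq: "eventually (\<lambda>w. infsum (?g w) UNIV = hecke_f a b c x w q) (nhds y)"
    using nz by eventually_elim (use has_sum_hecke_f assms in \<open>auto simp: infsumI\<close>)
  ultimately show ?thesis using analytic_at_cong[OF eq refl] by simp
qed

lemma has_sum_hecke_rows:
  assumes "x \<noteq> 0" "y \<noteq> 0" "finite A"
  shows "((\<lambda>(r, s). of_bool (r \<in> A) * hecke_term a b c x y q r s) has_sum (\<Sum>t\<in>A. hecke_row a b c x y q t)) UNIV"
proof -
  let ?g = "\<lambda>(r, s). hecke_term a b c x y q r s"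
  have "(?g has_sum (\<Sum>t\<in>A. hecke_row a b c x y q t)) (\<Union>t\<in>A. range (Pair t))"
  proof (rule sum_has_sum[OF assms(3)])
    show "(?g has_sum hecke_row a b c x y q t) (range (Pair t))" for t
      by (subst has_sum_reindex) (use has_sum_hecke_row[OF assms(1,2)] in \<open>auto simp: inj_on_def o_def\<close>)
  qed auto
  also have "(\<Union>t\<in>A. range (Pair t)) = A \<times> UNIV" by auto
  finally show ?thesis
    by (subst has_sum_cong_neutral[where T = "A \<times> UNIV" and g = ?g]) auto
qed

end

context
  fixes a b c :: int and q x y :: complex
  assumes q: "norm q < 1" "q \<noteq> 0" and ac: "a > 0" "c > 0" and b: "b \<ge> 0" and xy: "x \<noteq> 0" "y \<noteq> 0"
begin

lemma has_sum_hecke_columns: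
  assumes "finite A"
  shows "((\<lambda>(r, s). of_bool (s \<in> A) * hecke_term a b c x y q r s) has_sum (\<Sum>t\<in>A. hecke_row c b a y x q t)) UNIV"
proof -
  have "((\<lambda>p. (\<lambda>(r, s). of_bool (r \<in> A) * hecke_term c b a y x q r s) (prod.swap p)) has_sum
      (\<Sum>t\<in>A. hecke_row c b a y x q t)) UNIV"
    using has_sum_hecke_rows[OF q ac(2,1) b xy(2,1) assms] has_sum_reindex_bij_betw[OF bij_swap] by blast
  thus ?thesis by (simp add: case_prod_unfold hecke_term_swap[of c b a])
qed

lemma sg_weight_translate:
  assumes "k \<ge> 0" "l \<ge> 0"
  shows "sg_weight r s = sg_weight (r - k) (s + l) + of_bool (r \<in> {0..<k}) - of_bool (s \<in> {- l..<0})"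
  using assms by (auto simp: sg_weight_def sg_def)

theorem hecke_f_translate:
  assumes "k \<ge> 0" "l \<ge> 0"
  shows "hecke_f a b c x y q =
    hecke_term a b c x y q k (- l) * hecke_f a b c (q powi (a * k - b * l) * x) (q powi (b * k - c * l) * y) q
      + (\<Sum>t\<in>{0..<k}. hecke_row a b c x y q t) - (\<Sum>t\<in>{- l..<0}. hecke_row c b a y x q t)"
proof -
  let ?t = "hecke_term a b c x y q" and ?x = "q powi (a * k - b * l) * x" and ?y = "q powi (b * k - c * l) * y"
  define g where "g = (\<lambda>(r, s). sg_weight (r - k) (s + l) * ?t r s)"
  have "((\<lambda>p. ?t k (- l) * (case p of (r, s) \<Rightarrow> sg_weight r s * hecke_term a b c ?x ?y q r s)) has_sum
      ?t k (- l) * hecke_f a b c ?x ?y q) UNIV"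
    using q xy by (intro has_sum_cmult_right has_sum_hecke_f ac b) auto
  also have "(\<lambda>p. ?t k (- l) * (case p of (r, s) \<Rightarrow> sg_weight r s * hecke_term a b c ?x ?y q r s)) =
      (\<lambda>p. g (p + (k, - l)))"
    using hecke_term_add[OF xy q(2), of a b c _ k _ "- l"] by (auto simp: fun_eq_iff g_def)
  finally have "(g has_sum ?t k (- l) * hecke_f a b c ?x ?y q) UNIV"
    unfolding has_sum_translate .
  hence "((\<lambda>p. g p + (case p of (r, s) \<Rightarrow> of_bool (r \<in> {0..<k}) * ?t r s)
      + - (case p of (r, s) \<Rightarrow> of_bool (s \<in> {- l..<0}) * ?t r s)) has_sum
      ?t k (- l) * hecke_f a b c ?x ?y q + (\<Sum>t\<in>{0..<k}. hecke_row a b c x y q t)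
      + - (\<Sum>t\<in>{- l..<0}. hecke_row c b a y x q t)) UNIV"
    by (intro has_sum_add has_sum_uminusI has_sum_hecke_rows has_sum_hecke_columns q ac b xy) auto
  also have "(\<lambda>p. g p + (case p of (r, s) \<Rightarrow> of_bool (r \<in> {0..<k}) * ?t r s)
      + - (case p of (r, s) \<Rightarrow> of_bool (s \<in> {- l..<0}) * ?t r s)) = (\<lambda>(r, s). sg_weight r s * ?t r s)"
  proof (rule ext, clarify)
    show "g (r, s) + of_bool (r \<in> {0..<k}) * ?t r s + - (of_bool (s \<in> {- l..<0}) * ?t r s) =
        sg_weight r s * ?t r s" for r s
      unfolding g_def case_prod_conv sg_weight_translate[OF assms, of r s]
      by (simp only: left_diff_distrib distrib_right add_uminus_conv_diff)
  qed
  finally show ?thesis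
    using has_sum_unique[OF has_sum_hecke_f[OF q ac b xy]] by simp
qed

end


section \<open>The sums \<open>f\<^sub>n\<^sub>,\<^sub>n\<^sub>+\<^sub>p\<^sub>,\<^sub>n\<close> and \<open>g\<^sub>n\<^sub>,\<^sub>n\<^sub>+\<^sub>p\<^sub>,\<^sub>n\<close> for odd \<open>n\<close>\<close>

locale odd_hecke_sums =
  fixes q :: complex and n h p :: int
  assumes q: "norm q < 1" "q \<noteq> 0" and n_eq: "n = 2 * h + 1" and h: "h \<ge> 0" and p: "p > 0"
begin

definition Q :: complex where "Q = q powi (p * (2 * n + p))"

definition P :: complex where "P = Q powi n"

definition ratio :: "complex \<Rightarrow> complex \<Rightarrow> complex" where "ratio x y = y powi n / x powi n"

text \<open>The poles of the Appell--Lerch sums in \<open>g\<close> are the points where \<open>X x\<close> or \<open>X y\<close> is a power of \<open>Q\<close>.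
  For \<open>p = 4\<close> and \<open>n = 2 h + 1\<close>, \<open>X z = -q^(2n+8) z^4\<close>.\<close>
definition X :: "complex \<Rightarrow> complex" where "X z = - (q powi (tri p + p * (h + 1)) * (- z) powi p)"

definition regular :: "complex \<Rightarrow> bool" where "regular z \<longleftrightarrow> z \<noteq> 0 \<and> jtheta (X z) Q \<noteq> 0"

abbreviation row :: "complex \<Rightarrow> complex \<Rightarrow> int \<Rightarrow> complex" where
  "row x y t \<equiv> hecke_row n (n + p) n x y q t"

abbreviation appell_term :: "complex \<Rightarrow> complex \<Rightarrow> int \<Rightarrow> int \<Rightarrow> complex" where
  "appell_term x y t r \<equiv> theta_term P (ratio x y) r / (1 - Q powi (n * r - t - h) / X y)"

definition appell :: "complex \<Rightarrow> complex \<Rightarrow> int \<Rightarrow> complex" where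
  "appell x y t = (\<Sum>\<^sub>\<infinity>r. appell_term x y t r)"

definition half_g :: "complex \<Rightarrow> complex \<Rightarrow> complex" where
  "half_g x y = (\<Sum>t\<in>{0..<n}. row x y t * appell x y t)"

abbreviation multiplier :: "complex \<Rightarrow> complex" where
  "multiplier x \<equiv> Q powi (h + 1) / X x"

definition f :: "complex \<Rightarrow> complex \<Rightarrow> complex" where "f x y = hecke_f n (n + p) n x y q"

lemma n_pos: "n > 0"
  using h by (simp add: n_eq)

lemma norm_Q: "norm Q < 1" and Q_nonzero: "Q \<noteq> 0" and norm_P: "norm P < 1" and P_nonzero: "P \<noteq> 0"
proof -
  show Q: "norm Q < 1" "Q \<noteq> 0" unfolding Q_def using q n_pos p by (auto intro!: norm_power_int_less_1)
  show "norm P < 1" "P \<noteq> 0" unfolding P_def using Q n_pos by (auto intro!: norm_power_int_less_1)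
qed

lemma norm_q_n: "norm (q powi n) < 1" and q_n_nonzero: "q powi n \<noteq> 0"
  using q n_pos by (auto intro!: norm_power_int_less_1)

lemma X_nonzero: "z \<noteq> 0 \<Longrightarrow> X z \<noteq> 0"
  using q by (simp add: X_def)

lemma ratio_nonzero: "x \<noteq> 0 \<Longrightarrow> y \<noteq> 0 \<Longrightarrow> ratio x y \<noteq> 0"
  by (simp add: ratio_def)

lemma ratio_swap: "ratio y x = 1 / ratio x y"
  by (simp add: ratio_def)

lemma jtheta_ratio_swap:
  assumes "x \<noteq> 0" "y \<noteq> 0"
  shows "jtheta (ratio y x) P = - jtheta (ratio x y) P / ratio x y"
  unfolding ratio_swap[of y x] by (rule jtheta_inverse[OF norm_P ratio_nonzero[OF assms]])

lemma P_power: "P powi r = Q powi (n * r)"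
  by (simp add: P_def power_int_mult)

lemma ratio_mult_snd: "ratio x (Q * y) = P * ratio x y"
  by (simp add: ratio_def P_def power_int_mult_distrib)

lemma X_mult_Q: "X (Q * z) = Q powi p * X z"
  using power_int_mult_distrib[of Q "- z" p] by (simp add: X_def)

lemma regular_nonzero: "regular z \<Longrightarrow> z \<noteq> 0"
  by (simp add: regular_def)

lemma regular_iff:
  assumes "z \<noteq> 0"
  shows "regular z \<longleftrightarrow> (\<forall>k. Q powi k \<noteq> X z)"
  unfolding regular_def jtheta_eq_0_iff[OF norm_Q Q_nonzero X_nonzero[OF assms]] using assms by metis

lemma regular_denominator: "regular z \<Longrightarrow> 1 - Q powi k / X z \<noteq> 0"
  using regular_iff[of z] X_nonzero[of z] by (auto simp: regular_def)

lemma tri_n: "tri n = h * n"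
  by (simp add: n_eq tri_odd)


subsection \<open>Rows\<close>

lemma row_shift_n:
  assumes xy: "x \<noteq> 0" "y \<noteq> 0"
  shows "row x y (t + n) * (- (ratio x y * X y * Q powi (t + h))) = row x y t"
proof -
  define m where "m = monomial x y q"
  note m = monomial_rules[OF xy q(2) m_def] and eq = monomial_eqI[OF m_def]
  define z where "z = q powi ((n + p) * t) * y"
  have z: "z \<noteq> 0" using q xy by (simp add: z_def)
  have "q powi ((n + p) * (t + n)) * y = (q powi n) powi (n + p) * z"
    unfolding z_def by (simp only: m, rule eq) (simp_all add: algebra_simps)
  hence shift: "jtheta (q powi ((n + p) * (t + n)) * y) (q powi n) =
      (-1) powi (n + p) * (q powi n) powi (- tri (n + p)) * z powi (- (n + p)) * jtheta z (q powi n)"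
    using jtheta_shift[OF norm_q_n q_n_nonzero z] by simp
  have mono: "(- x) powi (t + n) * q powi (n * tri (t + n)) *
      ((-1) powi (n + p) * (q powi n) powi (- tri (n + p)) * z powi (- (n + p))) *
      (- (ratio x y * X y * Q powi (t + h))) = (- x) powi t * q powi (n * tri t)"
    unfolding z_def ratio_def X_def Q_def tri_add tri_n
    by (simp only: m, rule eq) (simp_all add: n_eq algebra_simps mult_self_eq_tri[of p])
  show ?thesis
    unfolding hecke_row_def shift z_def[symmetric] mono[symmetric] by (simp only: mult_ac)
qed

lemma row_mult_snd:
  assumes xy: "x \<noteq> 0" "y \<noteq> 0"
  shows "row x (Q * y) t = - (ratio x y * multiplier x) * row x y (t + p + n)"
proof -
  define m where "m = monomial x y q"
  note m = monomial_rules[OF xy q(2) m_def] and eq = monomial_eqI[OF m_def]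
  define z where "z = q powi ((n + p) * t) * (Q * y)"
  have z: "z \<noteq> 0" using q xy by (simp add: z_def Q_def)
  have "q powi ((n + p) * (t + p + n)) * y = (q powi n) powi n * z"
    unfolding z_def Q_def by (simp only: m, rule eq) (simp_all add: algebra_simps)
  hence shift: "jtheta (q powi ((n + p) * (t + p + n)) * y) (q powi n) =
      (-1) powi n * (q powi n) powi (- tri n) * z powi (- n) * jtheta z (q powi n)"
    using jtheta_shift[OF norm_q_n q_n_nonzero z] by simp
  have mono: "(- x) powi t * q powi (n * tri t) =
     - (ratio x y * multiplier x) * ((- x) powi (t + p + n) * q powi (n * tri (t + p + n)) *
      ((-1) powi n * (q powi n) powi (- tri n) * z powi (- n)))"
    unfolding z_def ratio_def X_def Q_def tri_add tri_n
    by (simp only: m, rule eq) (simp_all add: n_eq algebra_simps mult_self_eq_tri[of p])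
  show ?thesis
    unfolding hecke_row_def shift z_def[symmetric] mono by (simp only: mult_ac)
qed

lemma row_mult_fst: "row (Q * x) y t = Q powi t * row x y t"
  using power_int_mult_distrib[of Q "- x" t] by (simp add: hecke_row_def)

text \<open>This comes from translating the summation lattice by \<open>(1, 1)\<close>.\<close>
lemma row_mult_both:
  assumes xy: "x \<noteq> 0" "y \<noteq> 0"
  shows "row (q powi (2 * n + p) * x) (q powi (2 * n + p) * y) t = row x y (t + 1) / (q powi (n + p) * x * y)"
proof -
  define m where "m = monomial x y q"
  note m = monomial_rules[OF xy q(2) m_def] and eq = monomial_eqI[OF m_def]
  define z where "z = q powi ((n + p) * (t + 1)) * y"
  have z: "z \<noteq> 0" using q xy by (simp add: z_def)
  have "q powi ((n + p) * t) * (q powi (2 * n + p) * y) = q powi n * z"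
    unfolding z_def by (simp only: m, rule eq) (simp_all add: algebra_simps)
  hence shift: "jtheta (q powi ((n + p) * t) * (q powi (2 * n + p) * y)) (q powi n) = - jtheta z (q powi n) / z"
    using jtheta_mult_base[OF norm_q_n q_n_nonzero z] by (simp only:)
  have mono: "(- (q powi (2 * n + p) * x)) powi t * q powi (n * tri t) * (- 1 / z) =
      (- x) powi (t + 1) * q powi (n * tri (t + 1)) / (q powi (n + p) * x * y)"
    unfolding z_def tri_Suc by (simp only: m, rule eq) (simp_all add: algebra_simps)
  have "row (q powi (2 * n + p) * x) (q powi (2 * n + p) * y) t =
      (- (q powi (2 * n + p) * x)) powi t * q powi (n * tri t) * (- 1 / z) * jtheta z (q powi n)"
    unfolding hecke_row_def shift by simp
  also note mono
  finally show ?thesis by (simp add: hecke_row_def z_def)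
qed


subsection \<open>Appell--Lerch sums\<close>

lemma summable_on_appell_term:
  assumes "x \<noteq> 0" "y \<noteq> 0" "\<And>r. r \<in> I \<Longrightarrow> Q powi (n * r - t - h) \<noteq> X y"
  shows "appell_term x y t summable_on I"
  by (rule summable_on_appell[OF norm_P P_nonzero norm_Q Q_nonzero,
        of "\<lambda>_. ratio x y" y "\<lambda>_. X y" I "\<lambda>r. n * r - t - h"])
     (use assms ratio_nonzero X_nonzero in auto)

lemma has_sum_appell:
  assumes "x \<noteq> 0" "regular y"
  shows "(appell_term x y t has_sum appell x y t) UNIV"
  unfolding appell_def using assms regular_iff[of y] regular_nonzero[of y]
  by (intro has_sum_infsum summable_on_appell_term) auto

lemma has_sum_theta_ratio: "x \<noteq> 0 \<Longrightarrow> y \<noteq> 0 \<Longrightarrow> (theta_term P (ratio x y) has_sum jtheta (ratio x y) P) UNIV"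
  by (intro jacobi_triple_product norm_P P_nonzero ratio_nonzero)

lemma appell_shift_n:
  assumes x: "x \<noteq> 0" and y: "y \<noteq> 0"
  shows "appell x y (t + n) =
    - (ratio x y * (\<Sum>\<^sub>\<infinity>r. P powi r * appell_term x y t r))"
proof -
  have "appell x y (t + n) = (\<Sum>\<^sub>\<infinity>r. appell_term x y (t + n) (r + 1))"
    unfolding appell_def by (rule infsum_reindex_bij_betw[symmetric], rule bij_betwI[of _ _ _ "\<lambda>r. r - 1"]) auto
  also have "\<dots> = (\<Sum>\<^sub>\<infinity>r. - ratio x y * (P powi r * appell_term x y t r))"
    unfolding theta_term_Suc[OF P_nonzero ratio_nonzero[OF x y]] by (simp add: algebra_simps)
  finally show ?thesis unfolding infsum_cmult_right' by simp
qed

lemma appell_shift_n_regular: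
  assumes x: "x \<noteq> 0" and y: "regular y"
  shows "appell x y (t + n) = - (ratio x y * X y * Q powi (t + h)) * (appell x y t - jtheta (ratio x y) P)"
proof -
  have y0: "y \<noteq> 0" using y by (rule regular_nonzero)
  have split: "P powi r * appell_term x y t r = X y * Q powi (t + h) *
    (appell_term x y t r - theta_term P (ratio x y) r)" for r
  proof -
    define \<kappa> where "\<kappa> = Q powi (n * r - t - h) / X y"
    have "Q powi (n * r - t - h) = Q powi (n * r) / Q powi (t + h)"
      using power_int_diff[of Q "n * r" "t + h"] Q_nonzero by (simp add: algebra_simps)
    hence "P powi r = X y * Q powi (t + h) * \<kappa>"
      unfolding P_power \<kappa>_def using Q_nonzero X_nonzero[OF y0] by simp
    moreover have "1 - \<kappa> \<noteq> 0" unfolding \<kappa>_def by (rule regular_denominator[OF y])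
    ultimately show ?thesis unfolding \<kappa>_def[symmetric] by (simp add: field_simps)
  qed
  have "((\<lambda>r. appell_term x y t r + - theta_term P (ratio x y) r)
     has_sum (appell x y t + - jtheta (ratio x y) P)) UNIV"
    using has_sum_theta_ratio[OF x y0] by (intro has_sum_add has_sum_appell x y) (simp add: has_sum_uminus)
  hence "(\<Sum>\<^sub>\<infinity>r. P powi r * appell_term x y t r) =
    X y * Q powi (t + h) * (appell x y t - jtheta (ratio x y) P)"
    unfolding split infsum_cmult_right' by (simp add: infsumI)
  thus ?thesis unfolding appell_shift_n[OF x y0] by simp
qed

lemma appell_mult_snd:
  assumes x: "x \<noteq> 0" and y: "y \<noteq> 0"
  shows "appell x (Q * y) t = - appell x y (t + p + n) / ratio x y"
proof -
  have "appell x (Q * y) t = (\<Sum>\<^sub>\<infinity>r. P powi r * appell_term x y (t + p) r)"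
    unfolding appell_def
  proof (rule infsum_cong)
    fix r
    have "Q powi (n * r - t - h) / X (Q * y) = Q powi (n * r - (t + p) - h) / X y"
      unfolding X_mult_Q using Q_nonzero power_int_diff[of Q "n * r - t - h" p] by (simp add: algebra_simps)
    thus "appell_term x (Q * y) t r = P powi r * appell_term x y (t + p) r"
      using theta_term_mult[of P 1 "ratio x y" r] by (simp add: ratio_mult_snd)
  qed
  thus ?thesis using appell_shift_n[OF x y, of "t + p"] ratio_nonzero[OF x y] by simp
qed

lemma appell_mult_fst:
  assumes x: "x \<noteq> 0" and y: "regular y"
  shows "appell (Q * x) y t = Q powi (- h - t) / X y * appell x y t + jtheta (ratio (Q * x) y) P"
proof -
  have y0: "y \<noteq> 0" using y by (rule regular_nonzero)
  have split: "appell_term (Q * x) y t r =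
      Q powi (- h - t) / X y * appell_term x y t r + theta_term P (ratio (Q * x) y) r" for r
  proof -
    define \<kappa> where "\<kappa> = Q powi (n * r - t - h) / X y"
    have "ratio (Q * x) y = P powi (-1) * ratio x y"
      unfolding ratio_swap[of _ y] ratio_mult_snd by (simp add: power_int_minus field_simps)
    hence theta: "theta_term P (ratio (Q * x) y) r = P powi (- r) * theta_term P (ratio x y) r"
      using theta_term_mult[of P "-1" "ratio x y" r] by simp
    have "Q powi (n * r - t - h) = Q powi (n * r) * Q powi (- h - t)"
      using power_int_add[of Q "n * r" "- h - t"] Q_nonzero by (simp add: algebra_simps)
    hence "Q powi (- h - t) / X y = \<kappa> * P powi (- r)"
      unfolding P_power \<kappa>_def using Q_nonzero by (simp add: power_int_minus)
    moreover have "1 - \<kappa> \<noteq> 0" unfolding \<kappa>_def by (rule regular_denominator[OF y])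
    ultimately show ?thesis unfolding theta \<kappa>_def[symmetric] by (simp add: field_simps)
  qed
  have "(appell_term (Q * x) y t has_sum
     (Q powi (- h - t) / X y * appell x y t + jtheta (ratio (Q * x) y) P)) UNIV"
    unfolding split using Q_nonzero x y0
    by (intro has_sum_add has_sum_cmult_right has_sum_appell has_sum_theta_ratio x y) auto
  thus ?thesis unfolding appell_def[of "Q * x"] by (rule infsumI)
qed


subsection \<open>Functional equations\<close>

lemma row_appell_shift_n:
  assumes x: "x \<noteq> 0" and y: "regular y"
  shows "row x y (t + n) * appell x y (t + n) = row x y t * appell x y t - jtheta (ratio x y) P * row x y t"
  unfolding appell_shift_n_regular[OF assms] row_shift_n[OF x regular_nonzero[OF y], of t, symmetric]
  by (simp add: algebra_simps)

lemma row_appell_mult_snd: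
  assumes "x \<noteq> 0" "y \<noteq> 0"
  shows "row x (Q * y) t * appell x (Q * y) t = multiplier x * (row x y (t + p + n) * appell x y (t + p + n))"
  unfolding appell_mult_snd[OF assms] row_mult_snd[OF assms] using ratio_nonzero[OF assms] by simp

lemma sum_int_translate: "(\<Sum>t\<in>{a..<b}. F (t + c)) = (\<Sum>t\<in>{a + c..<b + c}. F t)" for a b c :: int
  by (rule sum.reindex_bij_witness[of _ "\<lambda>t. t - c" "\<lambda>t. t + c"]) auto

lemma sum_int_concat: "a \<le> b \<Longrightarrow> b \<le> c \<Longrightarrow> (\<Sum>t\<in>{a..<b}. F t) + (\<Sum>t\<in>{b..<c}. F t) = (\<Sum>t\<in>{a..<c}. F t)"
  for a b c :: int and F :: "int \<Rightarrow> complex"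
  by (subst sum.union_disjoint[symmetric]) (auto intro!: sum.cong)

lemma half_g_mult_snd:
  assumes x: "x \<noteq> 0" and y: "regular y"
  shows "half_g x (Q * y) =
    multiplier x * (half_g x y - jtheta (ratio x y) P * (\<Sum>t\<in>{0..<n + p}. row x y t))"
proof -
  define F where "F t = row x y t * appell x y t" for t
  have "(\<Sum>t\<in>{n..<2 * n + p}. F t) = (\<Sum>t\<in>{0..<n + p}. F (t + n))"
    unfolding sum_int_translate by (simp add: algebra_simps)
  also have "\<dots> = (\<Sum>t\<in>{0..<n + p}. F t) - jtheta (ratio x y) P * (\<Sum>t\<in>{0..<n + p}. row x y t)"
    unfolding F_def row_appell_shift_n[OF assms] by (simp add: sum_subtractf sum_distrib_left)
  finally have shifted: "(\<Sum>t\<in>{n..<2 * n + p}. F t) =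
      (\<Sum>t\<in>{0..<n + p}. F t) - jtheta (ratio x y) P * (\<Sum>t\<in>{0..<n + p}. row x y t)" .
  have "(\<Sum>t\<in>{0..<n}. F t) + (\<Sum>t\<in>{n..<2 * n + p}. F t) = (\<Sum>t\<in>{0..<n + p}. F t) + (\<Sum>t\<in>{n + p..<2 * n + p}. F t)"
    using sum_int_concat[of 0 n "2 * n + p" F] sum_int_concat[of 0 "n + p" "2 * n + p" F] n_pos p by simp
  hence "(\<Sum>t\<in>{n + p..<2 * n + p}. F t) = (\<Sum>t\<in>{0..<n}. F t) - jtheta (ratio x y) P * (\<Sum>t\<in>{0..<n + p}. row x y t)"
    unfolding shifted by (simp add: algebra_simps)
  moreover have "half_g x (Q * y) = multiplier x * (\<Sum>t\<in>{0..<n}. F (t + (p + n)))"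
    unfolding half_g_def row_appell_mult_snd[OF x regular_nonzero[OF y]] sum_distrib_left F_def
    by (simp add: add.assoc)
  moreover have "(\<Sum>t\<in>{0..<n}. F (t + (p + n))) = (\<Sum>t\<in>{n + p..<2 * n + p}. F t)"
    unfolding sum_int_translate by (simp add: algebra_simps)
  ultimately show ?thesis by (simp add: half_g_def F_def)
qed

lemma row_appell_mult_fst:
  assumes "x \<noteq> 0" "regular y"
  shows "row (Q * x) y t * appell (Q * x) y t =
    Q powi (- h) / X y * (row x y t * appell x y t) + jtheta (ratio (Q * x) y) P * (Q powi t * row x y t)"
proof -
  have "Q powi t * Q powi (- h - t) = Q powi (- h)"
    using power_int_add[of Q t "- h - t"] Q_nonzero by simp
  thus ?thesis
    unfolding row_mult_fst appell_mult_fst[OF assms] by (simp add: distrib_left mult_ac)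
qed

lemma sum_row_negative:
  assumes "x \<noteq> 0" "y \<noteq> 0"
  shows "multiplier y * (\<Sum>t\<in>{- n..<0}. row x y t) = - (ratio x y * (\<Sum>t\<in>{0..<n}. Q powi t * row x y t))"
proof -
  have row_shift: "multiplier y * row x y (t + - n) = - (ratio x y * (Q powi t * row x y t))" for t
  proof -
    have "row x y (t + - n) = row x y t * (- (ratio x y * X y * Q powi (t - n + h)))"
      using row_shift_n[OF assms, of "t - n"] by simp
    moreover have "Q powi t = Q powi (h + 1) * Q powi (t - n + h)"
      using power_int_add[of Q "h + 1" "t - n + h"] Q_nonzero by (simp add: n_eq)
    ultimately show ?thesis
      using X_nonzero[OF assms(2)] by simp
  qed
  have "(\<Sum>t\<in>{- n..<0}. row x y t) = (\<Sum>t\<in>{0..<n}. row x y (t + - n))"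
    unfolding sum_int_translate by simp
  thus ?thesis
    by (simp only: sum_distrib_left row_shift sum_negf)
qed

lemma half_g_mult_fst:
  assumes x: "regular x" and y: "y \<noteq> 0"
  shows "ratio x (Q * y) * half_g (Q * y) x =
    multiplier x * (ratio x y * half_g y x - jtheta (ratio x y) P * (\<Sum>t\<in>{- n..<0}. row y x t))"
proof -
  have xy: "x \<noteq> 0" "ratio x y \<noteq> 0" using x y by (simp_all add: regular_nonzero ratio_nonzero)
  define R where "R = (\<Sum>t\<in>{0..<n}. Q powi t * row y x t)"
  have "half_g (Q * y) x = Q powi (- h) / X x * half_g y x + jtheta (ratio (Q * y) x) P * R"
    unfolding half_g_def R_def row_appell_mult_fst[OF y x] by (simp only: sum.distrib sum_distrib_left)
  hence "ratio x (Q * y) * half_g (Q * y) x =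
      ratio x (Q * y) * (Q powi (- h) / X x * half_g y x) + ratio x (Q * y) * jtheta (ratio (Q * y) x) P * R"
    by (simp add: distrib_left)
  also have "ratio x (Q * y) * jtheta (ratio (Q * y) x) P = jtheta (ratio x y) P / ratio x y"
    using jtheta_ratio_swap[OF xy(1), of "Q * y"] jtheta_mult_base[OF norm_P P_nonzero xy(2)]
      Q_nonzero P_nonzero y xy(2) by (simp add: ratio_mult_snd)
  also have "ratio x (Q * y) * (Q powi (- h) / X x * half_g y x) = multiplier x * (ratio x y * half_g y x)"
  proof -
    have "P * Q powi (- h) = Q powi (h + 1)"
      unfolding P_def using Q_nonzero power_int_add[of Q n "- h"] by (simp add: n_eq)
    thus ?thesis unfolding ratio_mult_snd by (simp add: mult_ac)
  qed
  also have "jtheta (ratio x y) P / ratio x y * R =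
      - (jtheta (ratio x y) P * (multiplier x * (\<Sum>t\<in>{- n..<0}. row y x t)))"
    unfolding sum_row_negative[OF y xy(1)] R_def[symmetric] ratio_swap[of y x] by simp
  finally show ?thesis by (simp add: algebra_simps)
qed

text \<open>The difference \<open>f - g\<close>, cleared of the denominator \<open>j(y^n/x^n;P)\<close>.\<close>
definition defect :: "complex \<Rightarrow> complex \<Rightarrow> complex" where
  "defect x y = jtheta (ratio x y) P * f x y + ratio x y * half_g y x - half_g x y"

lemma f_mult_snd:
  assumes x: "x \<noteq> 0" and y: "y \<noteq> 0"
  shows "f x y = hecke_term n (n + p) n x y q (n + p) (- n) * f x (Q * y)
    + (\<Sum>t\<in>{0..<n + p}. row x y t) - (\<Sum>t\<in>{- n..<0}. row y x t)"
proof -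
  have "q powi (n * (n + p) - (n + p) * n) * x = x" "q powi ((n + p) * (n + p) - n * n) * y = Q * y"
    unfolding Q_def by (simp_all add: algebra_simps)
  moreover have "n + p \<ge> 0" "n \<ge> 0" using n_pos p by simp_all
  ultimately show ?thesis
    unfolding f_def using hecke_f_translate[OF q n_pos n_pos _ x y, of "n + p" "n + p" n] by (simp only:)
qed

theorem defect_mult_Q:
  assumes x: "regular x" and y: "regular y"
  shows "defect x (Q * y) = multiplier x * defect x y"
proof -
  have xy: "x \<noteq> 0" "y \<noteq> 0" using assms by (simp_all add: regular_nonzero)
  let ?\<kappa> = "hecke_term n (n + p) n x y q (n + p) (- n)" and ?C = "multiplier x"
    and ?j = "jtheta (ratio x y) P"
  define m where "m = monomial x y q"
  note m = monomial_rules[OF xy q(2) m_def] and eq = monomial_eqI[OF m_def]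
  have factor: "?C * ?\<kappa> = - (1 / ratio x y)"
    unfolding hecke_term_def Q_def X_def ratio_def tri_add tri_uminus tri_n
    by (simp only: m, rule eq) (simp_all add: n_eq algebra_simps mult_self_eq_tri[of p])
  have "jtheta (ratio x (Q * y)) P = - ?j / ratio x y"
    unfolding ratio_mult_snd by (rule jtheta_mult_base[OF norm_P P_nonzero ratio_nonzero[OF xy]])
  also have "\<dots> = ?j * (?C * ?\<kappa>)" unfolding factor by simp
  finally have "jtheta (ratio x (Q * y)) P * f x (Q * y) = ?C * (?j * (?\<kappa> * f x (Q * y)))" by simp
  moreover have "?\<kappa> * f x (Q * y) = f x y - (\<Sum>t\<in>{0..<n + p}. row x y t) + (\<Sum>t\<in>{- n..<0}. row y x t)"
    unfolding f_mult_snd[OF xy] by simp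
  ultimately have "defect x (Q * y) = ?C * (?j * (f x y - (\<Sum>t\<in>{0..<n + p}. row x y t) + (\<Sum>t\<in>{- n..<0}. row y x t)))
     + ?C * (ratio x y * half_g y x - ?j * (\<Sum>t\<in>{- n..<0}. row y x t))
     - ?C * (half_g x y - ?j * (\<Sum>t\<in>{0..<n + p}. row x y t))"
    unfolding defect_def half_g_mult_snd[OF xy(1) y] half_g_mult_fst[OF x xy(2)] by (simp only:)
  also have "\<dots> = ?C * defect x y"
    unfolding defect_def by (simp only: algebra_simps)
  finally show ?thesis .
qed


subsection \<open>Cancellation of the poles\<close>

lemma X_analytic: "X analytic_on A" if "0 \<notin> A"
  unfolding X_def using that by (intro analytic_intros) auto

lemma X_has_field_derivative:
  assumes "z \<noteq> 0"
  shows "(X has_field_derivative of_int p * X z / z) (at z)"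
proof -
  have "(- z) powi (p - 1) = - ((- z) powi p / z)"
    using assms by (simp add: power_int_diff)
  thus ?thesis
    unfolding X_def using assms by (auto intro!: derivative_eq_intros)
qed

lemma ratio_analytic:
  assumes "g analytic_on A" "k analytic_on A" "\<And>z. z \<in> A \<Longrightarrow> g z \<noteq> 0" "\<And>z. z \<in> A \<Longrightarrow> k z \<noteq> 0"
  shows "(\<lambda>z. ratio (g z) (k z)) analytic_on A"
  unfolding ratio_def using assms by (intro analytic_intros) auto

lemma row_analytic:
  assumes "x \<noteq> 0" "y \<noteq> 0"
  shows "(\<lambda>v. row x v t) analytic_on {y}" "(\<lambda>v. row v x t) analytic_on {y}"
  using assms by (intro analytic_on_hecke_row q n_pos analytic_intros; simp)+

lemma appell_part_analytic:
  assumes "x \<noteq> 0" "y \<noteq> 0" "\<And>r. r \<in> I \<Longrightarrow> Q powi (n * r - t - h) \<noteq> X y"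
  shows "(\<lambda>v. \<Sum>\<^sub>\<infinity>r\<in>I. appell_term x v t r) analytic_on {y}"
  by (rule analytic_at_appell[OF norm_P P_nonzero norm_Q Q_nonzero, where e = "\<lambda>r. n * r - t - h"])
     (use assms in \<open>auto intro!: ratio_analytic X_analytic analytic_intros simp: ratio_nonzero X_nonzero\<close>)

lemma row_appell_analytic:
  assumes "x \<noteq> 0" "y \<noteq> 0" "\<And>r. Q powi (n * r - t - h) \<noteq> X y"
  shows "(\<lambda>v. row x v t * appell x v t) analytic_on {y}"
  unfolding appell_def using assms
  by (intro analytic_on_mult row_analytic appell_part_analytic) auto

lemma half_g_fst_analytic:
  assumes "regular x" "y \<noteq> 0"
  shows "(\<lambda>v. half_g v x) analytic_on {y}"
proof -
  have x: "x \<noteq> 0" "\<And>k. Q powi k \<noteq> X x" using assms(1) regular_iff[of x] by (auto simp: regular_def)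
  have "(\<lambda>v. appell v x t) analytic_on {y}" for t
    unfolding appell_def
    by (rule analytic_at_appell[OF norm_P P_nonzero norm_Q Q_nonzero,
          where c = "\<lambda>_. X x" and e = "\<lambda>r. n * r - t - h"])
       (use assms(2) x in \<open>auto intro!: ratio_analytic analytic_intros simp: ratio_nonzero X_nonzero\<close>)
  thus ?thesis
    unfolding half_g_def using assms(2) x by (intro analytic_on_sum analytic_on_mult row_analytic) auto
qed

lemma defect_without_half_g_analytic:
  assumes "regular x" "y \<noteq> 0"
  shows "(\<lambda>v. jtheta (ratio x v) P * f x v + ratio x v * half_g v x) analytic_on {y}"
proof -
  have x: "x \<noteq> 0" using assms(1) by (rule regular_nonzero)
  have "f x analytic_on {y}"
    unfolding f_def[abs_def] using n_pos p by (intro analytic_at_hecke_f q x assms) auto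
  moreover have "(\<lambda>v. ratio x v) analytic_on {y}"
    using x assms(2) by (intro ratio_analytic analytic_intros) auto
  ultimately show ?thesis
    using x assms by (intro analytic_intros half_g_fst_analytic norm_P ratio_nonzero) auto
qed

lemma defect_analytic:
  assumes "regular x" "regular y"
  shows "defect x analytic_on {y}"
proof -
  have y: "y \<noteq> 0" "\<And>k. Q powi k \<noteq> X y" using assms(2) regular_iff[of y] by (auto simp: regular_def)
  have "half_g x analytic_on {y}"
    unfolding half_g_def[abs_def] using y regular_nonzero[OF assms(1)]
    by (intro analytic_on_sum row_appell_analytic) auto
  thus ?thesis
    unfolding defect_def[abs_def] using defect_without_half_g_analytic[OF assms(1) y(1)]
    by (intro analytic_on_diff) auto
qed

lemma jtheta_X_analytic: "y \<noteq> 0 \<Longrightarrow> (\<lambda>v. jtheta (X v) Q) analytic_on {y}"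
  by (intro analytic_on_jtheta norm_Q X_analytic) (auto simp: X_nonzero)

lemma eventually_regular:
  assumes x: "regular x" and y: "y \<noteq> 0"
  shows "eventually regular (at y)"
proof -
  have "(\<lambda>v. jtheta (X v) Q) holomorphic_on - {0}"
    by (intro analytic_imp_holomorphic analytic_on_jtheta norm_Q X_analytic) (auto simp: X_nonzero)
  moreover have "connected (- {0 :: complex})"
    by (rule connected_punctured_universe) simp
  ultimately have "eventually (\<lambda>v. jtheta (X v) Q \<noteq> 0 \<and> v \<in> - {0}) (at y)"
    by (rule non_zero_neighbour_alt[OF _ open_Compl[OF closed_singleton], of _ _ _ x])
       (use x y in \<open>auto simp: regular_def\<close>)
  thus ?thesis by eventually_elim (simp add: regular_def)
qed

lemma pole_index:
  obtains t r where "t \<in> {0..<n}" "n * r - t - h = k"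
    and "\<And>t' r'. t' \<in> {0..<n} \<Longrightarrow> n * r' - t' - h = k \<Longrightarrow> t' = t \<and> r' = r"
proof
  define t where "t = (- (h + k)) mod n"
  define r where "r = - ((- (h + k)) div n)"
  show t: "t \<in> {0..<n}" using n_pos by (simp add: t_def)
  show r: "n * r - t - h = k"
    using mult_div_mod_eq[of n "- (h + k)"] unfolding t_def r_def mult_minus_right by linarith
  fix t' r' assume t': "t' \<in> {0..<n}" "n * r' - t' - h = k"
  have diff: "n * (r' - r) = t' - t" using t'(2) r by (simp add: algebra_simps)
  hence "n dvd t' - t" by (metis dvd_triv_left)
  moreover have "\<bar>t' - t\<bar> < n" using t'(1) t by auto
  ultimately have "t' - t = 0" using dvd_imp_le_int[of "t' - t" n] n_pos by linarith
  thus "t' = t \<and> r' = r" using diff n_pos by simp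
qed

lemma row_theta_term_at_pole:
  assumes x: "x \<noteq> 0" and y: "y \<noteq> 0" "X y = Q powi k"
  shows "row x y (n * r - h - k) * theta_term P (ratio x y) r = row x y (- h - k)"
proof (induction r rule: int_step_induct)
  case 1
  show ?case by simp
next
  case (2 r)
  define t where "t = n * r - h - k"
  have t: "n * (r + 1) - h - k = t + n" by (simp add: t_def algebra_simps)
  have "X y * Q powi (t + h) = P powi r"
    unfolding y(2) P_power t_def using Q_nonzero power_int_add[of Q k "n * r - h - k + h"] by simp
  hence "row x y t = row x y (t + n) * (- (ratio x y * P powi r))"
    using row_shift_n[OF x y(1), of t] by (simp add: mult.assoc)
  hence "row x y t * theta_term P (ratio x y) r = row x y (t + n) * theta_term P (ratio x y) (r + 1)"
    unfolding theta_term_Suc[OF P_nonzero ratio_nonzero[OF x y(1)]] by simp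
  thus ?case unfolding t t_def[symmetric] by simp
qed

lemma half_g_split_pole:
  assumes x: "x \<noteq> 0" and v: "regular v" and t: "t \<in> {0..<n}"
  shows "half_g x v = row x v t * appell_term x v t r
    + row x v t * (\<Sum>\<^sub>\<infinity>s\<in>UNIV - {r}. appell_term x v t s)
    + (\<Sum>t\<in>{0..<n} - {t}. row x v t * appell x v t)"
proof -
  let ?g = "appell_term x v t"
  have "v \<noteq> 0" "\<And>k. Q powi k \<noteq> X v" using v regular_iff[of v] by (auto simp: regular_def)
  hence "?g summable_on UNIV - {r}"
    using x by (intro summable_on_appell_term) auto
  hence "infsum ?g (insert r (UNIV - {r})) = ?g r + infsum ?g (UNIV - {r})"
    by (rule infsum_insert) simp
  hence "appell x v t = ?g r + infsum ?g (UNIV - {r})"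
    by (simp add: appell_def insert_Diff_single)
  moreover have "half_g x v = row x v t * appell x v t + (\<Sum>t\<in>{0..<n} - {t}. row x v t * appell x v t)"
    unfolding half_g_def by (rule sum.remove) (use t in auto)
  ultimately show ?thesis by (simp add: distrib_left)
qed

lemma pole_factor_simple_zero:
  assumes y: "y \<noteq> 0" "X y = Q powi k"
  shows "(\<lambda>v. 1 - Q powi k / X v) analytic_on {y}" "deriv (\<lambda>v. 1 - Q powi k / X v) y \<noteq> 0"
proof -
  show "(\<lambda>v. 1 - Q powi k / X v) analytic_on {y}"
    using y(1) X_nonzero by (intro analytic_intros X_analytic) auto
  have "((\<lambda>v. 1 - Q powi k / X v) has_field_derivative of_int p / y) (at y)"
    using y Q_nonzero by (auto intro!: derivative_eq_intros X_has_field_derivative)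
  hence "deriv (\<lambda>v. 1 - Q powi k / X v) y = of_int p / y" by (rule DERIV_imp_deriv)
  thus "deriv (\<lambda>v. 1 - Q powi k / X v) y \<noteq> 0" using y(1) p by simp
qed

lemma pole_difference_removable:
  assumes x: "regular x" and y: "y \<noteq> 0" "X y = Q powi k" and t: "t = n * r - h - k"
    and M: "M analytic_on {y}" "M y = jtheta_cofactor Q k (X y) * row x y (- h - k)"
  shows "removable_at (\<lambda>v. M v / jtheta (X v) Q - row x v t * theta_term P (ratio x v) r / (1 - Q powi k / X v)) y"
proof -
  have x0: "x \<noteq> 0" using x by (rule regular_nonzero)
  let ?L = "\<lambda>v. jtheta_cofactor Q k (X v)"
  define N where "N v = M v / ?L v - row x v t * theta_term P (ratio x v) r" for v
  have cofactor: "?L analytic_on {y}" "?L y \<noteq> 0"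
    using y X_nonzero norm_Q Q_nonzero jtheta_cofactor_at_zero_nonzero
    by (auto intro!: analytic_intros X_analytic)
  have "(\<lambda>v. theta_term P (ratio x v) r) analytic_on {y}"
    unfolding theta_term_def using x0 y(1) ratio_nonzero by (intro analytic_intros ratio_analytic) auto
  hence "N analytic_on {y}"
    unfolding N_def[abs_def] using cofactor(2)
    by (intro analytic_on_diff analytic_on_divide analytic_on_mult M cofactor row_analytic x0 y) auto
  moreover have "N y = 0"
    using row_theta_term_at_pole[OF x0 y, of r] M(2) cofactor(2) by (simp add: N_def t)
  ultimately have quotient: "removable_at (\<lambda>v. N v / (1 - Q powi k / X v)) y"
    using pole_factor_simple_zero[OF y] y Q_nonzero by (intro removable_at_quotient_simple_zero) auto
  have "eventually (\<lambda>v. M v / jtheta (X v) Q - row x v t * theta_term P (ratio x v) r / (1 - Q powi k / X v) =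
      N v / (1 - Q powi k / X v)) (at y)"
    using eventually_regular[OF x y(1)]
  proof eventually_elim
    case (elim v)
    show ?case
      unfolding N_def jtheta_eq_cofactor[OF norm_Q Q_nonzero X_nonzero[OF regular_nonzero[OF elim]], of k]
      by (simp add: diff_divide_distrib)
  qed
  from removable_at_cong[OF this] quotient show ?thesis by (simp only:)
qed

lemma defect_removable_at_pole:
  assumes x: "regular x" and y: "y \<noteq> 0" "X y = Q powi k"
    and M: "M analytic_on {y}" "M y = jtheta_cofactor Q k (X y) * row x y (- h - k)"
  shows "removable_at (\<lambda>v. defect x v + M v / jtheta (X v) Q) y"
proof -
  have x0: "x \<noteq> 0" using x by (rule regular_nonzero)
  obtain t r where tr: "t \<in> {0..<n}" "n * r - t - h = k"
    and unique: "\<And>t' r'. t' \<in> {0..<n} \<Longrightarrow> n * r' - t' - h = k \<Longrightarrow> t' = t \<and> r' = r"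
    using pole_index[of k] by blast
  have not_pole: "Q powi (n * r' - t' - h) \<noteq> X y" if "t' \<in> {0..<n}" "t' \<noteq> t \<or> r' \<noteq> r" for t' r'
    using power_int_inj[OF norm_Q Q_nonzero] unique[OF that(1)] that(2) unfolding y(2) by metis
  define rest where "rest v = (jtheta (ratio x v) P * f x v + ratio x v * half_g v x)
    - row x v t * (\<Sum>\<^sub>\<infinity>s\<in>UNIV - {r}. appell_term x v t s)
    - (\<Sum>t\<in>{0..<n} - {t}. row x v t * appell x v t)" for v
  have rest: "removable_at rest y"
    unfolding rest_def[abs_def] using x0 y(1) not_pole tr(1)
    by (intro analytic_imp_removable_at analytic_on_diff defect_without_half_g_analytic x analytic_on_mult
        analytic_on_sum row_analytic appell_part_analytic row_appell_analytic) auto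
  have "t = n * r - h - k" using tr(2) by simp
  note difference = pole_difference_removable[OF x y this M]
  have "eventually (\<lambda>v. defect x v + M v / jtheta (X v) Q = rest v +
      (M v / jtheta (X v) Q - row x v t * theta_term P (ratio x v) r / (1 - Q powi k / X v))) (at y)"
    using eventually_regular[OF x y(1)]
    by eventually_elim (simp add: defect_def half_g_split_pole[OF x0 _ tr(1), of _ r] tr(2) rest_def)
  from removable_at_cong[OF this] show ?thesis
    using removable_at_add[OF rest difference] by (simp only:)
qed

lemma multiplier_not_power: "regular x \<Longrightarrow> multiplier x \<noteq> Q powi k"
proof
  assume x: "regular x" and "multiplier x = Q powi k"
  hence "Q powi (h + 1 - k) = X x"
    using Q_nonzero X_nonzero[OF regular_nonzero[OF x]] by (simp add: power_int_diff field_simps)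
  thus False using x regular_iff[of x] by (auto simp: regular_def)
qed

theorem defect_eq:
  assumes x: "regular x" and y: "regular y"
    and analytic: "\<And>v. v \<noteq> 0 \<Longrightarrow> M analytic_on {v}"
    and mult: "\<And>v. v \<noteq> 0 \<Longrightarrow> M (Q * v) / jtheta (X (Q * v)) Q = multiplier x * (M v / jtheta (X v) Q)"
    and pole: "\<And>v k. v \<noteq> 0 \<Longrightarrow> X v = Q powi k \<Longrightarrow> M v = jtheta_cofactor Q k (X v) * row x v (- h - k)"
  shows "defect x y = - (M y / jtheta (X y) Q)"
proof -
  define E where "E v = defect x v + M v / jtheta (X v) Q" for v
  have E_analytic: "E analytic_on {v}" if "regular v" for v
    unfolding E_def[abs_def] using that regular_nonzero[OF that]
    by (intro analytic_intros defect_analytic x analytic jtheta_X_analytic) (auto simp: regular_def)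
  have "E y = 0"
  proof (rule removable_quasi_periodic_eq_0[OF norm_Q Q_nonzero, of E "multiplier x"])
    fix v :: complex assume v: "v \<noteq> 0"
    show "removable_at E v"
    proof (cases "regular v")
      case True
      thus ?thesis by (intro analytic_imp_removable_at E_analytic)
    next
      case False
      then obtain k where "X v = Q powi k" using regular_iff[OF v] by metis
      thus ?thesis
        unfolding E_def[abs_def] using v by (intro defect_removable_at_pole x analytic pole)
    qed
    show "eventually (\<lambda>u. E (Q * u) = multiplier x * E u) (at v)"
      using eventually_regular[OF x v]
      by eventually_elim (simp add: E_def defect_mult_Q[OF x] mult regular_nonzero distrib_left)
  next
    show "multiplier x \<noteq> Q powi k" for k
      by (rule multiplier_not_power[OF x])
  next
    show "y \<noteq> 0" "isCont E y"
      using y regular_nonzero E_analytic analytic_at_imp_isCont by blast+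
  qed
  thus ?thesis by (simp add: E_def add_eq_0_iff)
qed


subsection \<open>Comparison with \<open>g\<close>\<close>

lemma hecke_g_arg_eq:
  assumes "x \<noteq> 0" "y \<noteq> 0"
  shows "P powi (r - 1) * hecke_g_arg n (n + p) n x y q t * ratio y x = Q powi (n * r - t - h) / X x"
proof -
  define m where "m = monomial x y q"
  note m = monomial_rules[OF assms q(2) m_def] and eq = monomial_eqI[OF m_def]
  have "(n + p)\<^sup>2 - n * n = p * (2 * n + p)" by (simp add: power2_eq_square algebra_simps)
  thus ?thesis
    unfolding hecke_g_arg_def ratio_def X_def P_def Q_def tri_Suc tri_add[of n p] tri_n
    by (simp only: m, intro eq) (simp_all add: n_eq algebra_simps mult_self_eq_tri[of p])
qed

lemma jtheta_ratio_mult_hecke_g: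
  assumes xy: "x \<noteq> 0" "y \<noteq> 0" and nz: "jtheta (ratio x y) P \<noteq> 0"
  shows "jtheta (ratio x y) P * hecke_g n (n + p) n x y q (ratio x y) (ratio y x) =
    half_g x y - ratio x y * half_g y x"
proof -
  let ?j = "jtheta (ratio x y) P"
  have base: "q powi (n * ((n + p)\<^sup>2 - n * n)) = P"
    unfolding P_def Q_def by (simp add: power_int_mult[symmetric] power2_eq_square algebra_simps)
  have appell_m_eq: "appell_m (hecke_g_arg n (n + p) n x y q t) P (ratio y x) = appell y x t / jtheta (ratio y x) P"
    if "x \<noteq> 0" "y \<noteq> 0" for x y t
    unfolding appell_m_def appell_def hecke_g_arg_eq[OF that] theta_term_def by simp
  have "hecke_g n (n + p) n x y q (ratio x y) (ratio y x) = half_g y x / jtheta (ratio y x) P + half_g x y / ?j"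
  proof -
    have "{0..n - 1} = {0..<n}" by auto
    thus ?thesis
      unfolding hecke_g_def base appell_m_eq[OF xy] appell_m_eq[OF xy(2,1)]
        half_g_def hecke_row_def sum_divide_distrib
      by simp
  qed
  thus ?thesis
    using jtheta_ratio_swap[OF xy] ratio_nonzero[OF xy] nz by (simp add: field_simps)
qed

end


section \<open>The case \<open>p = 4\<close>\<close>

locale odd_hecke_sums_4 = odd_hecke_sums q n h 4 for q :: complex and n h :: int
begin

definition \<rho> :: complex where "\<rho> = q powi (2 * n + 4)"

definition a :: complex where "a = q powi (n + 4)"

abbreviation prefactor :: "complex \<Rightarrow> complex \<Rightarrow> complex" where
  "prefactor x y \<equiv> q powi (- (n\<^sup>2 + n - 3)) * x powi (1 - h) * y powi (h + 1)"

abbreviation J4n :: complex where "J4n \<equiv> J2 (4 * n) (16 * n) q"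

abbreviation J8n :: complex where "J8n \<equiv> J2 (8 * n) (16 * n) q"

text \<open>\<open>j(y^n/x^n;P) j(X y;Q) \<Theta>\<^sub>n\<^sub>,\<^sub>4(x,y,q)\<close>\<close>
definition Theta4_numerator :: "complex \<Rightarrow> complex \<Rightarrow> complex" where
  "Theta4_numerator x y = prefactor x y / jtheta (X x) Q *
     (J4n * theta_S1 \<rho> (y / x) (a * x * y)
      - q\<^sup>2 * J8n * (y * theta_S2 \<rho> (y / x) (a * x * y)))"

lemma rho: "norm \<rho> < 1" "\<rho> \<noteq> 0" "\<rho> ^ 4 = Q"
  unfolding \<rho>_def Q_def using q n_pos power_int_mult[of q "2 * n + 4" 4]
  by (auto intro!: norm_power_int_less_1 simp: mult.commute)

lemma a_nonzero: "a \<noteq> 0"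
  using q by (simp add: a_def)

lemma X_4: "X z = - (a\<^sup>2 * z ^ 4)"
proof -
  have "q powi (tri 4 + 4 * (h + 1)) = a\<^sup>2"
    unfolding a_def using power_int_mult[of q "n + 4" 2] by (simp add: tri_def n_eq algebra_simps)
  thus ?thesis by (simp add: X_def)
qed

lemma X_mult_rho: "X (\<rho> * z) = Q * X z"
  by (simp add: X_4 power_mult_distrib rho)

lemma regular_mult_rho: "regular (\<rho> * z) \<longleftrightarrow> regular z"
  using jtheta_mult_base[OF norm_Q Q_nonzero X_nonzero, of z] rho X_nonzero[of z]
  by (auto simp: regular_def X_mult_rho)

lemma Theta4_numerator_analytic:
  assumes "regular x" "y \<noteq> 0"
  shows "Theta4_numerator x analytic_on {y}"
  unfolding Theta4_numerator_def[abs_def] using assms a_nonzero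
  by (intro analytic_intros theta_S_analytic rho) (auto simp: regular_def)

lemma Theta4_numerator_mult_snd:
  assumes x: "x \<noteq> 0" and y: "y \<noteq> 0"
  shows "Theta4_numerator x (Q * y) / jtheta (X (Q * y)) Q = multiplier x * (Theta4_numerator x y / jtheta (X y) Q)"
proof -
  let ?u = "y / x" and ?z = "a * x * y"
  let ?K = "\<rho> ^ 24 * ?u ^ 6 * ?z ^ 10"
  have uz: "?u \<noteq> 0" "?z \<noteq> 0" using x y a_nonzero by simp_all
  have args: "Q * y / x = \<rho> ^ 4 * ?u" "a * x * (Q * y) = \<rho> ^ 4 * ?z" by (simp_all add: rho(3))
  have shift_S2: "Q * y * theta_S2 \<rho> (\<rho> ^ 4 * ?u) (\<rho> ^ 4 * ?z) = - (y * theta_S2 \<rho> ?u ?z) / ?K"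
    unfolding theta_S_shift_both(2)[OF rho(1,2) uz] using rho(2) by (simp add: eval_nat_numeral flip: rho(3))
  have numerator: "Theta4_numerator x (Q * y) = Q powi (h + 1) * (- 1 / ?K) * Theta4_numerator x y"
    unfolding Theta4_numerator_def args shift_S2 theta_S_shift_both(1)[OF rho(1,2) uz] power_int_mult_distrib
    by (simp add: divide_inverse algebra_simps)
  have denominator: "jtheta (X (Q * y)) Q = jtheta (X y) Q / (Q ^ 6 * X y ^ 4)"
    unfolding X_mult_Q using jtheta_shift[OF norm_Q Q_nonzero X_nonzero[OF y], of 4]
    by (simp add: tri_def power_int_minus field_simps)
  have K_eq: "?K = - X x * (Q ^ 6 * X y ^ 4)"
    unfolding X_4 using x by (simp add: power_mult_distrib power_divide eval_nat_numeral flip: rho(3))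
  show ?thesis
    unfolding numerator denominator K_eq using Q_nonzero X_nonzero[OF x] X_nonzero[OF y] by simp
qed

lemma Theta4_numerator_mult_both:
  assumes x: "x \<noteq> 0" and y: "y \<noteq> 0"
  shows "Theta4_numerator (\<rho> * x) (\<rho> * y) = Theta4_numerator x y / (a ^ 3 * x * y ^ 5)"
proof -
  let ?u = "y / x" and ?z = "a * x * y"
  have uz: "?u \<noteq> 0" "?z \<noteq> 0" using x y a_nonzero by simp_all
  have args: "\<rho> * y / (\<rho> * x) = ?u" "a * (\<rho> * x) * (\<rho> * y) = \<rho>\<^sup>2 * ?z"
    using rho(2) by (simp_all add: power2_eq_square)
  have shift_S2: "\<rho> * y * theta_S2 \<rho> ?u (\<rho>\<^sup>2 * ?z) = y * theta_S2 \<rho> ?u ?z / (\<rho>\<^sup>2 * ?z ^ 5)"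
    unfolding theta_S_shift_z(2)[OF rho(1,2) uz] using rho(2) by (simp add: eval_nat_numeral)
  have "(\<rho> * x) powi (1 - h) * (\<rho> * y) powi (h + 1) = \<rho>\<^sup>2 * (x powi (1 - h) * y powi (h + 1))"
    unfolding power_int_mult_distrib using rho(2) power_int_add[of \<rho> "1 - h" "h + 1"] by simp
  moreover have "jtheta (X (\<rho> * x)) Q = - jtheta (X x) Q / X x"
    unfolding X_mult_rho by (rule jtheta_mult_base[OF norm_Q Q_nonzero X_nonzero[OF x]])
  ultimately have prefactor_mult: "prefactor (\<rho> * x) (\<rho> * y) / jtheta (X (\<rho> * x)) Q =
      - X x * \<rho>\<^sup>2 * (prefactor x y / jtheta (X x) Q)"
    by (simp add: mult.assoc)
  have bracket: "j * (theta_S1 \<rho> ?u ?z / (\<rho>\<^sup>2 * ?z ^ 5)) - k * (y * theta_S2 \<rho> ?u ?z / (\<rho>\<^sup>2 * ?z ^ 5)) =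
      (j * theta_S1 \<rho> ?u ?z - k * (y * theta_S2 \<rho> ?u ?z)) / (\<rho>\<^sup>2 * ?z ^ 5)" for j k
    by (simp only: diff_divide_distrib times_divide_eq_right)
  have cancel: "- c * r * A * (B / (r * Z)) = - c / Z * (A * B)" if "r \<noteq> 0" for c r A B Z :: complex
    using that by simp
  have "Theta4_numerator (\<rho> * x) (\<rho> * y) = - X x / ?z ^ 5 * Theta4_numerator x y"
    unfolding Theta4_numerator_def args shift_S2 theta_S_shift_z(1)[OF rho(1,2) uz] prefactor_mult bracket
    by (rule cancel) (use rho(2) in simp)
  also have "- X x / ?z ^ 5 = 1 / (a ^ 3 * x * y ^ 5)"
    unfolding X_4 using x a_nonzero by (simp add: power_mult_distrib eval_nat_numeral)
  finally show ?thesis by simp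
qed

lemma row_at_pole_0:
  assumes xy: "x \<noteq> 0" "y \<noteq> 0" and v: "v = a * y\<^sup>2" "v\<^sup>2 = -1"
  shows "prefactor x y * (y / x) * (q\<^sup>2 * y * J8n - (1 + v) * J4n) = - row x y (- h)"
proof -
  define m where "m = monomial x y q"
  note m = monomial_rules[OF xy q(2) m_def] and eq = monomial_eqI[OF m_def]
  define c where "c = q powi (n + 2) * y"
  have c: "c \<noteq> 0" using xy q by (simp add: c_def)
  have c_squared: "c\<^sup>2 = v * q powi n" and v_eq: "v = q\<^sup>2 * y * c"
    unfolding c_def v(1) a_def by (simp only: m, rule eq, simp_all add: algebra_simps)+
  have "1 + v = v * (1 - v)" using v(2) by (simp add: algebra_simps power2_eq_square)
  hence v_plus_1: "1 + v = q\<^sup>2 * y * (c * (1 - v))" using v_eq by simp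
  have J2_eq: "J8n = jtheta ((q powi n) ^ 8) ((q powi n) ^ 16)"
    "J4n = jtheta ((q powi n) ^ 4) ((q powi n) ^ 16)"
    unfolding J2_def by (simp_all add: power_int_mult mult.commute[of _ n])
  have theta_c: "q\<^sup>2 * y * J8n - (1 + v) * J4n = q\<^sup>2 * y * jtheta c (q powi n)"
    unfolding J2_eq v_plus_1 jtheta_eighth_root[OF norm_q_n q_n_nonzero v(2) c_squared] by (simp add: algebra_simps)
  have "q powi ((n + 4) * (- h)) * y = (q powi n) powi (- h - 3) * c"
    unfolding c_def by (simp only: m, rule eq) (simp_all add: n_eq algebra_simps)
  hence shift: "jtheta (q powi ((n + 4) * (- h)) * y) (q powi n) =
      (-1) powi (- h - 3) * (q powi n) powi (- tri (- h - 3)) * c powi (- (- h - 3)) * jtheta c (q powi n)"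
    using jtheta_shift[OF norm_q_n q_n_nonzero c, of "- h - 3"] by (simp only:)
  have mono: "prefactor x y * (y / x) * (q\<^sup>2 * y) =
     - ((- x) powi (- h) * q powi (n * tri (- h)) *
       ((-1) powi (- h - 3) * (q powi n) powi (- tri (- h - 3)) * c powi (- (- h - 3))))"
    unfolding c_def tri_diff tri_uminus
    by (simp only: m, rule eq) (simp_all add: n_eq tri_def[of 3] power2_eq_square algebra_simps)
  show ?thesis
    unfolding theta_c hecke_row_def shift using mono by (simp only: mult.assoc[symmetric] mult_minus_left)
qed

lemma Theta4_numerator_at_pole_0:
  assumes x: "regular x" and y: "y \<noteq> 0" "X y = 1"
  shows "Theta4_numerator x y = - (qpoch_inf Q Q ^ 3) * row x y (- h)"
proof -
  have xy: "x \<noteq> 0" "y \<noteq> 0" "jtheta (X x) Q \<noteq> 0" using x y by (simp_all add: regular_def)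
  define u v where "u = y / x" and "v = a * y\<^sup>2"
  let ?E = "qpoch_inf Q Q ^ 3"
  have u: "u \<noteq> 0" using xy by (simp add: u_def)
  have v: "v\<^sup>2 = -1"
    using y(2) by (simp add: X_4 v_def power_mult_distrib minus_equation_iff[of _ 1] flip: power_mult)
  have z: "a * x * y = v / u" using xy by (simp add: u_def v_def power2_eq_square)
  have X_x: "X x = 1 / u ^ 4"
    using v xy unfolding X_4 u_def v_def by (simp add: power_mult_distrib power_divide field_simps flip: power_mult)
  have quotient: "jtheta (u ^ 4) Q / u ^ 3 = - u * jtheta (X x) Q"
    unfolding X_x using jtheta_inverse[OF norm_Q, of "u ^ 4"] u by (simp add: eval_nat_numeral)
  have theta_S: "theta_S1 \<rho> u (v / u) = - ((1 + v) * ?E * u * jtheta (X x) Q)"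
    "theta_S2 \<rho> u (v / u) = - (?E * u * jtheta (X x) Q)"
    unfolding theta_S1_special_value[OF rho(1,2) u v] theta_S2_special_value[OF rho(1,2) u v] rho(3)
      times_divide_eq_right[symmetric] quotient by simp_all
  have "Theta4_numerator x y = prefactor x y / jtheta (X x) Q *
      (J4n * - ((1 + v) * ?E * u * jtheta (X x) Q) - q\<^sup>2 * J8n * (y * - (?E * u * jtheta (X x) Q)))"
    unfolding Theta4_numerator_def z theta_S u_def[symmetric] ..
  also have "\<dots> = ?E * (prefactor x y * u * (q\<^sup>2 * y * J8n - (1 + v) * J4n))"
    using xy(3) by (simp add: field_simps)
  also have "\<dots> = - ?E * row x y (- h)"
    unfolding u_def row_at_pole_0[OF xy(1,2) v_def v] by simp
  finally show ?thesis .
qed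

lemma Theta4_numerator_at_pole_translate:
  assumes xy: "x \<noteq> 0" "y \<noteq> 0" and pole: "X y = Q powi k"
  shows "Theta4_numerator x y = jtheta_cofactor Q k (Q powi k) * row x y (- h - k) \<longleftrightarrow>
    Theta4_numerator (\<rho> * x) (\<rho> * y) =
      jtheta_cofactor Q (k + 1) (Q powi (k + 1)) * row (\<rho> * x) (\<rho> * y) (- h - (k + 1))"
proof -
  have "jtheta_cofactor Q (k + 1) (Q powi (k + 1)) = jtheta_cofactor Q k (Q powi k) / (a\<^sup>2 * y ^ 4)"
    unfolding jtheta_cofactor_at_zero_Suc[OF Q_nonzero] unfolding pole[symmetric] by (simp add: X_4)
  moreover have "row (\<rho> * x) (\<rho> * y) (- h - (k + 1)) = row x y (- h - k) / (a * x * y)"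
    using row_mult_both[OF xy, of "- h - (k + 1)"] by (simp add: \<rho>_def a_def)
  ultimately have "jtheta_cofactor Q (k + 1) (Q powi (k + 1)) * row (\<rho> * x) (\<rho> * y) (- h - (k + 1)) =
      jtheta_cofactor Q k (Q powi k) * row x y (- h - k) / (a ^ 3 * x * y ^ 5)"
    by (simp add: eval_nat_numeral)
  thus ?thesis
    unfolding Theta4_numerator_mult_both[OF xy] using xy a_nonzero by simp
qed

lemma Theta4_numerator_at_pole:
  assumes "regular x" "y \<noteq> 0" "X y = Q powi k"
  shows "Theta4_numerator x y = jtheta_cofactor Q k (X y) * row x y (- h - k)"
proof -
  define at_pole where "at_pole k x y \<longleftrightarrow> regular x \<and> y \<noteq> 0 \<and> X y = Q powi k" for k x y
  define claim where "claim k x y \<longleftrightarrow> (at_pole k x y \<longrightarrow>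
    Theta4_numerator x y = jtheta_cofactor Q k (Q powi k) * row x y (- h - k))" for k x y
  have at_pole: "at_pole (k + 1) (\<rho> * x) (\<rho> * y) \<longleftrightarrow> at_pole k x y" for k x y
    using Q_nonzero rho(2) by (simp add: at_pole_def X_mult_rho regular_mult_rho power_int_add)
  have translate: "claim k x y \<longleftrightarrow> claim (k + 1) (\<rho> * x) (\<rho> * y)" for k x y
    unfolding claim_def at_pole
    using Theta4_numerator_at_pole_translate[of x y k] regular_nonzero[of x] by (auto simp: at_pole_def)
  have "\<forall>x y. claim k x y" for k
  proof (induction k rule: int_step_induct)
    case 1
    show ?case
      unfolding claim_def at_pole_def using Theta4_numerator_at_pole_0
      by (simp add: jtheta_cofactor_at_zero[OF Q_nonzero, of 0, simplified])
  next
    case (2 k)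
    show ?case
    proof (intro iffI allI)
      fix x y assume "\<forall>x y. claim k x y"
      thus "claim (k + 1) x y" using translate[of k "x / \<rho>" "y / \<rho>"] rho(2) by simp
    next
      fix x y assume "\<forall>x y. claim (k + 1) x y"
      thus "claim k x y" using translate[of k x y] by blast
    qed
  qed
  thus ?thesis using assms unfolding claim_def at_pole_def by simp
qed

lemma q_powers:
  "q powi (2 * (2 * n + 4)) = \<rho>\<^sup>2" "q powi (4 * (2 * n + 4)) = \<rho> ^ 4" "q powi (8 * (2 * n + 4)) = \<rho> ^ 8"
  "q powi (2 * n + 8) = a\<^sup>2" "q powi (3 * n + 8) = \<rho> * a"
  "q powi (6 * n + 16) = \<rho>\<^sup>2 * a\<^sup>2" "q powi (n + 1) = q * \<rho> / a"
proof -
  define m where "m = monomial 1 1 q"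
  note m = monomial_rules(3-)[OF one_neq_zero one_neq_zero q(2) m_def] and eq = monomial_eqI[OF m_def]
  show "q powi (2 * (2 * n + 4)) = \<rho>\<^sup>2" "q powi (4 * (2 * n + 4)) = \<rho> ^ 4" "q powi (8 * (2 * n + 4)) = \<rho> ^ 8"
    "q powi (2 * n + 8) = a\<^sup>2" "q powi (3 * n + 8) = \<rho> * a"
    "q powi (6 * n + 16) = \<rho>\<^sup>2 * a\<^sup>2" "q powi (n + 1) = q * \<rho> / a"
    unfolding \<rho>_def a_def by (simp only: m, rule eq; simp)+
qed

lemma P_4: "q powi (4 * n * (2 * n + 4)) = P"
  unfolding P_def Q_def by (simp add: power_int_mult[symmetric] algebra_simps)

lemma J1_powers:
  "J1 (2 * (2 * n + 4)) q = qpoch_inf (\<rho>\<^sup>2) (\<rho>\<^sup>2)" "J1 (4 * (2 * n + 4)) q = qpoch_inf (\<rho> ^ 4) (\<rho> ^ 4)"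
  "J1 (8 * (2 * n + 4)) q = qpoch_inf (\<rho> ^ 8) (\<rho> ^ 8)"
proof -
  have "J1 (k * (2 * n + 4)) q = qpoch_inf (q powi (k * (2 * n + 4))) (q powi (k * (2 * n + 4)))" if "k > 0" for k
    using that n_pos by (intro J1_eq_qpoch_inf q mult_pos_pos) auto
  from this[of 2] this[of 4] this[of 8]
  show "J1 (2 * (2 * n + 4)) q = qpoch_inf (\<rho>\<^sup>2) (\<rho>\<^sup>2)" "J1 (4 * (2 * n + 4)) q = qpoch_inf (\<rho> ^ 4) (\<rho> ^ 4)"
    "J1 (8 * (2 * n + 4)) q = qpoch_inf (\<rho> ^ 8) (\<rho> ^ 8)"
    unfolding q_powers by simp_all
qed

lemma jtheta_mult_S1:
  assumes "x \<noteq> 0" "y \<noteq> 0"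
  shows "jtheta (y / x) (\<rho> ^ 4) * S1 n x y q = theta_S1 \<rho> (y / x) (a * x * y)"
proof -
  have "a * x * y / (y / x) = a * x\<^sup>2" using assms by (simp add: power2_eq_square)
  thus ?thesis
    unfolding theta_S1_def S1_def Let_def q_powers J1_powers a_def[symmetric]
    by (simp add: power_mult_distrib power_divide mult.assoc)
qed

lemma jtheta_mult_S2:
  assumes "x \<noteq> 0" "y \<noteq> 0"
  shows "jtheta (y / x) (\<rho> ^ 4) * S2 n x y q = q * (y * theta_S2 \<rho> (y / x) (a * x * y))"
proof -
  have "\<rho> / (a * x * y * (y / x)) = \<rho> / a / y\<^sup>2" "1 / (y / x) = x / y"
    using assms by (simp_all add: power2_eq_square)
  thus ?thesis
    unfolding theta_S2_def S2_def Let_def q_powers J1_powers a_def[symmetric] using assms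
    by (simp add: power_mult_distrib power_divide mult.assoc) (simp add: field_simps power2_eq_square)
qed

lemma jtheta_ratio_mult_Theta4:
  assumes xy: "x \<noteq> 0" "y \<noteq> 0" and nz: "jtheta (ratio x y) P \<noteq> 0"
  shows "jtheta (ratio x y) P * Theta4 n x y q = Theta4_numerator x y / jtheta (X y) Q"
proof -
  have exponents: "- ((n - 3) div 2) = 1 - h" "(n + 1) div 2 = h + 1" by (simp_all add: n_eq)
  have "jtheta (y / x) Q * (J4n * S1 n x y q - q * J8n * S2 n x y q) =
      J4n * (jtheta (y / x) Q * S1 n x y q) - q * J8n * (jtheta (y / x) Q * S2 n x y q)"
    by (simp add: algebra_simps)
  also have "\<dots> = J4n * theta_S1 \<rho> (y / x) (a * x * y)
      - q\<^sup>2 * J8n * (y * theta_S2 \<rho> (y / x) (a * x * y))"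
    using jtheta_mult_S1[OF xy] jtheta_mult_S2[OF xy] by (simp add: rho(3) power2_eq_square)
  finally have numerator: "Theta4_numerator x y = prefactor x y / jtheta (X x) Q *
      (jtheta (y / x) Q * (J4n * S1 n x y q - q * J8n * S2 n x y q))"
    by (simp only: Theta4_numerator_def)
  show ?thesis
    unfolding numerator Theta4_def Let_def P_4 exponents q_powers rho(3) X_4 ratio_def[symmetric] using nz by simp
qed

lemma Theta4_no_pole_iff:
  assumes "x \<noteq> 0" "y \<noteq> 0"
  shows "Theta4_no_pole n x y q \<longleftrightarrow> regular x \<and> regular y \<and> jtheta (ratio x y) P \<noteq> 0"
  unfolding Theta4_no_pole_def Let_def P_4 q_powers rho(3) regular_def X_4 ratio_def using assms by auto

end

theorem theorem0p14:
  fixes n :: int and q x y :: complex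
  assumes "0 < norm q" and "norm q < 1"
    and "n > 0" and "odd n"
    and "x \<noteq> 0" and "y \<noteq> 0"
    and "hecke_g_no_pole n (n + 4) n x y q (y powi n / x powi n) (x powi n / y powi n)"
    and "Theta4_no_pole n x y q"
  shows "hecke_f n (n + 4) n x y q =
    hecke_g n (n + 4) n x y q (y powi n / x powi n) (x powi n / y powi n) - Theta4 n x y q"
proof -
  obtain h where h: "n = 2 * h + 1" using \<open>odd n\<close> by (elim oddE)
  interpret odd_hecke_sums_4 q n h
    by unfold_locales (use assms h in auto)
  let ?j = "jtheta (ratio x y) P"
  have generic: "regular x" "regular y" "?j \<noteq> 0"
    using assms(8) Theta4_no_pole_iff[OF assms(5,6)] by blast+
  have "defect x y = - (Theta4_numerator x y / jtheta (X y) Q)"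
    by (intro defect_eq generic assms(5)
        Theta4_numerator_analytic Theta4_numerator_mult_snd Theta4_numerator_at_pole)
  hence "?j * f x y = ?j * (hecke_g n (n + 4) n x y q (ratio x y) (ratio y x) - Theta4 n x y q)"
    unfolding right_diff_distrib jtheta_ratio_mult_hecke_g[OF assms(5,6) generic(3)]
      jtheta_ratio_mult_Theta4[OF assms(5,6) generic(3)] by (simp add: defect_def algebra_simps)
  thus ?thesis
    using generic(3) by (simp add: f_def ratio_def)
qed

end
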